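(* There are absolute constants $0<c<C<\infty$ (independent of $n$ and $p$) such that for every $n\ge1$: (a) $c\log(n+1)\le w_3(\ell_p^n)\le Cp\log(n+1)$ if $p=1$ or $2\le p<\infty$; (b) $c\log(n+1)\le w_3(\ell_\infty^n)\le C(\log(n+1))^2$.
   Context: $\ell_p^n$ is $\mathbb R^n$ with the usual $p$-norm. For a finite-dimensional real Banach space $X$ with closed unit ball $B_X$ and $f\in C(B_X)$ (continuous real-valued), let $E_3(f;B_X)=\inf_\varphi\max_{x\in B_X}|f(x)-\varphi(x)|$, the infimum over all real polynomials $\varphi$ on $X$ of total degree at most $2$; let $\Delta_h^3(f;x)=\sum_{j=0}^3(-1)^{3-j}\binom 3j f(x+jh)$ and $\omega_3(f;B_X)=\sup|\Delta_h^3(f;x)|$, the supremum over all $x,h\in X$ with $x,x+h,x+2h,x+3h\in B_X$. The Whitney constant is $w_3(X)=\sup\{E_3(f;B_X): f\in C(B_X),\ \omega_3(f;B_X)\le1\}$. *)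

theory Defs
  imports "HOL-Analysis.Analysis"
begin

text \<open>
  Since the dimension is quantified inside the statement, a point of \<open>\<real>\<^sup>n\<close> is a sequence vanishing
  from index \<open>n\<close> on, and an \<open>n\<close>-dimensional real Banach space is \<open>\<real>\<^sup>n\<close> with a norm \<open>N\<close>.
\<close>

definition real_space :: "nat \<Rightarrow> (nat \<Rightarrow> real) set" where
  "real_space n = {x. \<forall>i\<ge>n. x i = 0}"

definition lp_norm :: "nat \<Rightarrow> real \<Rightarrow> (nat \<Rightarrow> real) \<Rightarrow> real" where
  "lp_norm n p x = (\<Sum>i<n. \<bar>x i\<bar> powr p) powr (1 / p)"

text \<open>Meaningful for \<open>n \<ge> 1\<close> only: the maximum over the empty set is unspecified.\<close>

definition linf_norm :: "nat \<Rightarrow> (nat \<Rightarrow> real) \<Rightarrow> real" where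
  "linf_norm n x = Max ((\<lambda>i. \<bar>x i\<bar>) ` {..<n})"

definition unit_cball :: "nat \<Rightarrow> ((nat \<Rightarrow> real) \<Rightarrow> real) \<Rightarrow> (nat \<Rightarrow> real) set" where
  "unit_cball n N = {x \<in> real_space n. N x \<le> 1}"

text \<open>Functions are total here; only their values on the unit ball matter.\<close>

definition cont_on_ball :: "nat \<Rightarrow> ((nat \<Rightarrow> real) \<Rightarrow> real) \<Rightarrow> ((nat \<Rightarrow> real) \<Rightarrow> real) set" where
  "cont_on_ball n N =
     {f. continuous_map
           (subtopology (Metric_space.mtopology (real_space n) (\<lambda>x y. N (\<lambda>i. x i - y i)))
              (unit_cball n N))
           euclideanreal f}"

definition multi_indices :: "nat \<Rightarrow> nat \<Rightarrow> (nat \<Rightarrow> nat) set" where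
  "multi_indices n d = {\<alpha>. (\<forall>i\<ge>n. \<alpha> i = 0) \<and> (\<Sum>i<n. \<alpha> i) \<le> d}"

lemma finite_multi_indices: "finite (multi_indices n d)"
proof (rule finite_subset)
  have "\<alpha> i \<le> d" if "\<alpha> \<in> multi_indices n d" "i < n" for \<alpha> i
    using that member_le_sum[of i "{..<n}" \<alpha>] by (force simp: multi_indices_def)
  then show "multi_indices n d \<subseteq> {\<alpha>. \<forall>i. (i \<in> {..<n} \<longrightarrow> \<alpha> i \<in> {..d}) \<and> (i \<notin> {..<n} \<longrightarrow> \<alpha> i = 0)}"
    by (auto simp: multi_indices_def)
  show "finite {\<alpha>. \<forall>i. (i \<in> {..<n} \<longrightarrow> \<alpha> i \<in> {..d}) \<and> (i \<notin> {..<n} \<longrightarrow> \<alpha> i = (0::nat))}"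
    by (rule finite_set_of_finite_funs) auto
qed

definition polys_upto :: "nat \<Rightarrow> nat \<Rightarrow> ((nat \<Rightarrow> real) \<Rightarrow> real) set" where
  "polys_upto n d =
     {\<phi>. \<exists>a :: (nat \<Rightarrow> nat) \<Rightarrow> real.
           \<phi> = (\<lambda>x. \<Sum>\<alpha>\<in>multi_indices n d. a \<alpha> * (\<Prod>i<n. x i ^ \<alpha> i))}"

text \<open>
  Suprema and infima are taken in \<^typ>\<open>ereal\<close>, so that their finiteness is not presupposed.
\<close>

definition E3 :: "nat \<Rightarrow> ((nat \<Rightarrow> real) \<Rightarrow> real) \<Rightarrow> ((nat \<Rightarrow> real) \<Rightarrow> real) \<Rightarrow> ereal" where
  "E3 n N f = (INF \<phi>\<in>polys_upto n 2. SUP x\<in>unit_cball n N. ereal \<bar>f x - \<phi> x\<bar>)"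

definition shift :: "(nat \<Rightarrow> real) \<Rightarrow> nat \<Rightarrow> (nat \<Rightarrow> real) \<Rightarrow> nat \<Rightarrow> real" where
  "shift x j h = (\<lambda>i. x i + real j * h i)"

definition diff3 :: "((nat \<Rightarrow> real) \<Rightarrow> real) \<Rightarrow> (nat \<Rightarrow> real) \<Rightarrow> (nat \<Rightarrow> real) \<Rightarrow> real" where
  "diff3 f h x = (\<Sum>j\<le>3. (-1) ^ (3 - j) * real (3 choose j) * f (shift x j h))"

definition omega3 :: "nat \<Rightarrow> ((nat \<Rightarrow> real) \<Rightarrow> real) \<Rightarrow> ((nat \<Rightarrow> real) \<Rightarrow> real) \<Rightarrow> ereal" where
  "omega3 n N f =
     (SUP (x, h) \<in> {(x, h). x \<in> real_space n \<and> h \<in> real_space n \<and>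
                            (\<forall>j\<le>3. shift x j h \<in> unit_cball n N)}.
        ereal \<bar>diff3 f h x\<bar>)"

definition whitney3 :: "nat \<Rightarrow> ((nat \<Rightarrow> real) \<Rightarrow> real) \<Rightarrow> ereal" where
  "whitney3 n N = (SUP f \<in> {f \<in> cont_on_ball n N. omega3 n N f \<le> 1}. E3 n N f)"

end

theory Submission
  imports Defs "HOL-Library.Function_Algebras"
begin

text \<open>
  For the upper bounds, let the third differences of \<open>f\<close> be at most 1.  Then its mixed third
  differences near the origin are bounded, too.  This says that the odd part of \<open>f\<close> is approximately
  additive and that the polar form of the even part is approximately additive in each variable.
  Hence, near the origin and up to a bounded error, \<open>f x = f 0 + F x + \<beta> x x / 2\<close> with homogeneous
  \<open>F\<close> and \<open>\<beta>\<close> of this kind (\<open>homogeneous_decomposition\<close>), and a bound for the error near the origin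
  propagates to the whole ball (\<open>whitney3_upper\<close>).  It remains to approximate \<open>F\<close> by a linear form
  and \<open>\<beta> x x\<close> by a quadratic form.

  By duality a good linear form exists if \<open>\<Sum> F (x\<^sub>j)\<close> is small compared with \<open>\<Sum> N (x\<^sub>j)\<close> whenever
  \<open>\<Sum> x\<^sub>j = 0\<close>, and by Caratheodory only sums of at most \<open>n + 1\<close> terms matter.  Adding up such a sum
  along a balanced binary tree costs a constant for each of the \<open>O(log n)\<close> levels.  So \<open>F\<close> is within
  \<open>O(log n)\<close> of a linear form, for every norm (\<open>approx_by_linear_form\<close>).

  For quadratic forms the same duality asks for a comparison of \<open>\<Sum> G (x\<^sub>i)\<close> with \<open>\<Sum> G (y\<^sub>i)\<close>, where
  \<open>G x = \<beta> x x\<close>, for families of at most \<open>n\<^sup>2 + 1\<close> vectors such that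
  \<open>\<Sum> x\<^sub>i \<otimes> x\<^sub>i = \<Sum> y\<^sub>i \<otimes> y\<^sub>i\<close> (\<open>approx_by_quadratic_form\<close>).  In a space of type 2, where the mean of
  \<open>N (\<Sum> \<plusminus>x\<^sub>i)\<^sup>2\<close> is at most \<open>T \<Sum> N (x\<^sub>i)\<^sup>2\<close>, the approximate parallelogram law for \<open>G\<close> and the
  binary tree show that \<open>\<Sum> G (x\<^sub>i)\<close> is the mean of \<open>G (\<Sum> \<plusminus>x\<^sub>i)\<close> up to
  \<open>O(T log n) \<Sum> N (x\<^sub>i)\<^sup>2\<close> (\<open>rademacher_mean_quadratic\<close>).  With Gaussian coefficients in place of the
  signs the mean would depend on \<open>\<Sum> x\<^sub>i \<otimes> x\<^sub>i\<close> only.  The argument is carried out with an average over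
  the orthogonal group, which relates the two families (\<open>gram_congruence\<close>) and on which iterated
  finite averages serve as an approximate Haar measure (\<open>sums_over_congruent_tuples\<close>).  For
  \<open>2 \<le> p < \<infinity>\<close> Khinchine's inequality yields \<open>T = p\<close>; the norm of \<open>\<ell>\<^sub>\<infinity>\<^sup>n\<close> is equivalent to that
  of \<open>\<ell>\<^sub>p\<^sup>n\<close> with \<open>p\<close> of order \<open>log n\<close>, which is where the second logarithm comes from.  In \<open>\<ell>\<^sub>1\<^sup>n\<close>
  the matrix of \<open>\<beta>\<close> in the unit vectors can be used directly (\<open>approx_by_quadratic_l1\<close>).

  For the lower bound in \<open>\<ell>\<^sub>1\<^sup>n\<close> the example is Ribe's function \<open>\<Sum> x\<^sub>i ln \<bar>x\<^sub>i\<bar>\<close>, which is approximately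
  additive but vanishes at the unit vectors and has the value \<open>- ln n\<close> at their barycentre.  For \<open>p \<ge> 2\<close> its
  quadratic analogue \<open>\<Sum> t\<^sub>i\<^sup>2 ln \<bar>t\<^sub>i\<bar>\<close> is used, where the \<open>t\<^sub>i\<close> are coordinates in an orthogonal basis
  of vectors with entries \<open>\<plusminus>1\<close>; it is compared with quadratic forms on this basis and on a second
  one, all of whose vectors have coordinates of equal modulus (\<open>whitney3_lower_log\<close>).  Cubic
  polynomials take care of the finitely many \<open>n\<close> for which these bounds degenerate.
\<close>

section \<open>Seminorms on real vector spaces\<close>

text \<open>
  With the pointwise operations sequences form a real vector space, so the general part of the
  argument can be carried out in an arbitrary real vector space with a seminorm.  Seminorms, rather
  than norms, allow a norm on \<open>\<real>\<^sup>n\<close> to be evaluated at every sequence.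
\<close>

instantiation "fun" :: (type, real_vector) real_vector
begin

definition scaleR_fun :: "real \<Rightarrow> ('a \<Rightarrow> 'b) \<Rightarrow> 'a \<Rightarrow> 'b"
  where "scaleR_fun r f = (\<lambda>x. r *\<^sub>R f x)"

instance
  by standard (simp_all add: scaleR_fun_def plus_fun_def fun_eq_iff scaleR_add_left scaleR_add_right)

end

lemma scaleR_fun_apply [simp]: "(r *\<^sub>R f) x = r *\<^sub>R f x"
  by (simp add: scaleR_fun_def)

lemma sum_fun_apply: "(\<Sum>i\<in>I. f i) x = (\<Sum>i\<in>I. f i x)"
  for f :: "'i \<Rightarrow> 'a \<Rightarrow> 'b::comm_monoid_add"
  by (induction I rule: infinite_finite_induct) simp_all

locale seminorm =
  fixes N :: "'a::real_vector \<Rightarrow> real"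
  assumes triangle: "N (x + y) \<le> N x + N y"
    and scale: "N (r *\<^sub>R x) = \<bar>r\<bar> * N x"
begin

lemma zero [simp]: "N 0 = 0"
  using scale[of 0 0] by simp

lemma minus [simp]: "N (- x) = N x"
  using scale[of "-1" x] by simp

lemma nonneg [simp]: "0 \<le> N x"
  using triangle[of x "- x"] by simp

lemma minus_commute: "N (x - y) = N (y - x)"
  using minus[of "x - y"] by simp

lemma triangle_diff: "N (x - y) \<le> N x + N y"
  using triangle[of x "- y"] by simp

lemma abs_diff_le: "\<bar>N x - N y\<bar> \<le> N (x - y)"
  using triangle[of "x - y" y] triangle[of "y - x" x] minus_commute[of x y] by simp

lemma sum_le: "N (\<Sum>i\<in>I. x i) \<le> (\<Sum>i\<in>I. N (x i))"
proof (induction I rule: infinite_finite_induct)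
  case (insert i I)
  then show ?case
    using triangle[of "x i" "\<Sum>i\<in>I. x i"] by simp
qed simp_all

lemma scale_le: "\<bar>r\<bar> \<le> 1 \<Longrightarrow> N (r *\<^sub>R x) \<le> N x"
  by (simp add: scale mult_left_le_one_le)

lemma normalize: "0 < N x \<Longrightarrow> N ((1 / N x) *\<^sub>R x) = 1"
  by (simp add: scale)

end

section \<open>Third differences and approximately additive functions\<close>

definition third_diff :: "('a::real_vector \<Rightarrow> real) \<Rightarrow> 'a \<Rightarrow> 'a \<Rightarrow> real" where
  "third_diff f h x = f (x + 3 *\<^sub>R h) - 3 * f (x + 2 *\<^sub>R h) + 3 * f (x + h) - f x"

text \<open>
  This is Hyers' stability argument on an interval.  Subtracting a linear function one may assume
  \<open>a 1 = 0\<close>.  Let \<open>M\<close> be the supremum of \<open>\<bar>a\<bar>\<close>.  Doubling gives \<open>\<bar>a t\<bar> \<le> (M + \<delta>) / 2\<close> for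
  \<open>t \<le> 1/2\<close>, and comparing \<open>t\<close> with \<open>1 - t\<close> extends this to all \<open>t\<close> at the price of another
  \<open>\<delta>\<close>.  Hence \<open>M \<le> M/2 + 3\<delta>/2\<close>; the bound \<open>K\<close> makes \<open>M\<close> finite.
\<close>

lemma approx_additive_interval:
  fixes a :: "real \<Rightarrow> real"
  assumes add: "\<And>s t. 0 \<le> s \<Longrightarrow> 0 \<le> t \<Longrightarrow> s + t \<le> 1 \<Longrightarrow> \<bar>a (s + t) - a s - a t\<bar> \<le> \<delta>"
    and bound: "\<And>t. 0 \<le> t \<Longrightarrow> t \<le> 1 \<Longrightarrow> \<bar>a t\<bar> \<le> K"
    and t: "0 \<le> t" "t \<le> 1"
  shows "\<bar>a t - t * a 1\<bar> \<le> 3 * \<delta>"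
proof -
  define \<alpha> where "\<alpha> t = a t - t * a 1" for t
  have add': "\<bar>\<alpha> (s + t) - \<alpha> s - \<alpha> t\<bar> \<le> \<delta>" if "0 \<le> s" "0 \<le> t" "s + t \<le> 1" for s t
    using add[OF that] by (simp add: \<alpha>_def algebra_simps)
  have \<alpha>1: "\<alpha> 1 = 0"
    by (simp add: \<alpha>_def)
  have bdd: "bdd_above ((\<lambda>t. \<bar>\<alpha> t\<bar>) ` {0..1})"
  proof (rule bdd_aboveI2)
    fix t :: real assume "t \<in> {0..1}"
    then have "\<bar>a t\<bar> \<le> K" "\<bar>t * a 1\<bar> \<le> K"
      using bound[of t] bound[of 1] mult_left_le_one_le[of "\<bar>a 1\<bar>" t] by (auto simp: abs_mult)
    then show "\<bar>\<alpha> t\<bar> \<le> K + K"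
      unfolding \<alpha>_def by linarith
  qed
  define M where "M = (SUP t\<in>{0..1}. \<bar>\<alpha> t\<bar>)"
  have le_M: "\<bar>\<alpha> t\<bar> \<le> M" if "0 \<le> t" "t \<le> 1" for t
    unfolding M_def using bdd that by (intro cSUP_upper) auto
  have half: "\<bar>\<alpha> t\<bar> \<le> (M + \<delta>) / 2" if "0 \<le> t" "t \<le> 1/2" for t
    using add'[of t t] le_M[of "t + t"] that by auto
  have "0 \<le> \<delta>"
    using add'[of 0 0] by simp
  have "M \<le> (M + \<delta>) / 2 + \<delta>"
    unfolding M_def
  proof (rule cSUP_least)
    fix t :: real assume t: "t \<in> {0..1}"
    have "\<bar>\<alpha> t\<bar> \<le> (M + \<delta>) / 2 + \<delta>"
    proof (cases "t \<le> 1/2")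
      case True
      then show ?thesis
        using half[of t] t \<open>0 \<le> \<delta>\<close> by (smt (verit) atLeastAtMost_iff)
    next
      case False
      then have "\<bar>\<alpha> (1 - t)\<bar> \<le> (M + \<delta>) / 2" "\<bar>- \<alpha> t - \<alpha> (1 - t)\<bar> \<le> \<delta>"
        using half[of "1 - t"] add'[of t "1 - t"] \<alpha>1 t by auto
      then show ?thesis
        unfolding abs_le_iff by linarith
    qed
    then show "\<bar>\<alpha> t\<bar> \<le> ((SUP t\<in>{0..1}. \<bar>\<alpha> t\<bar>) + \<delta>) / 2 + \<delta>"
      unfolding M_def .
  qed auto
  then have "M \<le> 3 * \<delta>"
    by (simp add: field_simps)
  then show ?thesis
    using le_M[OF t] by (simp add: \<alpha>_def)
qed

context seminorm
begin

text \<open>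
  The polarization identity for differences: with \<open>h\<^sub>\<epsilon> = - \<epsilon>\<^sub>1 x - \<epsilon>\<^sub>2 y / 2 - \<epsilon>\<^sub>3 z / 3\<close> the mixed
  difference \<open>\<Delta>\<^sub>x \<Delta>\<^sub>y \<Delta>\<^sub>z f 0\<close> equals the sum over \<open>\<epsilon> \<in> {0,1}\<^sup>3\<close> of
  \<open>(-1)\<^bsup>\<bar>\<epsilon>\<bar>\<^esup> \<Delta>\<^sup>3 f\<close> with step \<open>h\<^sub>\<epsilon>\<close> at \<open>\<epsilon>\<^sub>1 x + \<epsilon>\<^sub>2 y + \<epsilon>\<^sub>3 z\<close>, because the \<open>k\<close>-th point of
  such a progression does not depend on \<open>\<epsilon>\<^sub>k\<close>.  The summand for \<open>\<epsilon> = 0\<close> vanishes.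
\<close>

lemma mixed_third_difference:
  assumes f: "\<And>x h. N x \<le> 4 \<Longrightarrow> N (x + h) \<le> 4 \<Longrightarrow> N (x + 2 *\<^sub>R h) \<le> 4 \<Longrightarrow> N (x + 3 *\<^sub>R h) \<le> 4
                \<Longrightarrow> \<bar>third_diff f h x\<bar> \<le> 1"
    and xyz: "N x \<le> 1" "N y \<le> 1" "N z \<le> 1"
  shows "\<bar>f (x + y + z) - f (x + y) - f (x + z) - f (y + z) + f x + f y + f z - f 0\<bar> \<le> 7"
proof -
  define v where "v a b c = a *\<^sub>R x + b *\<^sub>R y + c *\<^sub>R z" for a b c :: real
  define P where "P a b c = f (v a b c)" for a b c
  have N_v: "N (v a b c) \<le> 4" if "\<bar>a\<bar> + \<bar>b\<bar> + \<bar>c\<bar> \<le> 4" for a b c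
  proof -
    have "N (v a b c) \<le> \<bar>a\<bar> * N x + \<bar>b\<bar> * N y + \<bar>c\<bar> * N z"
      unfolding v_def using triangle[of "a *\<^sub>R x + b *\<^sub>R y" "c *\<^sub>R z"] triangle[of "a *\<^sub>R x" "b *\<^sub>R y"]
      by (simp add: scale)
    also have "\<dots> \<le> \<bar>a\<bar> * 1 + \<bar>b\<bar> * 1 + \<bar>c\<bar> * 1"
      using xyz by (intro add_mono mult_left_mono) auto
    finally show ?thesis
      using that by simp
  qed
  have line: "\<bar>P (-2 * a) (- b / 2) 0 - 3 * P (- a) 0 (c / 3) + 3 * P 0 (b / 2) (2 * c / 3) - P a b c\<bar> \<le> 1"
    if "a \<in> {0, 1}" "b \<in> {0, 1}" "c \<in> {0, 1}" for a b c
  proof -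
    let ?x = "v a b c" and ?h = "v (- a) (- b / 2) (- c / 3)"
    have pts: "?x + ?h = v 0 (b / 2) (2 * c / 3)" "?x + 2 *\<^sub>R ?h = v (- a) 0 (c / 3)"
      "?x + 3 *\<^sub>R ?h = v (-2 * a) (- b / 2) 0"
      by (auto simp: v_def algebra_simps simp flip: scaleR_add_left)
    have "\<bar>third_diff f ?h ?x\<bar> \<le> 1"
      by (rule f; (unfold pts)?; rule N_v; use that in auto)
    then show ?thesis
      unfolding third_diff_def pts P_def by simp
  qed
  have "\<bar>P 1 1 1 - P 1 1 0 - P 1 0 1 - P 0 1 1 + P 1 0 0 + P 0 1 0 + P 0 0 1 - P 0 0 0\<bar> \<le> 7"
    using line[of 1 1 1] line[of 1 1 0] line[of 1 0 1] line[of 0 1 1]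
      line[of 1 0 0] line[of 0 1 0] line[of 0 0 1] unfolding abs_le_iff by simp
  then show ?thesis
    by (simp add: P_def v_def)
qed

text \<open>The values of \<open>a\<close> on the unit sphere, extended positively homogeneously.\<close>

definition homog :: "('a \<Rightarrow> real) \<Rightarrow> 'a \<Rightarrow> real" where
  "homog a x = N x * a ((1 / N x) *\<^sub>R x)"

lemma homog_scaleR:
  assumes "\<And>x. a (- x) = - a x"
  shows "homog a (r *\<^sub>R x) = r * homog a x"
proof -
  consider "r = 0 \<or> N x = 0" | "r > 0" "N x > 0" | "r < 0" "N x > 0"
    using nonneg[of x] by linarith
  then show ?thesis
  proof cases
    case 3
    then have "(1 / N (r *\<^sub>R x)) *\<^sub>R (r *\<^sub>R x) = - ((1 / N x) *\<^sub>R x)"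
      by (simp add: scale)
    then show ?thesis
      using 3 assms by (simp add: homog_def scale)
  qed (auto simp: homog_def scale)
qed

lemma approx_additive_ray:
  assumes add: "\<And>x y. N x \<le> 1 \<Longrightarrow> N y \<le> 1 \<Longrightarrow> \<bar>a (x + y) - a x - a y\<bar> \<le> \<delta>"
    and bound: "\<And>x. N x \<le> 1 \<Longrightarrow> \<bar>a x\<bar> \<le> K"
    and "N x \<le> 1" "0 \<le> t" "t \<le> 1"
  shows "\<bar>a (t *\<^sub>R x) - t * a x\<bar> \<le> 3 * \<delta>"
proof -
  have N: "N (s *\<^sub>R x) \<le> 1" if "0 \<le> s" "s \<le> 1" for s
    using scale_le[of s x] that assms by auto
  have "\<bar>(\<lambda>t. a (t *\<^sub>R x)) t - t * (\<lambda>t. a (t *\<^sub>R x)) 1\<bar> \<le> 3 * \<delta>"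
    by (rule approx_additive_interval[where K = K])
      (use assms N in \<open>auto simp: scaleR_add_left\<close>)
  then show ?thesis by simp
qed

lemma homog_approx:
  assumes add: "\<And>x y. N x \<le> 1 \<Longrightarrow> N y \<le> 1 \<Longrightarrow> \<bar>a (x + y) - a x - a y\<bar> \<le> \<delta>"
    and bound: "\<And>x. N x \<le> 1 \<Longrightarrow> \<bar>a x\<bar> \<le> K"
    and x: "N x \<le> 1"
  shows "\<bar>homog a x - a x\<bar> \<le> 3 * \<delta>"
proof (cases "N x = 0")
  case False
  then have *: "N x > 0"
    using nonneg[of x] by linarith
  show ?thesis
    using approx_additive_ray[where a = a and \<delta> = \<delta> and K = K and x = "(1 / N x) *\<^sub>R x" and t = "N x", OF add bound] x * normalize[OF *]
    by (simp add: homog_def abs_minus_commute)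
next
  case True
  have "\<bar>a x\<bar> \<le> 3 * \<delta> + e" if e: "e > 0" for e
  proof -
    \<comment> \<open>all multiples of \<open>x\<close> lie in the unit ball, so \<open>a\<close> is bounded on the whole line through \<open>x\<close>\<close>
    define t where "t = min 1 (e / (\<bar>K\<bar> + 1))"
    have t: "0 < t" "t \<le> 1" "t * \<bar>K\<bar> \<le> e"
    proof -
      show "0 < t" "t \<le> 1" using e by (auto simp: t_def)
      have "t * \<bar>K\<bar> \<le> e / (\<bar>K\<bar> + 1) * \<bar>K\<bar>"
        by (intro mult_right_mono) (auto simp: t_def)
      also have "\<dots> \<le> e" using e by (simp add: field_simps)
      finally show "t * \<bar>K\<bar> \<le> e" .
    qed
    have "\<bar>a (t *\<^sub>R ((1 / t) *\<^sub>R x)) - t * a ((1 / t) *\<^sub>R x)\<bar> \<le> 3 * \<delta>"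
      using t True by (intro approx_additive_ray[where a = a and \<delta> = \<delta> and K = K, OF add bound]) (auto simp: scale)
    moreover have "\<bar>t * a ((1 / t) *\<^sub>R x)\<bar> \<le> t * \<bar>K\<bar>"
      using bound[of "(1 / t) *\<^sub>R x"] t True by (auto simp: abs_mult scale)
    ultimately show ?thesis using t by simp
  qed
  then have "\<bar>a x\<bar> \<le> 3 * \<delta>"
    by (rule field_le_epsilon)
  then show ?thesis
    using True by (simp add: homog_def)
qed

text \<open>By homogeneity it suffices to consider \<open>x\<close> and \<open>y\<close> with \<open>N x + N y = 1\<close>.  Then \<open>x\<close>, \<open>y\<close> and \<open>x + y\<close>
  lie in the unit ball, where \<open>a\<close> may be replaced by \<open>homog a\<close> three times.\<close>

lemma homog_approx_additive:
  assumes odd: "\<And>x. a (- x) = - a x"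
    and add: "\<And>x y. N x \<le> 1 \<Longrightarrow> N y \<le> 1 \<Longrightarrow> \<bar>a (x + y) - a x - a y\<bar> \<le> \<delta>"
    and bound: "\<And>x. N x \<le> 1 \<Longrightarrow> \<bar>a x\<bar> \<le> K"
  shows "\<bar>homog a (x + y) - homog a x - homog a y\<bar> \<le> 10 * \<delta> * (N x + N y)"
proof (cases "N x + N y = 0")
  case True
  then have "N x = 0" "N y = 0"
    using nonneg[of x] nonneg[of y] by linarith+
  then have "N (x + y) = 0"
    using triangle[of x y] nonneg[of "x + y"] by linarith
  then show ?thesis
    using \<open>N x = 0\<close> \<open>N y = 0\<close> by (simp add: homog_def)
next
  case False
  define s where "s = N x + N y"
  have s: "s > 0"
    using False nonneg[of x] nonneg[of y] unfolding s_def by linarith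
  define x' y' where "x' = (1 / s) *\<^sub>R x" and "y' = (1 / s) *\<^sub>R y"
  have eq: "x = s *\<^sub>R x'" "y = s *\<^sub>R y'" "x + y = s *\<^sub>R (x' + y')"
    using s by (auto simp: x'_def y'_def scaleR_add_right)
  have N: "N x' \<le> 1" "N y' \<le> 1" "N (x' + y') \<le> 1"
  proof -
    show "N x' \<le> 1" "N y' \<le> 1"
      using s nonneg[of x] nonneg[of y] by (auto simp: x'_def y'_def scale s_def field_simps)
    have "N (x' + y') \<le> N x' + N y'" by (rule triangle)
    also have "\<dots> = 1"
      using s by (simp add: x'_def y'_def scale s_def flip: add_divide_distrib)
    finally show "N (x' + y') \<le> 1" .
  qed
  have approx: "\<bar>homog a z - a z\<bar> \<le> 3 * \<delta>" if "N z \<le> 1" for z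
    by (rule homog_approx[where K = K]) (use add bound that in auto)
  note hom = homog_scaleR[of a, OF odd]
  have "\<bar>homog a (x' + y') - homog a x' - homog a y'\<bar> \<le> 10 * \<delta>"
    using approx[OF N(1)] approx[OF N(2)] approx[OF N(3)] add[OF N(1,2)] by linarith
  then have "s * \<bar>homog a (x' + y') - homog a x' - homog a y'\<bar> \<le> s * (10 * \<delta>)"
    using s by simp
  moreover have "homog a (x + y) - homog a x - homog a y
      = s * (homog a (x' + y') - homog a x' - homog a y')"
    unfolding eq(3) hom using eq(1,2) hom
    by (metis right_diff_distrib)
  ultimately show ?thesis
    using s by (simp add: abs_mult s_def mult_ac)
qed

definition odd_part :: "('a \<Rightarrow> real) \<Rightarrow> 'a \<Rightarrow> real" where
  "odd_part f x = (f x - f (- x)) / 2"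

text \<open>The polar form of the even part of \<open>f\<close>; for a quadratic form it is the bilinear form itself.\<close>

definition polar :: "('a \<Rightarrow> real) \<Rightarrow> 'a \<Rightarrow> 'a \<Rightarrow> real" where
  "polar f x y = (f (x + y) + f (- x - y) - f (x - y) - f (y - x)) / 4"

definition bihomog :: "('a \<Rightarrow> 'a \<Rightarrow> real) \<Rightarrow> 'a \<Rightarrow> 'a \<Rightarrow> real" where
  "bihomog b x y = homog (\<lambda>x'. homog (b x') y) x"

lemma polar_commute: "polar f x y = polar f y x"
proof -
  have e: "x + y = y + x" "- x - y = - y - x"
    by simp_all
  show ?thesis
    unfolding polar_def e by simp
qed

lemma polar_minus: "polar f (- x) y = - polar f x y"
proof -
  have e: "- x + y = y - x" "- (- x) - y = x - y" "y - (- x) = x + y"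
    by simp_all
  show ?thesis
    unfolding polar_def e by (simp add: add_divide_distrib diff_divide_distrib)
qed

lemma bihomog_eq: "bihomog b x y = N x * (N y * b ((1 / N x) *\<^sub>R x) ((1 / N y) *\<^sub>R y))"
  by (simp add: bihomog_def homog_def)

lemma bihomog_polar_commute: "bihomog (polar f) x y = bihomog (polar f) y x"
  by (simp add: bihomog_eq polar_commute[of f "(1 / N x) *\<^sub>R x"])

lemma bihomog_polar_scaleR: "bihomog (polar f) (r *\<^sub>R x) y = r * bihomog (polar f) x y"
  unfolding bihomog_def by (rule homog_scaleR) (simp add: homog_def polar_minus)

definition seminorm_continuous :: "('a \<Rightarrow> real) \<Rightarrow> bool" where
  "seminorm_continuous G \<longleftrightarrow> (\<forall>x. \<forall>\<epsilon>>0. \<exists>\<delta>>0. \<forall>y. N (y - x) < \<delta> \<longrightarrow> \<bar>G y - G x\<bar> < \<epsilon>)"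

text \<open>The restriction to the diagonal is \<open>(N x)\<^sup>2\<close> times a bounded continuous function of \<open>x / N x\<close>;
  boundedness is what gives continuity where \<open>N x = 0\<close>.\<close>

lemma bihomog_polar_continuous:
  assumes bound: "\<And>x. N x \<le> 4 \<Longrightarrow> \<bar>f x\<bar> \<le> K"
    and cont: "\<And>x \<epsilon>. N x \<le> 4 \<Longrightarrow> 0 < \<epsilon> \<Longrightarrow> \<exists>\<delta>>0. \<forall>y. N y \<le> 4 \<longrightarrow> N (y - x) < \<delta> \<longrightarrow> \<bar>f y - f x\<bar> < \<epsilon>"
  shows "seminorm_continuous (\<lambda>x. bihomog (polar f) x x)"
  unfolding seminorm_continuous_def
proof (intro allI impI)
  fix x and \<epsilon> :: real assume \<epsilon>: "0 < \<epsilon>"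
  let ?G = "\<lambda>x. bihomog (polar f) x x"
  define u where "u y = (1 / N y) *\<^sub>R y" for y
  have N_u: "N (u y) \<le> 1" for y
    by (cases "N y = 0") (simp_all add: u_def scale)
  have G: "?G y = (N y)\<^sup>2 * ((f (2 *\<^sub>R u y) + f (- 2 *\<^sub>R u y) - 2 * f 0) / 4)" for y
  proof -
    have "u y + u y = 2 *\<^sub>R u y" "- u y - u y = - 2 *\<^sub>R u y" "u y - u y = 0"
      by (simp_all add: scaleR_2)
    then have "polar f (u y) (u y) = (f (2 *\<^sub>R u y) + f (- 2 *\<^sub>R u y) - 2 * f 0) / 4"
      unfolding polar_def by simp
    then show ?thesis
      by (simp add: bihomog_eq u_def power2_eq_square)
  qed
  show "\<exists>\<delta>>0. \<forall>y. N (y - x) < \<delta> \<longrightarrow> \<bar>?G y - ?G x\<bar> < \<epsilon>"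
  proof (cases "N x = 0")
    case True
    have K: "\<bar>f z\<bar> \<le> \<bar>K\<bar>" if "N z \<le> 4" for z
      using bound[OF that] by simp
    have le: "\<bar>?G y\<bar> \<le> (N y)\<^sup>2 * \<bar>K\<bar>" for y
    proof -
      have "\<bar>f (2 *\<^sub>R u y)\<bar> \<le> \<bar>K\<bar>" "\<bar>f (- 2 *\<^sub>R u y)\<bar> \<le> \<bar>K\<bar>" "\<bar>f 0\<bar> \<le> \<bar>K\<bar>"
        using N_u[of y] by (auto intro!: K simp: scale)
      then have "\<bar>(f (2 *\<^sub>R u y) + f (- 2 *\<^sub>R u y) - 2 * f 0) / 4\<bar> \<le> \<bar>K\<bar>"
        by (simp add: abs_le_iff)
      then have "(N y)\<^sup>2 * \<bar>(f (2 *\<^sub>R u y) + f (- 2 *\<^sub>R u y) - 2 * f 0) / 4\<bar> \<le> (N y)\<^sup>2 * \<bar>K\<bar>"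
        by (intro mult_left_mono) auto
      then show ?thesis
        by (simp add: G abs_mult)
    qed
    define \<delta> where "\<delta> = min 1 (\<epsilon> / (\<bar>K\<bar> + 1))"
    have "\<bar>?G y - ?G x\<bar> < \<epsilon>" if "N (y - x) < \<delta>" for y
    proof -
      have "N y \<le> N (y - x)"
        using triangle[of "y - x" x] True by simp
      then have y: "N y < 1" "N y < \<epsilon> / (\<bar>K\<bar> + 1)"
        using that by (auto simp: \<delta>_def)
      have "?G x = 0"
        using True by (simp add: G)
      then have "\<bar>?G y - ?G x\<bar> \<le> (N y)\<^sup>2 * \<bar>K\<bar>"
        using le[of y] by simp
      also have "\<dots> \<le> N y * (\<bar>K\<bar> + 1)"
        using y nonneg[of y] by (intro mult_mono) (auto simp: power2_eq_square mult_left_le_one_le)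
      also have "\<dots> < \<epsilon>"
        using y(2) by (simp add: pos_less_divide_eq)
      finally show ?thesis .
    qed
    moreover have "\<delta> > 0"
      using \<epsilon> by (simp add: \<delta>_def)
    ultimately show ?thesis by blast
  next
    case False
    then have pos: "N x > 0"
      using nonneg[of x] by linarith
    let ?F = "filtercomap (\<lambda>y. N (y - x)) (nhds 0)"
    have ev: "eventually P ?F \<longleftrightarrow> (\<exists>\<delta>>0. \<forall>y. N (y - x) < \<delta> \<longrightarrow> P y)" for P
    proof
      assume "eventually P ?F"
      then obtain Q where "eventually Q (nhds (0::real))" "\<And>y. Q (N (y - x)) \<Longrightarrow> P y"
        by (auto simp: eventually_filtercomap)
      then show "\<exists>\<delta>>0. \<forall>y. N (y - x) < \<delta> \<longrightarrow> P y"
        unfolding eventually_nhds_metric by (force simp: dist_real_def)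
    next
      assume "\<exists>\<delta>>0. \<forall>y. N (y - x) < \<delta> \<longrightarrow> P y"
      then obtain \<delta> where \<delta>: "\<delta> > 0" "\<And>y. N (y - x) < \<delta> \<Longrightarrow> P y"
        by auto
      moreover have "eventually (\<lambda>t::real. t < \<delta>) (nhds 0)"
        using \<delta>(1) by (rule eventually_nhds_in_open[of "{..<\<delta>}", simplified])
      ultimately show "eventually P ?F"
        unfolding eventually_filtercomap by blast
    qed
    have lim_N: "(N \<longlongrightarrow> N x) ?F"
      unfolding tendsto_iff ev dist_real_def using abs_diff_le by (meson le_less_trans)
    have N_diff: "N (u y - u x) \<le> 2 * N (y - x) / N x" for y
    proof (cases "N y = 0")
      case True
      then have "N x \<le> N (y - x)"
        using triangle[of "x - y" y] minus_commute[of x y] by simp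
      moreover have "u y = 0"
        using True by (simp add: u_def)
      moreover have "N (u x) = 1"
        unfolding u_def by (rule normalize[OF pos])
      ultimately show ?thesis
        using pos by (simp add: field_simps)
    next
      case y: False
      have "u y - u x = (1 / N x) *\<^sub>R (y - x) + (1 / N y - 1 / N x) *\<^sub>R y"
        by (simp add: u_def algebra_simps)
      then have "N (u y - u x) \<le> N (y - x) / N x + \<bar>1 / N y - 1 / N x\<bar> * N y"
        using triangle[of "(1 / N x) *\<^sub>R (y - x)" "(1 / N y - 1 / N x) *\<^sub>R y"] by (simp add: scale)
      also have "\<bar>1 / N y - 1 / N x\<bar> * N y = \<bar>(1 / N y - 1 / N x) * N y\<bar>"
        by (simp add: abs_mult)
      also have "(1 / N y - 1 / N x) * N y = (N x - N y) / N x"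
        using pos y by (simp add: field_simps)
      also have "\<bar>(N x - N y) / N x\<bar> \<le> N (y - x) / N x"
        using abs_diff_le[of x y] pos by (simp add: divide_right_mono minus_commute)
      finally show ?thesis
        by simp
    qed
    have lim_f: "((\<lambda>y. f (r *\<^sub>R u y)) \<longlongrightarrow> f (r *\<^sub>R u x)) ?F" if r: "\<bar>r\<bar> = 2" for r
      unfolding tendsto_iff ev dist_real_def
    proof (intro allI impI)
      fix e :: real assume "0 < e"
      have N4: "N (r *\<^sub>R u y) \<le> 4" for y
        using N_u[of y] r by (simp add: scale)
      from cont[OF N4 \<open>0 < e\<close>, of x] obtain \<delta> where \<delta>: "\<delta> > 0"
        "\<And>z. N z \<le> 4 \<Longrightarrow> N (z - r *\<^sub>R u x) < \<delta> \<Longrightarrow> \<bar>f z - f (r *\<^sub>R u x)\<bar> < e"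
        by blast
      have "\<bar>f (r *\<^sub>R u y) - f (r *\<^sub>R u x)\<bar> < e" if y: "N (y - x) < \<delta> * N x / 4" for y
      proof (rule \<delta>(2)[OF N4])
        have "N (r *\<^sub>R u y - r *\<^sub>R u x) = 2 * N (u y - u x)"
          using scale[of r "u y - u x"] r by (simp add: scaleR_diff_right)
        also have "\<dots> \<le> 4 * N (y - x) / N x"
          using N_diff[of y] by simp
        also have "\<dots> < \<delta>"
          using y pos by (simp add: field_simps)
        finally show "N (r *\<^sub>R u y - r *\<^sub>R u x) < \<delta>" .
      qed
      then show "\<exists>d>0. \<forall>y. N (y - x) < d \<longrightarrow> \<bar>f (r *\<^sub>R u y) - f (r *\<^sub>R u x)\<bar> < e"
        using \<delta>(1) pos by (intro exI[of _ "\<delta> * N x / 4"]) auto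
    qed
    have "(?G \<longlongrightarrow> ?G x) ?F"
      unfolding G by (intro tendsto_intros lim_N lim_f) auto
    then show ?thesis
      using \<epsilon> unfolding tendsto_iff ev dist_real_def by blast
  qed
qed

text \<open>
  The reduction of the problem to homogeneous functions.  Boundedness of the mixed third differences
  at the origin says that the odd part of \<open>f\<close> is approximately additive and that the polar form of
  the even part is approximately biadditive.  Both are replaced by homogeneous functions, which
  turns bounded errors on the ball into errors controlled by the seminorm everywhere.
\<close>

lemma homogeneous_decomposition:
  assumes f3: "\<And>x h. N x \<le> 4 \<Longrightarrow> N (x + h) \<le> 4 \<Longrightarrow> N (x + 2 *\<^sub>R h) \<le> 4 \<Longrightarrow> N (x + 3 *\<^sub>R h) \<le> 4
                \<Longrightarrow> \<bar>third_diff f h x\<bar> \<le> 1"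
    and bound: "\<And>x. N x \<le> 4 \<Longrightarrow> \<bar>f x\<bar> \<le> K"
    and cont: "\<And>x \<epsilon>. N x \<le> 4 \<Longrightarrow> 0 < \<epsilon> \<Longrightarrow> \<exists>\<delta>>0. \<forall>y. N y \<le> 4 \<longrightarrow> N (y - x) < \<delta> \<longrightarrow> \<bar>f y - f x\<bar> < \<epsilon>"
  obtains F \<beta> where
    "\<And>r x. F (r *\<^sub>R x) = r * F x"
    "\<And>x y. \<bar>F (x + y) - F x - F y\<bar> \<le> 70 * (N x + N y)"
    "\<And>x y. \<beta> x y = \<beta> y x"
    "\<And>r x y. \<beta> (r *\<^sub>R x) y = r * \<beta> x y"
    "\<And>x x' y. \<bar>\<beta> (x + x') y - \<beta> x y - \<beta> x' y\<bar> \<le> 70 * (N x + N x') * N y"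
    "seminorm_continuous (\<lambda>x. \<beta> x x)"
    "\<And>x. N x \<le> 1 \<Longrightarrow> \<bar>f x - f 0 - F x - \<beta> x x / 2\<bar> \<le> 105"
proof
  let ?u = "odd_part f" and ?b = "polar f"
  let ?F = "homog ?u" and ?\<beta> = "bihomog ?b"
  have mixed: "\<bar>f (x + y + z) - f (x + y) - f (x + z) - f (y + z) + f x + f y + f z - f 0\<bar> \<le> 7"
    if "N x \<le> 1" "N y \<le> 1" "N z \<le> 1" for x y z
    using f3 that by (rule mixed_third_difference)
  have N2: "N (x + y) \<le> 4" if "N x \<le> 1" "N y \<le> 1" for x y
    using triangle[of x y] that by linarith
  have u_odd: "?u (- x) = - ?u x" for x
    by (simp add: odd_part_def field_simps)
  have u_add: "\<bar>?u (x + y) - ?u x - ?u y\<bar> \<le> 7" if "N x \<le> 1" "N y \<le> 1" for x y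
  proof -
    have e: "x + - x + y = y" "x + - x = 0" "- x + y + - y = - x" "y + - y = 0" "- x + - y = - (x + y)"
      by simp_all
    show ?thesis
      using mixed[of x "- x" y] mixed[of "- x" y "- y"] that
      unfolding odd_part_def abs_le_iff e by (simp add: field_simps)
  qed
  have u_bound: "\<bar>?u x\<bar> \<le> K" if "N x \<le> 1" for x
    using bound[of x] bound[of "- x"] that unfolding odd_part_def by (simp add: abs_le_iff)
  have b_add: "\<bar>?b (x + x') y - ?b x y - ?b x' y\<bar> \<le> 7" if "N x \<le> 1" "N x' \<le> 1" "N y \<le> 1" for x x' y
  proof -
    have e: "- x + - x' + y = y - (x + x')" "- x + - x' + - y = - (x + x') - y"
      "x + x' + - y = x + x' - y" "- x + - x' = - (x + x')" "z + - y = z - y" "- z + y = y - z" for z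
      by simp_all
    show ?thesis
      using mixed[of x x' y] mixed[of "- x" "- x'" y] mixed[of x x' "- y"] mixed[of "- x" "- x'" "- y"] that
      unfolding polar_def abs_le_iff e minus by argo
  qed
  have b_bound: "\<bar>?b x y\<bar> \<le> K" if "N x \<le> 1" "N y \<le> 1" for x y
    using bound[of "x + y"] bound[of "x - y"] bound[of "- x - y"] bound[of "y - x"]
      N2[of x y] N2[of x "- y"] N2[of "- x" "- y"] N2[of y "- x"] that
    unfolding polar_def by (simp add: abs_le_iff)
  show "?F (r *\<^sub>R x) = r * ?F x" for r x
    by (rule homog_scaleR) (rule u_odd)
  show "\<bar>?F (x + y) - ?F x - ?F y\<bar> \<le> 70 * (N x + N y)" for x y
    using homog_approx_additive[of ?u 7 K x y, OF u_odd u_add u_bound] by simp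
  show "?\<beta> x y = ?\<beta> y x" for x y
    by (rule bihomog_polar_commute)
  show "?\<beta> (r *\<^sub>R x) y = r * ?\<beta> x y" for r x y
    by (rule bihomog_polar_scaleR)
  show "\<bar>?\<beta> (x + x') y - ?\<beta> x y - ?\<beta> x' y\<bar> \<le> 70 * (N x + N x') * N y" for x x' y
  proof (cases "N y = 0")
    case True
    then show ?thesis by (simp add: bihomog_eq)
  next
    case False
    then have y: "N y > 0"
      using nonneg[of y] by linarith
    define y0 where "y0 = (1 / N y) *\<^sub>R y"
    have y0: "N y0 \<le> 1"
      using normalize[OF y] by (simp add: y0_def)
    have eq: "?\<beta> z y = N y * homog (\<lambda>x. ?b x y0) z" for z
      by (simp add: bihomog_eq homog_def y0_def)
    have "\<bar>homog (\<lambda>x. ?b x y0) (x + x') - homog (\<lambda>x. ?b x y0) x - homog (\<lambda>x. ?b x y0) x'\<bar>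
        \<le> 10 * 7 * (N x + N x')"
      by (rule homog_approx_additive[where K = K]) (use y0 in \<open>auto simp: polar_minus intro: b_add b_bound\<close>)
    then have "N y * \<bar>homog (\<lambda>x. ?b x y0) (x + x') - homog (\<lambda>x. ?b x y0) x - homog (\<lambda>x. ?b x y0) x'\<bar>
        \<le> N y * (10 * 7 * (N x + N x'))"
      using y by simp
    moreover have "?\<beta> (x + x') y - ?\<beta> x y - ?\<beta> x' y
      = N y * (homog (\<lambda>x. ?b x y0) (x + x') - homog (\<lambda>x. ?b x y0) x - homog (\<lambda>x. ?b x y0) x')"
      by (simp add: eq algebra_simps)
    ultimately show ?thesis
      using y by (simp add: abs_mult mult_ac)
  qed
  show "seminorm_continuous (\<lambda>x. ?\<beta> x x)"
    using bound cont by (rule bihomog_polar_continuous)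
  have F_approx: "\<bar>?F x - ?u x\<bar> \<le> 21" if "N x \<le> 1" for x
    using homog_approx[of ?u 7 K x, OF u_add u_bound that] by simp
  have \<beta>_approx: "\<bar>?\<beta> x x - ?b x x\<bar> \<le> 42" if x: "N x \<le> 1" for x
  proof (cases "N x = 0")
    case True
    have "\<bar>homog (\<lambda>z. ?b z x) x - ?b x x\<bar> \<le> 3 * 7"
      by (rule homog_approx[where K = K]) (use x in \<open>auto intro: b_add b_bound\<close>)
    then show ?thesis
      using True by (simp add: homog_def bihomog_eq)
  next
    case False
    then have pos: "N x > 0"
      using nonneg[of x] by linarith
    define t e where "t = N x" and "e = (1 / N x) *\<^sub>R x"
    have t: "0 \<le> t" "t \<le> 1" and xe: "x = t *\<^sub>R e" and e: "N e \<le> 1"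
      using x pos normalize[OF pos] by (auto simp: t_def e_def)
    have ray: "\<bar>?b (t *\<^sub>R e) z - t * ?b e z\<bar> \<le> 3 * 7" if "N z \<le> 1" for z
      by (rule approx_additive_ray[where K = K and a = "\<lambda>w. ?b w z"])
        (use t e that in \<open>auto intro: b_add b_bound\<close>)
    have "\<bar>?b (t *\<^sub>R e) (t *\<^sub>R e) - t * ?b e (t *\<^sub>R e)\<bar> \<le> 21"
      using ray[of "t *\<^sub>R e"] x xe by simp
    moreover have "\<bar>t * ?b e (t *\<^sub>R e) - t * (t * ?b e e)\<bar> \<le> 1 * 21"
    proof -
      have "\<bar>?b e (t *\<^sub>R e) - t * ?b e e\<bar> \<le> 21"
        using ray[OF e] polar_commute[of f e "t *\<^sub>R e"] by simp
      then have "\<bar>t\<bar> * \<bar>?b e (t *\<^sub>R e) - t * ?b e e\<bar> \<le> 1 * 21"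
        using t by (intro mult_mono) auto
      then show ?thesis
        by (simp only: abs_mult[symmetric] right_diff_distrib)
    qed
    ultimately have "\<bar>?b (t *\<^sub>R e) (t *\<^sub>R e) - t * (t * ?b e e)\<bar> \<le> 42"
      by (simp add: abs_le_iff)
    moreover have "?\<beta> x x = t * (t * ?b e e)"
      by (simp add: bihomog_eq t_def e_def)
    ultimately show ?thesis
      using xe by (simp add: abs_minus_commute)
  qed
  show "\<bar>f x - f 0 - ?F x - ?\<beta> x x / 2\<bar> \<le> 105" if x: "N x \<le> 1" for x
  proof -
    have "?\<beta> x x / 2 = 2 * ?\<beta> ((1/2) *\<^sub>R x) ((1/2) *\<^sub>R x)"
      using bihomog_polar_scaleR[of f "1/2" x "(1/2) *\<^sub>R x"] bihomog_polar_scaleR[of f "1/2" x x]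
        bihomog_polar_commute[of f x "(1/2) *\<^sub>R x"] by simp
    moreover have "\<bar>?\<beta> ((1/2) *\<^sub>R x) ((1/2) *\<^sub>R x) - ?b ((1/2) *\<^sub>R x) ((1/2) *\<^sub>R x)\<bar> \<le> 42"
      using x by (intro \<beta>_approx) (simp add: scale)
    moreover have "?b ((1/2) *\<^sub>R x) ((1/2) *\<^sub>R x) = (f x + f (- x) - 2 * f 0) / 4"
    proof -
      have "(1/2) *\<^sub>R x + (1/2) *\<^sub>R x = x" "- ((1/2) *\<^sub>R x) - (1/2) *\<^sub>R x = - x"
        by (simp_all flip: scaleR_add_left scaleR_minus_left scaleR_diff_left)
      then show ?thesis
        by (simp add: polar_def)
    qed
    ultimately show ?thesis
      using F_approx[OF x]
      unfolding odd_part_def abs_le_iff by (simp add: add_divide_distrib diff_divide_distrib)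
  qed
qed

end

section \<open>Duality in finite dimension\<close>

text \<open>
  A finite-dimensional Hahn--Banach theorem: \<open>S\<close> collects the consequences of a system of
  inequalities \<open>t \<bullet> v \<le> g\<close>.  The last coordinate of \<open>t\<close> is eliminated as in the Fourier--Motzkin
  procedure: the bounds for it coming from \<open>v d = 1\<close> and from \<open>v d = -1\<close> are compatible because the
  sum of two such inequalities does not involve it.
\<close>

lemma cone_functional:
  fixes S :: "((nat \<Rightarrow> real) \<times> real) set"
  assumes add: "\<And>v g w h. (v, g) \<in> S \<Longrightarrow> (w, h) \<in> S \<Longrightarrow> (v + w, g + h) \<in> S"
    and scale: "\<And>v g r. (v, g) \<in> S \<Longrightarrow> 0 < r \<Longrightarrow> (r *\<^sub>R v, r * g) \<in> S"
    and supp: "\<And>v g j. (v, g) \<in> S \<Longrightarrow> d \<le> j \<Longrightarrow> v j = 0"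
    and sym: "\<And>v g. (v, g) \<in> S \<Longrightarrow> \<exists>h. (- v, h) \<in> S"
    and nonneg: "\<And>g. (0, g) \<in> S \<Longrightarrow> 0 \<le> g"
  shows "\<exists>t. \<forall>v g. (v, g) \<in> S \<longrightarrow> (\<Sum>j<d. t j * v j) \<le> g"
  using assms
proof (induction d arbitrary: S)
  case 0
  then have "v = 0" if "(v, g) \<in> S" for v g
    using that by (auto simp: fun_eq_iff)
  then have "0 \<le> g" if "(v, g) \<in> S" for v g
    using 0(5)[of g] that by metis
  then show ?case
    by simp
next
  case (Suc d)
  note add = Suc.prems(1) and scale = Suc.prems(2) and sym = Suc.prems(4)
  have "\<exists>t. \<forall>v g. (v, g) \<in> {(v, g) \<in> S. v d = 0} \<longrightarrow> (\<Sum>j<d. t j * v j) \<le> g"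
  proof (rule Suc.IH)
    show "v j = 0" if "(v, g) \<in> {(v, g) \<in> S. v d = 0}" "d \<le> j" for v g j
      using that Suc.prems(3)[of v g j] by (cases "j = d") auto
    show "\<exists>h. (- v, h) \<in> {(v, g) \<in> S. v d = 0}" if "(v, g) \<in> {(v, g) \<in> S. v d = 0}" for v g
      using that sym[of v g] by (auto simp: fun_Compl_def)
    show "0 \<le> g" if "(0, g) \<in> {(v, g) \<in> S. v d = 0}" for g
      using that Suc.prems(5)[of g] by blast
    show "(v + w, g + h) \<in> {(v, g) \<in> S. v d = 0}"
      if "(v, g) \<in> {(v, g) \<in> S. v d = 0}" "(w, h) \<in> {(v, g) \<in> S. v d = 0}" for v g w h
    proof -
      have "(v + w, g + h) \<in> S"
        by (rule add) (use that in blast)+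
      moreover have "(v + w) d = 0"
        using that by simp
      ultimately show ?thesis
        by blast
    qed
    show "(r *\<^sub>R v, r * g) \<in> {(v, g) \<in> S. v d = 0}"
      if "(v, g) \<in> {(v, g) \<in> S. v d = 0}" "0 < r" for v g r
    proof -
      have "(r *\<^sub>R v, r * g) \<in> S"
        by (rule scale) (use that in blast)+
      moreover have "(r *\<^sub>R v) d = 0"
        using that by simp
      ultimately show ?thesis
        by blast
    qed
  qed
  then obtain t where t: "\<And>v g. (v, g) \<in> S \<Longrightarrow> v d = 0 \<Longrightarrow> (\<Sum>j<d. t j * v j) \<le> g"
    by blast
  define T where "T v = (\<Sum>j<d. t j * v j)" for v :: "nat \<Rightarrow> real"
  have T_add: "T (v + w) = T v + T w" and T_scale: "T (r *\<^sub>R v) = r * T v" for v w r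
    by (simp_all add: T_def algebra_simps sum.distrib sum_distrib_left)
  define L where "L = {T w - h | w h. (w, h) \<in> S \<and> w d = -1}"
  have le: "l \<le> g - T v" if "l \<in> L" "(v, g) \<in> S" "v d = 1" for l v g
  proof -
    from \<open>l \<in> L\<close> obtain w h where w: "(w, h) \<in> S" "w d = -1" "l = T w - h"
      by (auto simp: L_def)
    have "T (v + w) \<le> g + h"
      unfolding T_def by (rule t) (use add[OF that(2) w(1)] that w in auto)
    then show ?thesis
      using w by (simp add: T_add)
  qed
  define \<tau> where "\<tau> = Sup L"
  have upper: "T v + \<tau> * v d \<le> g" if v: "(v, g) \<in> S" "v d = 1" for v g
  proof -
    obtain h where "(- v, h) \<in> S"
      using sym[OF v(1)] by blast
    then have "L \<noteq> {}"
      using v(2) by (force simp: L_def fun_Compl_def)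
    then have "\<tau> \<le> g - T v"
      unfolding \<tau>_def using le[OF _ v] by (intro cSup_least)
    then show ?thesis
      using v by simp
  qed
  have lower: "T w + \<tau> * w d \<le> h" if w: "(w, h) \<in> S" "w d = -1" for w h
  proof -
    obtain g where g: "(- w, g) \<in> S"
      using sym[OF w(1)] by blast
    have "bdd_above L"
      using le[OF _ g] w(2) by (intro bdd_aboveI) (auto simp: fun_Compl_def)
    then have "T w - h \<le> \<tau>"
      unfolding \<tau>_def using w by (intro cSup_upper) (auto simp: L_def)
    then show ?thesis
      using w by simp
  qed
  have "(\<Sum>j<Suc d. (t(d := \<tau>)) j * v j) \<le> g" if v: "(v, g) \<in> S" for v g
  proof -
    have eq: "(\<Sum>j<Suc d. (t(d := \<tau>)) j * v j) = T v + \<tau> * v d"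
      by (simp add: T_def)
    define r where "r = 1 / \<bar>v d\<bar>"
    consider "v d = 0" | "v d > 0" | "v d < 0"
      by linarith
    then have "T v + \<tau> * v d \<le> g"
    proof cases
      case 1
      then show ?thesis
        using t[OF v] by (simp add: T_def)
    next
      case 2
      then have "r > 0"
        by (simp add: r_def)
      then have "T (r *\<^sub>R v) + \<tau> * (r *\<^sub>R v) d \<le> r * g"
        by (intro upper scale v) (use 2 in \<open>simp_all add: r_def\<close>)
      then have "r * (T v + \<tau> * v d) \<le> r * g"
        by (simp add: T_scale algebra_simps)
      then show ?thesis
        using \<open>r > 0\<close> by simp
    next
      case 3
      then have "r > 0"
        by (simp add: r_def)
      then have "T (r *\<^sub>R v) + \<tau> * (r *\<^sub>R v) d \<le> r * g"
        by (intro lower scale v) (use 3 in \<open>simp_all add: r_def\<close>)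
      then have "r * (T v + \<tau> * v d) \<le> r * g"
        by (simp add: T_scale algebra_simps)
      then show ?thesis
        using \<open>r > 0\<close> by simp
    qed
    then show ?thesis
      by (simp only: eq)
  qed
  then show ?case
    by blast
qed

text \<open>More vectors than coordinates are dependent, by Gaussian elimination.  The family may have
  repeated members, so dependence is expressed through coefficients.\<close>

lemma linear_dependence:
  fixes \<psi> :: "'i \<Rightarrow> nat \<Rightarrow> real"
  assumes "finite J" "d < card J"
  shows "\<exists>\<mu>. (\<exists>j\<in>J. \<mu> j \<noteq> 0) \<and> (\<forall>c<d. (\<Sum>j\<in>J. \<mu> j * \<psi> j c) = 0)"
  using assms
proof (induction d arbitrary: J \<psi>)
  case 0
  then have "J \<noteq> {}"
    by auto
  then show ?case
    by (intro exI[of _ "\<lambda>_. 1"]) auto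
next
  case (Suc d)
  show ?case
  proof (cases "\<forall>j\<in>J. \<psi> j d = 0")
    case True
    obtain \<mu> where "\<exists>j\<in>J. \<mu> j \<noteq> 0" "\<forall>c<d. (\<Sum>j\<in>J. \<mu> j * \<psi> j c) = 0"
      using Suc.IH[of J \<psi>] Suc.prems by auto
    then show ?thesis
      using True by (intro exI[of _ \<mu>]) (auto simp: less_Suc_eq)
  next
    case False
    then obtain p where p: "p \<in> J" "\<psi> p d \<noteq> 0"
      by auto
    define q where "q j = \<psi> j d / \<psi> p d" for j
    have "d < card (J - {p})"
      using Suc.prems p by simp
    then obtain \<mu> where \<mu>: "\<exists>j\<in>J - {p}. \<mu> j \<noteq> 0"
      "\<And>c. c < d \<Longrightarrow> (\<Sum>j\<in>J - {p}. \<mu> j * (\<psi> j c - q j * \<psi> p c)) = 0"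
      using Suc.IH[of "J - {p}" "\<lambda>j c. \<psi> j c - q j * \<psi> p c"] Suc.prems by auto
    define \<nu> where "\<nu> = \<mu>(p := - (\<Sum>j\<in>J - {p}. \<mu> j * q j))"
    have "(\<Sum>j\<in>J. \<nu> j * \<psi> j c) = (\<Sum>j\<in>J - {p}. \<mu> j * (\<psi> j c - q j * \<psi> p c))" for c
    proof -
      have "(\<Sum>j\<in>J. \<nu> j * \<psi> j c) = \<nu> p * \<psi> p c + (\<Sum>j\<in>J - {p}. \<nu> j * \<psi> j c)"
        using p Suc.prems by (simp add: sum.remove)
      also have "(\<Sum>j\<in>J - {p}. \<nu> j * \<psi> j c) = (\<Sum>j\<in>J - {p}. \<mu> j * \<psi> j c)"
        by (intro sum.cong) (auto simp: \<nu>_def)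
      finally show ?thesis
        by (simp add: \<nu>_def algebra_simps sum_subtractf sum_distrib_left sum_negf)
    qed
    moreover have "(\<Sum>j\<in>J - {p}. \<mu> j * (\<psi> j d - q j * \<psi> p d)) = 0"
      using p by (simp add: q_def)
    ultimately have "\<forall>c<Suc d. (\<Sum>j\<in>J. \<nu> j * \<psi> j c) = 0"
      using \<mu>(2) by (simp add: less_Suc_eq)
    moreover have "\<exists>j\<in>J. \<nu> j \<noteq> 0"
      using \<mu>(1) by (auto simp: \<nu>_def)
    ultimately show ?thesis
      by blast
  qed
qed

text \<open>Caratheodory's reduction: moving along an affine dependence shortens a long relation without
  increasing its value.\<close>

lemma caratheodory_nonneg:
  fixes \<psi> :: "'i \<Rightarrow> nat \<Rightarrow> real" and \<gamma> :: "'i \<Rightarrow> real"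
  assumes small: "\<And>J \<rho>. J \<subseteq> I \<Longrightarrow> finite J \<Longrightarrow> card J \<le> d + 1 \<Longrightarrow> (\<forall>j\<in>J. 0 < \<rho> j) \<Longrightarrow>
                    (\<forall>c<d. (\<Sum>j\<in>J. \<rho> j * \<psi> j c) = 0) \<Longrightarrow> 0 \<le> (\<Sum>j\<in>J. \<rho> j * \<gamma> j)"
    and "finite J" "J \<subseteq> I" "\<forall>j\<in>J. 0 < \<rho> j" "\<forall>c<d. (\<Sum>j\<in>J. \<rho> j * \<psi> j c) = 0"
  shows "0 \<le> (\<Sum>j\<in>J. \<rho> j * \<gamma> j)"
  using assms(2-)
proof (induction "card J" arbitrary: J \<rho> rule: less_induct)
  case less
  show ?case
  proof (cases "card J \<le> d + 1")
    case True
    then show ?thesis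
      using small less.prems by blast
  next
    case False
    then obtain \<mu>0 where \<mu>0: "\<exists>j\<in>J. \<mu>0 j \<noteq> 0"
      "\<forall>c<Suc d. (\<Sum>j\<in>J. \<mu>0 j * (\<lambda>j c. if c < d then \<psi> j c else 1) j c) = 0"
      using linear_dependence[OF less.prems(1), of "Suc d" "\<lambda>j c. if c < d then \<psi> j c else 1"] by auto
    define \<mu> where "\<mu> = (if (\<Sum>j\<in>J. \<mu>0 j * \<gamma> j) \<le> 0 then \<mu>0 else (\<lambda>j. - \<mu>0 j))"
    have \<mu>: "\<exists>j\<in>J. \<mu> j \<noteq> 0" "\<And>c. c < d \<Longrightarrow> (\<Sum>j\<in>J. \<mu> j * \<psi> j c) = 0" "(\<Sum>j\<in>J. \<mu> j) = 0"
      "(\<Sum>j\<in>J. \<mu> j * \<gamma> j) \<le> 0"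
    proof -
      have "(\<Sum>j\<in>J. \<mu>0 j * \<psi> j c) = 0" if "c < d" for c
        using \<mu>0(2)[rule_format, of c] that by auto
      moreover have "(\<Sum>j\<in>J. \<mu>0 j) = 0"
        using \<mu>0(2)[rule_format, of d] by auto
      ultimately show "\<exists>j\<in>J. \<mu> j \<noteq> 0" "\<And>c. c < d \<Longrightarrow> (\<Sum>j\<in>J. \<mu> j * \<psi> j c) = 0" "(\<Sum>j\<in>J. \<mu> j) = 0"
        "(\<Sum>j\<in>J. \<mu> j * \<gamma> j) \<le> 0"
        using \<mu>0(1) by (auto simp: \<mu>_def sum_negf)
    qed
    define Neg where "Neg = {j \<in> J. \<mu> j < 0}"
    have "Neg \<noteq> {}"
    proof
      assume "Neg = {}"
      then have "\<forall>j\<in>J. 0 \<le> \<mu> j"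
        by (force simp: Neg_def)
      then have "\<forall>j\<in>J. \<mu> j = 0"
        using \<mu>(3) sum_nonneg_eq_0_iff[OF less.prems(1), of \<mu>] by auto
      then show False
        using \<mu>(1) by auto
    qed
    have fin: "finite Neg"
      using less.prems by (simp add: Neg_def)
    define t where "t = Min ((\<lambda>j. \<rho> j / - \<mu> j) ` Neg)"
    have "t \<in> (\<lambda>j. \<rho> j / - \<mu> j) ` Neg"
      unfolding t_def using fin \<open>Neg \<noteq> {}\<close> by (intro Min_in) auto
    then obtain p where p: "p \<in> Neg" "t = \<rho> p / - \<mu> p"
      by auto
    have t_le: "t \<le> \<rho> j / - \<mu> j" if "j \<in> Neg" for j
      unfolding t_def using fin that by (intro Min_le) auto
    have t_nonneg: "0 \<le> t"
      using p less.prems(3) by (force simp: Neg_def divide_simps)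
    define \<rho>' where "\<rho>' j = \<rho> j + t * \<mu> j" for j
    have \<rho>'_nonneg: "0 \<le> \<rho>' j" if "j \<in> J" for j
    proof (cases "j \<in> Neg")
      case True
      then show ?thesis
        using t_le[OF True] by (simp add: \<rho>'_def Neg_def field_simps)
    next
      case False
      then show ?thesis
        using that less.prems(3) t_nonneg by (force simp: \<rho>'_def Neg_def intro!: add_nonneg_nonneg mult_nonneg_nonneg)
    qed
    have "\<rho>' p = 0"
      using p by (simp add: \<rho>'_def Neg_def field_simps)
    define J' where "J' = {j \<in> J. 0 < \<rho>' j}"
    have "p \<in> J" "p \<notin> J'" "J' \<subseteq> J"
      using p \<open>\<rho>' p = 0\<close> by (auto simp: J'_def Neg_def)
    then have "J' \<subset> J"
      by blast
    have sum_J': "(\<Sum>j\<in>J'. \<rho>' j * f j) = (\<Sum>j\<in>J. \<rho> j * f j) + t * (\<Sum>j\<in>J. \<mu> j * f j)" for f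
    proof -
      have "(\<Sum>j\<in>J'. \<rho>' j * f j) = (\<Sum>j\<in>J. \<rho>' j * f j)"
        using less.prems(1) \<rho>'_nonneg by (intro sum.mono_neutral_left) (force simp: J'_def)+
      then show ?thesis
        by (simp add: \<rho>'_def algebra_simps sum.distrib sum_distrib_left)
    qed
    have "0 \<le> (\<Sum>j\<in>J'. \<rho>' j * \<gamma> j)"
    proof (rule less.hyps)
      show "card J' < card J"
        using \<open>J' \<subset> J\<close> less.prems(1) by (rule psubset_card_mono[rotated])
      show "\<forall>c<d. (\<Sum>j\<in>J'. \<rho>' j * \<psi> j c) = 0"
        using less.prems(4) \<mu>(2) by (simp add: sum_J')
    qed (use less.prems in \<open>auto simp: J'_def\<close>)
    also have "\<dots> \<le> (\<Sum>j\<in>J. \<rho> j * \<gamma> j)"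
      unfolding sum_J' using t_nonneg \<mu>(4) by (simp add: mult_nonneg_nonpos)
    finally show ?thesis .
  qed
qed

text \<open>
  Solvability of a symmetric, possibly infinite system of linear inequalities in \<open>d\<close> unknowns is
  decided by its relations with at most \<open>d + 1\<close> terms.  The bound on the number of terms is what
  makes the logarithm of the dimension appear.
\<close>

lemma linear_system_solvable:
  fixes \<psi> :: "'i \<Rightarrow> nat \<Rightarrow> real" and \<gamma> :: "'i \<Rightarrow> real"
  assumes supp: "\<And>i c. i \<in> I \<Longrightarrow> d \<le> c \<Longrightarrow> \<psi> i c = 0"
    and sym: "\<And>i. i \<in> I \<Longrightarrow> \<exists>i'\<in>I. \<psi> i' = - \<psi> i"
    and small: "\<And>J \<rho>. J \<subseteq> I \<Longrightarrow> finite J \<Longrightarrow> card J \<le> d + 1 \<Longrightarrow> (\<forall>j\<in>J. 0 < \<rho> j) \<Longrightarrow>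
                    (\<forall>c<d. (\<Sum>j\<in>J. \<rho> j * \<psi> j c) = 0) \<Longrightarrow> 0 \<le> (\<Sum>j\<in>J. \<rho> j * \<gamma> j)"
  obtains t where "\<And>i. i \<in> I \<Longrightarrow> (\<Sum>c<d. t c * \<psi> i c) \<le> \<gamma> i"
proof -
  define S where "S = {(\<Sum>j\<in>J. \<rho> j *\<^sub>R \<psi> j, \<Sum>j\<in>J. \<rho> j * \<gamma> j) | J \<rho>.
                        finite J \<and> J \<subseteq> I \<and> (\<forall>j\<in>J. (0::real) < \<rho> j)}"
  have S_I: "(\<Sum>j\<in>J. \<rho> j *\<^sub>R \<psi> j, \<Sum>j\<in>J. \<rho> j * \<gamma> j) \<in> S"
    if "finite J" "J \<subseteq> I" "\<And>j. j \<in> J \<Longrightarrow> 0 < \<rho> j" for J \<rho>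
    unfolding S_def using that by blast
  have S_E: "\<exists>J \<rho>. finite J \<and> J \<subseteq> I \<and> (\<forall>j\<in>J. 0 < \<rho> j) \<and>
      v = (\<Sum>j\<in>J. \<rho> j *\<^sub>R \<psi> j) \<and> g = (\<Sum>j\<in>J. \<rho> j * \<gamma> j)" if "(v, g) \<in> S" for v g
    using that unfolding S_def by blast
  have "\<exists>t. \<forall>v g. (v, g) \<in> S \<longrightarrow> (\<Sum>j<d. t j * v j) \<le> g"
  proof (rule cone_functional)
    fix v g w h assume "(v, g) \<in> S" "(w, h) \<in> S"
    from S_E[OF this(1)] S_E[OF this(2)] obtain J \<rho> K \<mu> where
      J: "finite J" "J \<subseteq> I" "\<forall>j\<in>J. 0 < \<rho> j" "v = (\<Sum>j\<in>J. \<rho> j *\<^sub>R \<psi> j)" "g = (\<Sum>j\<in>J. \<rho> j * \<gamma> j)" and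
      K: "finite K" "K \<subseteq> I" "\<forall>j\<in>K. 0 < \<mu> j" "w = (\<Sum>j\<in>K. \<mu> j *\<^sub>R \<psi> j)" "h = (\<Sum>j\<in>K. \<mu> j * \<gamma> j)"
      by blast
    define \<nu> where "\<nu> j = (if j \<in> J then \<rho> j else 0) + (if j \<in> K then \<mu> j else 0)" for j
    have "(\<Sum>j\<in>J \<union> K. \<nu> j *\<^sub>R f j) = (\<Sum>j\<in>J. \<rho> j *\<^sub>R f j) + (\<Sum>j\<in>K. \<mu> j *\<^sub>R f j)"
      for f :: "'i \<Rightarrow> 'b::real_vector"
    proof -
      have "(\<Sum>j\<in>J \<union> K. \<nu> j *\<^sub>R f j) = (\<Sum>j\<in>J \<union> K. if j \<in> J then \<rho> j *\<^sub>R f j else 0)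
          + (\<Sum>j\<in>J \<union> K. if j \<in> K then \<mu> j *\<^sub>R f j else 0)"
        unfolding sum.distrib[symmetric] by (intro sum.cong) (auto simp: \<nu>_def algebra_simps)
      then show ?thesis
        using J(1) K(1) by (simp add: sum.If_cases Int_absorb1 Int_absorb2 Un_Int_distrib flip: sum.inter_restrict)
    qed
    from this[of \<psi>] this[of \<gamma>] have "(v + w, g + h) = (\<Sum>j\<in>J \<union> K. \<nu> j *\<^sub>R \<psi> j, \<Sum>j\<in>J \<union> K. \<nu> j * \<gamma> j)"
      using J K by simp
    also have "\<dots> \<in> S"
      using J K by (intro S_I) (auto simp: \<nu>_def add_pos_pos)
    finally show "(v + w, g + h) \<in> S" .
  next
    fix v g and r :: real assume "(v, g) \<in> S" "0 < r"
    from S_E[OF this(1)] obtain J \<rho> where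
      J: "finite J" "J \<subseteq> I" "\<forall>j\<in>J. 0 < \<rho> j" "v = (\<Sum>j\<in>J. \<rho> j *\<^sub>R \<psi> j)" "g = (\<Sum>j\<in>J. \<rho> j * \<gamma> j)"
      by blast
    have "(r *\<^sub>R v, r * g) = (\<Sum>j\<in>J. (r * \<rho> j) *\<^sub>R \<psi> j, \<Sum>j\<in>J. (r * \<rho> j) * \<gamma> j)"
      using J by (simp add: scaleR_sum_right sum_distrib_left mult.assoc)
    also have "\<dots> \<in> S"
      using J \<open>0 < r\<close> by (intro S_I) auto
    finally show "(r *\<^sub>R v, r * g) \<in> S" .
  next
    fix v g j assume "(v, g) \<in> S" "d \<le> j"
    with S_E[OF this(1)] show "v j = 0"
      by (auto simp: sum_fun_apply supp subset_eq)
  next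
    fix v g assume "(v, g) \<in> S"
    from S_E[OF this] obtain J \<rho> where
      J: "finite J" "J \<subseteq> I" "\<forall>j\<in>J. 0 < \<rho> j" "v = (\<Sum>j\<in>J. \<rho> j *\<^sub>R \<psi> j)" "g = (\<Sum>j\<in>J. \<rho> j * \<gamma> j)"
      by blast
    show "\<exists>h. (- v, h) \<in> S"
      using J(1-4)
    proof (induction J arbitrary: v rule: finite_induct)
      case empty
      then have "- v = 0"
        by (metis neg_0_equal_iff_equal sum.empty)
      then have "(- v, 0) \<in> S"
        using S_I[of "{}" "\<lambda>_. 1"] by (metis empty_iff empty_subsetI finite.emptyI sum.empty)
      then show ?case
        by blast
    next
      case (insert j J)
      define s where "s = (\<Sum>j\<in>J. \<rho> j *\<^sub>R \<psi> j)"
      obtain h where h: "(- s, h) \<in> S"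
        using insert.IH[OF _ _ s_def] insert.prems by blast
      obtain i where i: "i \<in> I" "\<psi> i = - \<psi> j"
        using sym[of j] insert.prems by auto
      from S_E[OF h] obtain K \<mu> where
        K: "finite K" "K \<subseteq> I" "\<forall>j\<in>K. 0 < \<mu> j" "- s = (\<Sum>j\<in>K. \<mu> j *\<^sub>R \<psi> j)"
        by blast
      define \<nu> where "\<nu> k = (if k \<in> K then \<mu> k else 0) + (if k = i then \<rho> j else 0)" for k
      have "(\<Sum>k\<in>insert i K. \<nu> k *\<^sub>R \<psi> k) = (\<Sum>k\<in>K. \<mu> k *\<^sub>R \<psi> k) + \<rho> j *\<^sub>R \<psi> i"
      proof -
        have "(\<Sum>k\<in>insert i K. \<nu> k *\<^sub>R \<psi> k) = (\<Sum>k\<in>insert i K. if k \<in> K then \<mu> k *\<^sub>R \<psi> k else 0)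
            + (\<Sum>k\<in>insert i K. if k = i then \<rho> j *\<^sub>R \<psi> i else 0)"
          unfolding sum.distrib[symmetric] by (intro sum.cong) (auto simp: \<nu>_def algebra_simps)
        moreover have "(\<Sum>k\<in>insert i K. if k \<in> K then \<mu> k *\<^sub>R \<psi> k else 0) = (\<Sum>k\<in>K. \<mu> k *\<^sub>R \<psi> k)"
          using K(1) by (intro sum.mono_neutral_cong_right) auto
        ultimately show ?thesis
          using K(1) by simp
      qed
      also have "\<dots> = - (s + \<rho> j *\<^sub>R \<psi> j)"
        by (simp add: i(2) flip: K(4))
      also have "s + \<rho> j *\<^sub>R \<psi> j = v"
        by (simp only: insert.prems(3) sum.insert[OF insert.hyps] s_def add.commute)
      finally have eq: "(\<Sum>k\<in>insert i K. \<nu> k *\<^sub>R \<psi> k) = - v" .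
      have "(- v, \<Sum>k\<in>insert i K. \<nu> k * \<gamma> k) = (\<Sum>k\<in>insert i K. \<nu> k *\<^sub>R \<psi> k, \<Sum>k\<in>insert i K. \<nu> k * \<gamma> k)"
        by (simp only: eq)
      also have "\<dots> \<in> S"
        using K i insert.prems by (intro S_I) (auto simp: \<nu>_def add_pos_pos)
      finally show ?case
        by blast
    qed
  next
    fix g assume "(0, g) \<in> S"
    from S_E[OF this] obtain J \<rho> where
      J: "finite J" "J \<subseteq> I" "\<forall>j\<in>J. 0 < \<rho> j" "0 = (\<Sum>j\<in>J. \<rho> j *\<^sub>R \<psi> j)" "g = (\<Sum>j\<in>J. \<rho> j * \<gamma> j)"
      by blast
    have "(\<Sum>j\<in>J. \<rho> j * \<psi> j c) = 0" for c
      using fun_cong[OF J(4), of c] by (simp add: sum_fun_apply)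
    then have rel: "\<forall>c<d. (\<Sum>j\<in>J. \<rho> j * \<psi> j c) = 0"
      by blast
    have "0 \<le> (\<Sum>j\<in>J. \<rho> j * \<gamma> j)"
      by (rule caratheodory_nonneg[OF small J(1-3) rel])
    then show "0 \<le> g"
      using J(5) by simp
  qed
  then obtain t where t: "\<And>v g. (v, g) \<in> S \<Longrightarrow> (\<Sum>j<d. t j * v j) \<le> g"
    by blast
  have "(\<Sum>c<d. t c * \<psi> i c) \<le> \<gamma> i" if "i \<in> I" for i
    using t[of "\<psi> i" "\<gamma> i"] S_I[of "{i}" "\<lambda>_. 1"] that by simp
  then show ?thesis
    using that by blast
qed

section \<open>Approximation by linear and by quadratic forms\<close>

context seminorm
begin

text \<open>Adding the summands along a balanced binary tree, each of its \<open>m\<close> levels contributes the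
  same error.\<close>

lemma approx_additive_sum:
  assumes add: "\<And>x y. \<bar>F (x + y) - F x - F y\<bar> \<le> c * (N x + N y)"
    and c: "0 \<le> c" and "finite I" "card I \<le> 2 ^ m"
  shows "\<bar>F (\<Sum>i\<in>I. x i) - (\<Sum>i\<in>I. F (x i))\<bar> \<le> c * m * (\<Sum>i\<in>I. N (x i))"
  using assms(3,4)
proof (induction m arbitrary: I)
  case 0
  have "F 0 = 0"
    using add[of 0 0] by simp
  then show ?case
    using 0 by (cases "I = {}") (auto simp: le_Suc_eq card_1_singleton_iff)
next
  case (Suc m)
  have "min (card I) (2 ^ m) \<le> card I"
    by simp
  from obtain_subset_with_card_n[OF this]
  obtain J where J: "J \<subseteq> I" "card J = min (card I) (2 ^ m)"
    by metis
  define K where "K = I - J"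
  have "finite J" "finite K"
    unfolding K_def using J(1) Suc.prems(1) by (simp_all add: finite_subset)
  moreover have "I = J \<union> K" "J \<inter> K = {}"
    using J(1) unfolding K_def by blast+
  ultimately have JK: "I = J \<union> K" "J \<inter> K = {}" "finite J" "finite K"
    by blast+
  have "card K = card I - card J"
    unfolding K_def using J(1) JK(3) by (rule card_Diff_subset[rotated])
  then have cards: "card J \<le> 2 ^ m" "card K \<le> 2 ^ m"
    using J(2) Suc.prems(2) unfolding power_Suc by linarith+
  have sums: "(\<Sum>i\<in>I. f i) = (\<Sum>i\<in>J. f i) + (\<Sum>i\<in>K. f i)" for f :: "'b \<Rightarrow> 'c::comm_monoid_add"
    using JK by (simp add: sum.union_disjoint)
  have "N (\<Sum>i\<in>J. x i) + N (\<Sum>i\<in>K. x i) \<le> (\<Sum>i\<in>I. N (x i))"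
    unfolding sums by (intro add_mono sum_le)
  then have "c * (N (\<Sum>i\<in>J. x i) + N (\<Sum>i\<in>K. x i)) \<le> c * (\<Sum>i\<in>I. N (x i))"
    using c by (intro mult_left_mono)
  then have "\<bar>F (\<Sum>i\<in>I. x i) - F (\<Sum>i\<in>J. x i) - F (\<Sum>i\<in>K. x i)\<bar> \<le> c * (\<Sum>i\<in>I. N (x i))"
    unfolding sums using add[of "\<Sum>i\<in>J. x i" "\<Sum>i\<in>K. x i"] by linarith
  moreover note Suc.IH[OF JK(3) cards(1)] Suc.IH[OF JK(4) cards(2)]
  ultimately have "\<bar>F (\<Sum>i\<in>I. x i) - (\<Sum>i\<in>I. F (x i))\<bar>
      \<le> c * (\<Sum>i\<in>I. N (x i)) + c * m * (\<Sum>i\<in>J. N (x i)) + c * m * (\<Sum>i\<in>K. N (x i))"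
    unfolding sums[of "\<lambda>i. F (x i)"] by linarith
  also have "\<dots> = c * Suc m * (\<Sum>i\<in>I. N (x i))"
    unfolding sums by (simp add: algebra_simps)
  finally show ?case .
qed

end

text \<open>The linear form solves a system of inequalities, one for each vector; the relations of this
  system are the representations of \<open>0\<close> as a sum.\<close>

lemma approx_by_linear_form:
  fixes N :: "(nat \<Rightarrow> real) \<Rightarrow> real"
  assumes "seminorm N"
    and hom: "\<And>r x. F (r *\<^sub>R x) = r * F x"
    and add: "\<And>x y. \<bar>F (x + y) - F x - F y\<bar> \<le> c * (N x + N y)"
    and c: "0 \<le> c" and m: "n + 1 \<le> 2 ^ m"
  obtains t where "\<And>x. x \<in> real_space n \<Longrightarrow> \<bar>F x - (\<Sum>i<n. t i * x i)\<bar> \<le> c * m * N x"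
proof -
  interpret seminorm N by fact
  obtain t where t: "\<And>x. x \<in> real_space n \<Longrightarrow> (\<Sum>i<n. t i * x i) \<le> F x + c * m * N x"
  proof (rule linear_system_solvable[of "real_space n" n "\<lambda>x. x" "\<lambda>x. F x + c * m * N x"])
    show "\<exists>y\<in>real_space n. y = - x" if "x \<in> real_space n" for x
      using that by (auto simp: real_space_def fun_Compl_def)
  next
    fix J \<rho> assume J: "J \<subseteq> real_space n" "finite J" "card J \<le> n + 1" "\<forall>x\<in>J. 0 < \<rho> x"
      and rel: "\<forall>i<n. (\<Sum>x\<in>J. \<rho> x * x i) = 0"
    have "(\<Sum>x\<in>J. \<rho> x *\<^sub>R x) = 0"
    proof
      fix i show "(\<Sum>x\<in>J. \<rho> x *\<^sub>R x) i = 0 i"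
        using rel J(1) by (cases "i < n") (auto simp: sum_fun_apply real_space_def subset_eq intro!: sum.neutral)
    qed
    moreover have "F 0 = 0"
      using hom[of 0 0] by simp
    moreover have "\<bar>F (\<Sum>x\<in>J. \<rho> x *\<^sub>R x) - (\<Sum>x\<in>J. F (\<rho> x *\<^sub>R x))\<bar> \<le> c * m * (\<Sum>x\<in>J. N (\<rho> x *\<^sub>R x))"
      using J m c by (intro approx_additive_sum add) auto
    moreover have "(\<Sum>x\<in>J. N (\<rho> x *\<^sub>R x)) = (\<Sum>x\<in>J. \<rho> x * N x)"
      using J(4) by (intro sum.cong) (auto simp: scale)
    ultimately show "0 \<le> (\<Sum>x\<in>J. \<rho> x * (F x + c * m * N x))"
      by (simp add: hom algebra_simps sum.distrib sum_distrib_left)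
  qed (auto simp: real_space_def)
  have "\<bar>F x - (\<Sum>i<n. t i * x i)\<bar> \<le> c * m * N x" if x: "x \<in> real_space n" for x
  proof -
    have "- x \<in> real_space n"
      using x by (auto simp: real_space_def fun_Compl_def)
    then show ?thesis
      using t[OF x] t[of "- x"] hom[of "-1" x] unfolding abs_le_iff
      by (simp add: sum_negf)
  qed
  then show ?thesis
    using that by blast
qed

text \<open>
  A quadratic form is a linear functional of \<open>x \<otimes> x\<close>.  By duality an even 2-homogeneous function is
  close to a quadratic form as soon as its sums over two families with the same \<open>\<Sum>x \<otimes> x\<close> are close.
\<close>

lemma approx_by_quadratic_form:
  fixes N :: "(nat \<Rightarrow> real) \<Rightarrow> real"
  assumes "seminorm N" and n: "0 < n"
    and hom: "\<And>r x. G (r *\<^sub>R x) = r\<^sup>2 * G x"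
    and cov: "\<And>k (x :: nat \<Rightarrow> nat \<Rightarrow> real) y. k \<le> n * n + 1 \<Longrightarrow>
        (\<And>i. i < k \<Longrightarrow> x i \<in> real_space n) \<Longrightarrow> (\<And>i. i < k \<Longrightarrow> y i \<in> real_space n) \<Longrightarrow>
        (\<And>a b. a < n \<Longrightarrow> b < n \<Longrightarrow> (\<Sum>i<k. x i a * x i b) = (\<Sum>i<k. y i a * y i b)) \<Longrightarrow>
        \<bar>(\<Sum>i<k. G (x i)) - (\<Sum>i<k. G (y i))\<bar> \<le> M * ((\<Sum>i<k. (N (x i))\<^sup>2) + (\<Sum>i<k. (N (y i))\<^sup>2))"
  obtains q where "\<And>x. x \<in> real_space n \<Longrightarrow>
    \<bar>G x - (\<Sum>c<n*n. q c * (x (c div n) * x (c mod n)))\<bar> \<le> M * (N x)\<^sup>2"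
proof -
  interpret seminorm N by fact
  define sg where "sg s = (if s then 1 else -1 :: real)" for s
  define \<psi> where "\<psi> = (\<lambda>(s, x :: nat \<Rightarrow> real) c. if c < n * n then sg s * (x (c div n) * x (c mod n)) else 0)"
  define \<gamma> where "\<gamma> = (\<lambda>(s, x). sg s * G x + M * (N x)\<^sup>2)"
  obtain q where q: "\<And>i. i \<in> UNIV \<times> real_space n \<Longrightarrow> (\<Sum>c<n*n. q c * \<psi> i c) \<le> \<gamma> i"
  proof (rule linear_system_solvable[of "UNIV \<times> real_space n" "n * n" \<psi> \<gamma>])
    show "\<exists>i'\<in>UNIV \<times> real_space n. \<psi> i' = - \<psi> i" if "i \<in> UNIV \<times> real_space n" for i
      using that by (intro bexI[of _ "(\<not> fst i, snd i)"]) (auto simp: \<psi>_def sg_def fun_eq_iff split: prod.splits)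
  next
    fix J \<rho> assume J: "J \<subseteq> UNIV \<times> real_space n" "finite J" "card J \<le> n * n + 1" "\<forall>j\<in>J. 0 < \<rho> j"
      and rel: "\<forall>c<n*n. (\<Sum>j\<in>J. \<rho> j * \<psi> j c) = 0"
    define k where "k = card J"
    obtain e where e: "bij_betw e {..<k} J"
      using ex_bij_betw_nat_finite[OF J(2)] by (auto simp: k_def atLeast0LessThan)
    define z where "z i = sqrt (\<rho> (e i)) *\<^sub>R snd (e i)" for i
    define x y where "x i = (if fst (e i) then z i else 0)" and "y i = (if fst (e i) then 0 else z i)" for i
    have eJ: "e i \<in> J" if "i < k" for i
      using e that by (auto simp: bij_betw_def)
    have sum_e: "(\<Sum>j\<in>J. f j) = (\<Sum>i<k. f (e i))" for f :: "bool \<times> (nat \<Rightarrow> real) \<Rightarrow> real"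
      using sum.reindex_bij_betw[OF e, of f] by simp
    have z: "z i \<in> real_space n" if "i < k" for i
      using eJ[OF that] J(1) by (auto simp: z_def real_space_def)
    have sq: "sqrt (\<rho> (e i)) * sqrt (\<rho> (e i)) = \<rho> (e i)" if "i < k" for i
      using eJ[OF that] J(4) by (auto simp: less_imp_le)
    have G0: "G 0 = 0"
      using hom[of 0 0] by simp
    have "\<bar>(\<Sum>i<k. G (x i)) - (\<Sum>i<k. G (y i))\<bar> \<le> M * ((\<Sum>i<k. (N (x i))\<^sup>2) + (\<Sum>i<k. (N (y i))\<^sup>2))"
    proof (rule cov)
      show "k \<le> n * n + 1"
        using J(3) by (simp add: k_def)
      show "x i \<in> real_space n" "y i \<in> real_space n" if "i < k" for i
        using z[OF that] by (auto simp: x_def y_def real_space_def)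
      fix a b assume ab: "a < n" "b < n"
      let ?c = "a * n + b"
      have "?c < (a + 1) * n"
        using ab by simp
      also have "\<dots> \<le> n * n"
        using ab by (intro mult_right_mono) auto
      finally have c: "?c < n * n" .
      have "x i a * x i b - y i a * y i b = \<rho> (e i) * \<psi> (e i) ?c" if "i < k" for i
        using sq[OF that] c ab
        by (cases "e i") (auto simp: x_def y_def z_def \<psi>_def sg_def algebra_simps)
      then have "(\<Sum>i<k. x i a * x i b - y i a * y i b) = (\<Sum>i<k. \<rho> (e i) * \<psi> (e i) ?c)"
        by (intro sum.cong) auto
      also have "\<dots> = 0"
        using rel c sum_e[of "\<lambda>j. \<rho> j * \<psi> j ?c"] by simp
      finally show "(\<Sum>i<k. x i a * x i b) = (\<Sum>i<k. y i a * y i b)"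
        by (simp add: sum_subtractf)
    qed
    moreover have "(\<Sum>j\<in>J. \<rho> j * \<gamma> j)
        = (\<Sum>i<k. G (x i) - G (y i) + M * ((N (x i))\<^sup>2 + (N (y i))\<^sup>2))"
      unfolding sum_e
    proof (intro sum.cong refl)
      fix i assume "i \<in> {..<k}"
      then show "\<rho> (e i) * \<gamma> (e i) = G (x i) - G (y i) + M * ((N (x i))\<^sup>2 + (N (y i))\<^sup>2)"
        using sq[of i] G0
        by (cases "e i") (auto simp: x_def y_def z_def \<gamma>_def sg_def hom scale power2_eq_square algebra_simps)
    qed
    ultimately show "0 \<le> (\<Sum>j\<in>J. \<rho> j * \<gamma> j)"
      by (simp add: sum.distrib sum_subtractf sum_distrib_left algebra_simps abs_le_iff)
  qed (auto simp: \<psi>_def)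
  have "\<bar>G x - (\<Sum>c<n*n. q c * (x (c div n) * x (c mod n)))\<bar> \<le> M * (N x)\<^sup>2" if "x \<in> real_space n" for x
    using q[of "(True, x)"] q[of "(False, x)"] that unfolding abs_le_iff
    by (simp add: \<psi>_def \<gamma>_def sg_def sum_negf)
  then show ?thesis
    using that by blast
qed

section \<open>Rademacher averages\<close>

definition rademacher_mean :: "'i set \<Rightarrow> ('i \<Rightarrow> 'a::real_vector) \<Rightarrow> ('a \<Rightarrow> real) \<Rightarrow> real" where
  "rademacher_mean I x F = (\<Sum>S\<in>Pow I. F (\<Sum>i\<in>I. if i \<in> S then - x i else x i)) / 2 ^ card I"

lemma rademacher_mean_empty [simp]: "rademacher_mean {} x F = F 0"
  by (simp add: rademacher_mean_def)

lemma rademacher_mean_insert: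
  assumes "finite I" "i \<notin> I"
  shows "rademacher_mean (insert i I) x F
    = (rademacher_mean I x (\<lambda>z. F (x i + z)) + rademacher_mean I x (\<lambda>z. F (- x i + z))) / 2"
proof -
  let ?f = "\<lambda>J S. \<Sum>j\<in>J. if j \<in> S then - x j else x j"
  have disj: "Pow I \<inter> insert i ` Pow I = {}"
    using assms by auto
  have inj: "inj_on (insert i) (Pow I)"
    using assms by (auto simp: inj_on_def)
  have "(\<Sum>S\<in>Pow (insert i I). F (?f (insert i I) S))
      = (\<Sum>S\<in>Pow I. F (?f (insert i I) S)) + (\<Sum>S\<in>insert i ` Pow I. F (?f (insert i I) S))"
    unfolding Pow_insert using assms disj by (intro sum.union_disjoint) auto
  also have "(\<Sum>S\<in>insert i ` Pow I. F (?f (insert i I) S)) = (\<Sum>S\<in>Pow I. F (?f (insert i I) (insert i S)))"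
    by (simp add: sum.reindex[OF inj])
  also have "\<dots> = (\<Sum>S\<in>Pow I. F (- x i + ?f I S))"
  proof (intro sum.cong refl)
    fix S assume "S \<in> Pow I"
    have "?f (insert i I) (insert i S) = - x i + ?f I (insert i S)"
      using assms by (simp add: sum.insert)
    also have "?f I (insert i S) = ?f I S"
      using assms by (intro sum.cong) auto
    finally show "F (?f (insert i I) (insert i S)) = F (- x i + ?f I S)"
      by (simp only:)
  qed
  also have "(\<Sum>S\<in>Pow I. F (?f (insert i I) S)) = (\<Sum>S\<in>Pow I. F (x i + ?f I S))"
  proof (intro sum.cong refl)
    fix S assume "S \<in> Pow I"
    then have "i \<notin> S"
      using assms by auto
    then have "?f (insert i I) S = x i + ?f I S"
      using assms by (simp add: sum.insert)
    then show "F (?f (insert i I) S) = F (x i + ?f I S)"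
      by (simp only:)
  qed
  finally show ?thesis
    using assms unfolding rademacher_mean_def by (simp add: add_divide_distrib)
qed

lemma rademacher_mean_add:
  "rademacher_mean I x (\<lambda>z. F z + H z) = rademacher_mean I x F + rademacher_mean I x H"
  by (simp add: rademacher_mean_def sum.distrib add_divide_distrib)

lemma rademacher_mean_diff:
  "rademacher_mean I x (\<lambda>z. F z - H z) = rademacher_mean I x F - rademacher_mean I x H"
  by (simp add: rademacher_mean_def sum_subtractf diff_divide_distrib)

lemma rademacher_mean_cmult:
  "rademacher_mean I x (\<lambda>z. c * F z) = c * rademacher_mean I x F"
  by (simp add: rademacher_mean_def sum_distrib_left)

lemma rademacher_mean_sum:
  "rademacher_mean I x (\<lambda>z. \<Sum>j\<in>J. F j z) = (\<Sum>j\<in>J. rademacher_mean I x (F j))"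
  by (simp add: rademacher_mean_def sum.swap[of _ J] sum_divide_distrib)

lemma rademacher_mean_const [simp]:
  assumes "finite I"
  shows "rademacher_mean I x (\<lambda>_. c) = c"
  using assms by (simp add: rademacher_mean_def card_Pow)

lemma rademacher_mean_mono:
  assumes "\<And>z. F z \<le> H z"
  shows "rademacher_mean I x F \<le> rademacher_mean I x H"
  unfolding rademacher_mean_def by (intro divide_right_mono sum_mono assms) simp

lemma rademacher_mean_abs_diff_le:
  assumes "\<And>z. \<bar>F z - H z\<bar> \<le> B z"
  shows "\<bar>rademacher_mean I x F - rademacher_mean I x H\<bar> \<le> rademacher_mean I x B"
proof -
  have "rademacher_mean I x (\<lambda>z. F z - H z) \<le> rademacher_mean I x B"
    "rademacher_mean I x (\<lambda>z. H z - F z) \<le> rademacher_mean I x B"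
    using assms by (auto intro!: rademacher_mean_mono simp: abs_le_iff)
  then show ?thesis
    by (simp add: rademacher_mean_diff abs_le_iff)
qed

lemma rademacher_mean_uminus:
  assumes "finite I"
  shows "rademacher_mean I x (\<lambda>z. F (- z)) = rademacher_mean I x F"
  using assms
proof (induction I arbitrary: F rule: finite_induct)
  case (insert i I)
  have "rademacher_mean I x (\<lambda>z. F (- (x i + z))) = rademacher_mean I x (\<lambda>z. F (- x i + z))"
    using insert.IH[of "\<lambda>z. F (- x i + z)"] by simp
  moreover have "rademacher_mean I x (\<lambda>z. F (- (- x i + z))) = rademacher_mean I x (\<lambda>z. F (x i + z))"
    using insert.IH[of "\<lambda>z. F (x i + z)"] by simp
  ultimately show ?case
    using insert.hyps by (simp add: rademacher_mean_insert)
qed simp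

lemma rademacher_mean_union:
  assumes "finite I" "finite J" "I \<inter> J = {}"
  shows "rademacher_mean (I \<union> J) x F = rademacher_mean I x (\<lambda>z. rademacher_mean J x (\<lambda>w. F (z + w)))"
  using assms(1,3)
proof (induction I arbitrary: F rule: finite_induct)
  case (insert i I)
  then have "i \<notin> I \<union> J" "I \<inter> J = {}"
    by auto
  then show ?case
    using insert.hyps insert.IH[of "\<lambda>z. F (x i + z)"] insert.IH[of "\<lambda>z. F (- x i + z)"] assms(2)
    by (simp add: rademacher_mean_insert add.assoc del: uminus_add_conv_diff)
qed simp

lemma rademacher_mean_union_even:
  assumes "finite I" "finite J" "I \<inter> J = {}"
  shows "rademacher_mean (I \<union> J) x F
    = rademacher_mean I x (\<lambda>z. rademacher_mean J x (\<lambda>w. (F (z + w) + F (z - w)) / 2))"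
proof -
  have "rademacher_mean J x (\<lambda>w. (F (z + w) + F (z - w)) / 2) = rademacher_mean J x (\<lambda>w. F (z + w))" for z
  proof -
    have "rademacher_mean J x (\<lambda>w. 1/2 * F (z + w) + 1/2 * F (z - w))
        = 1/2 * rademacher_mean J x (\<lambda>w. F (z + w)) + 1/2 * rademacher_mean J x (\<lambda>w. F (z - w))"
      by (simp only: rademacher_mean_add rademacher_mean_cmult)
    moreover have "rademacher_mean J x (\<lambda>w. F (z - w)) = rademacher_mean J x (\<lambda>w. F (z + w))"
      using rademacher_mean_uminus[OF assms(2), of x "\<lambda>w. F (z + w)"] by simp
    ultimately show ?thesis
      by (simp add: add_divide_distrib)
  qed
  then show ?thesis
    using rademacher_mean_union[OF assms] by simp
qed

context seminorm
begin

text \<open>The seminorm has (Rademacher) type 2, with constant \<open>sqrt T\<close> in the usual normalization.\<close>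

definition type2 :: "real \<Rightarrow> bool" where
  "type2 T \<longleftrightarrow> (\<forall>I x. finite I \<longrightarrow>
     rademacher_mean (I :: nat set) x (\<lambda>z. (N z)\<^sup>2) \<le> T * (\<Sum>i\<in>I. (N (x i))\<^sup>2))"

text \<open>
  Random signs turn the approximate parallelogram law into approximate additivity over the summands:
  splitting a random sum into two halves costs the mean of the squared seminorms of the halves, which
  by type 2 is controlled by the summands.  So each level of a binary tree costs the same.
\<close>

lemma rademacher_mean_quadratic:
  fixes I :: "nat set"
  assumes par: "\<And>x y. \<bar>G (x + y) + G (x - y) - 2 * G x - 2 * G y\<bar> \<le> 2 * c * ((N x)\<^sup>2 + (N y)\<^sup>2)"
    and hom: "\<And>r x. G (r *\<^sub>R x) = r\<^sup>2 * G x"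
    and "type2 T" and c: "0 \<le> c" and "finite I" "card I \<le> 2 ^ m"
  shows "\<bar>rademacher_mean I x G - (\<Sum>i\<in>I. G (x i))\<bar> \<le> c * T * m * (\<Sum>i\<in>I. (N (x i))\<^sup>2)"
  using assms(5,6)
proof (induction m arbitrary: I)
  case 0
  have "G 0 = 0" "G (- z) = G z" for z
    using hom[of 0 0] hom[of "-1" z] by simp_all
  then show ?case
    using 0 by (cases "I = {}") (auto simp: le_Suc_eq card_1_singleton_iff rademacher_mean_insert)
next
  case (Suc m)
  have "min (card I) (2 ^ m) \<le> card I"
    by simp
  from obtain_subset_with_card_n[OF this]
  obtain J where J: "J \<subseteq> I" "card J = min (card I) (2 ^ m)"
    by metis
  define K where "K = I - J"
  have JK: "finite J" "finite K"
    unfolding K_def using J(1) Suc.prems(1) by (simp_all add: finite_subset)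
  have I: "I = J \<union> K" and disj: "J \<inter> K = {}"
    using J(1) unfolding K_def by blast+
  have "card K = card I - card J"
    unfolding K_def using JK(1) J(1) by (rule card_Diff_subset)
  then have cards: "card J \<le> 2 ^ m" "card K \<le> 2 ^ m"
    using J(2) Suc.prems(2) unfolding power_Suc by linarith+
  have sums: "(\<Sum>i\<in>I. f i) = (\<Sum>i\<in>J. f i) + (\<Sum>i\<in>K. f i)" for f :: "nat \<Rightarrow> real"
    using JK disj by (simp add: I sum.union_disjoint)
  let ?J = "rademacher_mean J x" and ?K = "rademacher_mean K x"
  have inner: "\<bar>?K (\<lambda>w. (G (z + w) + G (z - w)) / 2) - (G z + ?K G)\<bar> \<le> c * ((N z)\<^sup>2 + ?K (\<lambda>w. (N w)\<^sup>2))" for z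
  proof -
    have "\<bar>?K (\<lambda>w. (G (z + w) + G (z - w)) / 2) - ?K (\<lambda>w. G z + G w)\<bar> \<le> ?K (\<lambda>w. c * ((N z)\<^sup>2 + (N w)\<^sup>2))"
    proof (rule rademacher_mean_abs_diff_le)
      show "\<bar>(G (z + w) + G (z - w)) / 2 - (G z + G w)\<bar> \<le> c * ((N z)\<^sup>2 + (N w)\<^sup>2)" for w
        using par[of z w] unfolding abs_le_iff by (simp add: field_simps)
    qed
    then show ?thesis
      using JK(2) by (simp add: rademacher_mean_add rademacher_mean_cmult)
  qed
  have "\<bar>rademacher_mean I x G - ?J (\<lambda>z. G z + ?K G)\<bar> \<le> ?J (\<lambda>z. c * ((N z)\<^sup>2 + ?K (\<lambda>w. (N w)\<^sup>2)))"
    unfolding I rademacher_mean_union_even[OF JK disj]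
    by (rule rademacher_mean_abs_diff_le) (rule inner)
  then have "\<bar>rademacher_mean I x G - (?J G + ?K G)\<bar> \<le> c * (?J (\<lambda>z. (N z)\<^sup>2) + ?K (\<lambda>w. (N w)\<^sup>2))"
    using JK(1) by (simp add: rademacher_mean_add rademacher_mean_cmult)
  also have "\<dots> \<le> c * (T * (\<Sum>i\<in>J. (N (x i))\<^sup>2) + T * (\<Sum>i\<in>K. (N (x i))\<^sup>2))"
    using \<open>type2 T\<close> JK c unfolding type2_def by (intro mult_left_mono add_mono) auto
  finally have "\<bar>rademacher_mean I x G - (\<Sum>i\<in>I. G (x i))\<bar>
      \<le> c * (T * (\<Sum>i\<in>J. (N (x i))\<^sup>2) + T * (\<Sum>i\<in>K. (N (x i))\<^sup>2))
        + c * T * m * (\<Sum>i\<in>J. (N (x i))\<^sup>2) + c * T * m * (\<Sum>i\<in>K. (N (x i))\<^sup>2)"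
    unfolding sums using Suc.IH[OF JK(1) cards(1)] Suc.IH[OF JK(2) cards(2)] by linarith
  also have "\<dots> = c * T * Suc m * (\<Sum>i\<in>I. (N (x i))\<^sup>2)"
    unfolding sums by (simp add: algebra_simps)
  finally show ?case .
qed

end

section \<open>The group generated by reflections\<close>

definition ip :: "nat \<Rightarrow> (nat \<Rightarrow> real) \<Rightarrow> (nat \<Rightarrow> real) \<Rightarrow> real" where
  "ip k a b = (\<Sum>i<k. a i * b i)"

definition unit_vec :: "nat \<Rightarrow> nat \<Rightarrow> real" where
  "unit_vec l = (\<lambda>i. if i = l then 1 else 0)"

definition reflect :: "nat \<Rightarrow> (nat \<Rightarrow> real) \<Rightarrow> (nat \<Rightarrow> real) \<Rightarrow> (nat \<Rightarrow> real)" where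
  "reflect k w a = a - (2 * ip k a w / ip k w w) *\<^sub>R w"

text \<open>
  The orthogonal group of \<open>\<real>\<^sup>k\<close>, through its generators.  Reflection in a vector of length \<open>0\<close> is the
  identity, because of the division by \<open>ip k w w\<close>.
\<close>

inductive_set orth :: "nat \<Rightarrow> ((nat \<Rightarrow> real) \<Rightarrow> (nat \<Rightarrow> real)) set" for k where
  id: "id \<in> orth k"
| reflect: "w \<in> real_space k \<Longrightarrow> g \<in> orth k \<Longrightarrow> reflect k w \<circ> g \<in> orth k"

lemma real_space_diff: "a \<in> real_space k \<Longrightarrow> b \<in> real_space k \<Longrightarrow> a - b \<in> real_space k"
  and real_space_scaleR: "a \<in> real_space k \<Longrightarrow> r *\<^sub>R a \<in> real_space k"
  and real_space_unit_vec: "l < k \<Longrightarrow> unit_vec l \<in> real_space k"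
  by (auto simp: real_space_def unit_vec_def)

lemma ip_add: "ip k (a + b) c = ip k a c + ip k b c"
  and ip_diff: "ip k (a - b) c = ip k a c - ip k b c"
  and ip_scaleR: "ip k (r *\<^sub>R a) c = r * ip k a c"
  by (simp_all add: ip_def algebra_simps sum.distrib sum_subtractf sum_distrib_left)

lemma ip_commute: "ip k a b = ip k b a"
  by (simp add: ip_def mult.commute)

lemma ip_unit_vec: "l < k \<Longrightarrow> ip k a (unit_vec l) = a l"
  by (simp add: ip_def unit_vec_def if_distrib cong: if_cong)

lemma coord_sq_le_ip: "i < k \<Longrightarrow> (a i)\<^sup>2 \<le> ip k a a"
  unfolding ip_def power2_eq_square by (rule member_le_sum) auto

lemma ip_self_eq_0_iff: "a \<in> real_space k \<Longrightarrow> ip k a a = 0 \<longleftrightarrow> a = 0"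
  by (auto simp: ip_def sum_nonneg_eq_0_iff real_space_def fun_eq_iff) (metis lessThan_iff not_less)

lemma unit_vec_expansion:
  assumes "a \<in> real_space k"
  shows "a = (\<Sum>l<k. a l *\<^sub>R unit_vec l)"
proof
  fix i show "a i = (\<Sum>l<k. a l *\<^sub>R unit_vec l) i"
    using assms by (simp add: sum_fun_apply unit_vec_def real_space_def if_distrib cong: if_cong)
qed

lemma reflect_add: "reflect k w (a + b) = reflect k w a + reflect k w b"
  by (simp add: reflect_def ip_add algebra_simps add_divide_distrib)

lemma reflect_scaleR: "reflect k w (r *\<^sub>R a) = r *\<^sub>R reflect k w a"
  by (simp add: reflect_def ip_scaleR algebra_simps)

lemma reflect_ip: "ip k (reflect k w a) (reflect k w b) = ip k a b"
proof (cases "ip k w w = 0")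
  case True
  then show ?thesis
    by (simp add: reflect_def)
next
  case False
  have ip_right: "ip k x (y - z) = ip k x y - ip k x z" "ip k x (r *\<^sub>R y) = r * ip k x y" for x y z r
    unfolding ip_commute[of k x] by (rule ip_diff ip_scaleR)+
  define \<alpha> \<beta> where "\<alpha> = 2 * ip k a w / ip k w w" and "\<beta> = 2 * ip k b w / ip k w w"
  have "\<alpha> * ip k w w = 2 * ip k a w" "\<alpha> * ip k b w = \<beta> * ip k a w"
    using False by (simp_all add: \<alpha>_def \<beta>_def)
  moreover have "ip k (reflect k w a) (reflect k w b)
      = ip k a b - \<beta> * ip k a w - \<alpha> * ip k b w + \<beta> * (\<alpha> * ip k w w)"
    unfolding reflect_def \<alpha>_def[symmetric] \<beta>_def[symmetric]
    by (simp add: ip_diff ip_scaleR ip_right ip_commute[of k w b] right_diff_distrib)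
  ultimately show ?thesis
    by simp
qed

lemma reflect_involution: "reflect k w (reflect k w a) = a"
proof (cases "ip k w w = 0")
  case False
  then have "ip k (reflect k w a) w = - ip k a w"
    by (simp add: reflect_def ip_diff ip_scaleR)
  then show ?thesis
    by (simp add: reflect_def[of k w "reflect k w a"]) (simp add: reflect_def)
qed (simp add: reflect_def)

lemma orth_real_space: "g \<in> orth k \<Longrightarrow> a \<in> real_space k \<Longrightarrow> g a \<in> real_space k"
  by (induction rule: orth.induct)
    (auto simp: reflect_def intro!: real_space_diff real_space_scaleR)

lemma orth_add: "g \<in> orth k \<Longrightarrow> g (a + b) = g a + g b"
  by (induction rule: orth.induct) (simp_all only: id_apply o_apply reflect_add)

lemma orth_scaleR: "g \<in> orth k \<Longrightarrow> g (r *\<^sub>R a) = r *\<^sub>R g a"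
  by (induction rule: orth.induct) (simp_all only: id_apply o_apply reflect_scaleR)

lemma orth_diff: "g \<in> orth k \<Longrightarrow> g (a - b) = g a - g b"
  using orth_add[of g k a "- b"] orth_scaleR[of g k "-1" b] by simp

lemma orth_zero: "g \<in> orth k \<Longrightarrow> g 0 = 0"
  using orth_scaleR[of g k 0 0] by simp

lemma orth_sum:
  assumes "g \<in> orth k"
  shows "g (\<Sum>i\<in>I. a i) = (\<Sum>i\<in>I. g (a i))"
proof (induction I rule: infinite_finite_induct)
  case (insert i I)
  then show ?case
    using orth_add[OF assms, of "a i" "\<Sum>i\<in>I. a i"] by (metis sum.insert)
next
  case (infinite I)
  then show ?case
    by (simp only: sum.infinite orth_zero[OF assms] not_False_eq_True)
next
  case empty
  then show ?case
    by (simp only: sum.empty orth_zero[OF assms])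
qed

lemma orth_ip: "g \<in> orth k \<Longrightarrow> ip k (g a) (g b) = ip k a b"
  by (induction rule: orth.induct) (simp_all only: id_apply o_apply reflect_ip)

lemma orth_comp:
  assumes "g \<in> orth k" "h \<in> orth k"
  shows "g \<circ> h \<in> orth k"
  using assms(1)
proof (induction rule: orth.induct)
  case id
  then show ?case
    using assms(2) by (simp only: id_comp)
next
  case (reflect w g)
  show ?case
    unfolding comp_assoc by (rule orth.reflect[OF reflect.hyps(1) reflect.IH])
qed

lemma orth_inverse: "g \<in> orth k \<Longrightarrow> \<exists>h\<in>orth k. g \<circ> h = id \<and> h \<circ> g = id"
proof (induction rule: orth.induct)
  case id
  show ?case
    by (intro bexI[of _ id] orth.id) simp
next
  case (reflect w g)
  then obtain h where h: "h \<in> orth k" "g \<circ> h = id" "h \<circ> g = id"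
    by blast
  have "h \<circ> reflect k w \<in> orth k"
    using orth_comp[OF h(1) orth.reflect[OF reflect.hyps(1) orth.id]] by simp
  moreover have "(reflect k w \<circ> g) \<circ> (h \<circ> reflect k w) = id" "(h \<circ> reflect k w) \<circ> (reflect k w \<circ> g) = id"
  proof -
    have gh: "g (h a) = a" "h (g a) = a" for a
      using fun_cong[OF h(2), of a] fun_cong[OF h(3), of a] by simp_all
    show "(reflect k w \<circ> g) \<circ> (h \<circ> reflect k w) = id" "(h \<circ> reflect k w) \<circ> (reflect k w \<circ> g) = id"
      by (rule ext; simp only: o_apply gh reflect_involution id_apply)+
  qed
  ultimately show ?case
    by blast
qed

text \<open>The rows of an orthogonal matrix are normalized because its transpose is its inverse.\<close>

lemma orth_row:
  assumes "v \<in> orth k" "i < k"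
  shows "(\<Sum>l<k. (v (unit_vec l) i)\<^sup>2) = 1"
proof -
  obtain h where h: "h \<in> orth k" "h \<circ> v = id" "v \<circ> h = id"
    using orth_inverse[OF assms(1)] by blast
  have "v (unit_vec l) i = h (unit_vec i) l" if "l < k" for l
  proof -
    have "v (unit_vec l) i = ip k (v (unit_vec l)) (v (h (unit_vec i)))"
      using ip_unit_vec[OF assms(2), of "v (unit_vec l)"] fun_cong[OF h(3), of "unit_vec i"] by simp
    also have "\<dots> = ip k (h (unit_vec i)) (unit_vec l)"
      by (simp add: orth_ip[OF assms(1)] ip_commute)
    finally show ?thesis
      by (simp add: ip_unit_vec[OF that])
  qed
  then have "(\<Sum>l<k. (v (unit_vec l) i)\<^sup>2) = ip k (h (unit_vec i)) (h (unit_vec i))"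
    by (simp add: ip_def power2_eq_square)
  also have "\<dots> = 1"
    using ip_unit_vec[OF assms(2), of "unit_vec i"] by (simp add: orth_ip[OF h(1)] unit_vec_def)
  finally show ?thesis .
qed

definition flip :: "nat set \<Rightarrow> (nat \<Rightarrow> real) \<Rightarrow> (nat \<Rightarrow> real)" where
  "flip S a = (\<lambda>i. if i \<in> S then - a i else a i)"

lemma flip_orth:
  assumes "S \<subseteq> {..<k}"
  shows "flip S \<in> orth k"
proof -
  have "finite S"
    using assms finite_subset by blast
  then show ?thesis
    using assms
  proof (induction S rule: finite_induct)
    case empty
    have "flip {} = id"
      by (simp add: flip_def fun_eq_iff)
    then show ?case
      by (simp only: orth.id)
  next
    case (insert j S)
    have j: "ip k (unit_vec j) (unit_vec j) = 1" "ip k a (unit_vec j) = a j" for a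
      using insert.prems by (simp_all add: ip_unit_vec) (simp add: unit_vec_def)
    have "flip (insert j S) = reflect k (unit_vec j) \<circ> flip S"
      using insert.hyps by (auto simp: fun_eq_iff reflect_def j flip_def) (auto simp: unit_vec_def split: if_splits)
    moreover have "j < k" "flip S \<in> orth k"
      using insert.prems insert.IH by auto
    ultimately show ?case
      by (simp only: orth.reflect real_space_unit_vec)
  qed
qed

text \<open>Vectors with equal Gram matrices are congruent.  The new vector is put in place by reflecting
  in the difference of its actual and its intended position; this difference is orthogonal to the
  vectors which are already in place.\<close>

lemma gram_congruence:
  fixes n :: nat
  assumes "\<And>c. c < n \<Longrightarrow> r c \<in> real_space k" "\<And>c. c < n \<Longrightarrow> s c \<in> real_space k"
    and "\<And>c d. c < n \<Longrightarrow> d < n \<Longrightarrow> ip k (r c) (r d) = ip k (s c) (s d)"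
  shows "\<exists>g\<in>orth k. \<forall>c<n. g (r c) = s c"
  using assms
proof (induction n)
  case 0
  then show ?case
    using orth.id by auto
next
  case (Suc n)
  then obtain g where g: "g \<in> orth k" "\<And>c. c < n \<Longrightarrow> g (r c) = s c"
    by (metis less_SucI)
  define w where "w = g (r n) - s n"
  have w: "w \<in> real_space k"
    unfolding w_def using Suc.prems(1,2) by (intro real_space_diff orth_real_space[OF g(1)]) auto
  have norms: "ip k (g (r n)) (g (r n)) = ip k (s n) (s n)"
    using Suc.prems(3)[of n n] orth_ip[OF g(1)] by simp
  have "reflect k w (g (r n)) = s n"
  proof (cases "ip k w w = 0")
    case True
    then have "w = 0"
      using ip_self_eq_0_iff[OF w] by blast
    then show ?thesis
      using True by (simp add: reflect_def w_def)
  next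
    case False
    have "ip k w w = ip k (g (r n)) w - ip k (s n) w"
      by (simp add: ip_diff w_def)
    moreover have "ip k (s n) w = - ip k (g (r n)) w"
      unfolding ip_commute[of k "s n" w] ip_commute[of k "g (r n)" w]
      using norms ip_commute[of k "s n" "g (r n)"] by (simp add: w_def ip_diff)
    ultimately have "2 * ip k (g (r n)) w = ip k w w"
      by simp
    then have "reflect k w (g (r n)) = g (r n) - w"
      using False by (simp add: reflect_def)
    then show ?thesis
      by (simp add: w_def)
  qed
  moreover have "reflect k w (g (r c)) = s c" if c: "c < n" for c
  proof -
    have "ip k (s c) w = ip k (g (r n)) (s c) - ip k (s n) (s c)"
      using ip_diff[of k "g (r n)" "s n" "s c"] ip_commute[of k "s c" w] by (simp only: w_def)
    also have "\<dots> = ip k (g (r n)) (g (r c)) - ip k (s n) (s c)"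
      by (simp only: g(2)[OF c])
    also have "\<dots> = 0"
      using Suc.prems(3)[of n c] c orth_ip[OF g(1)] by simp
    finally show ?thesis
      using g(2)[OF c] by (simp add: reflect_def)
  qed
  ultimately have "\<forall>c<Suc n. (reflect k w \<circ> g) (r c) = s c"
    by (simp add: less_Suc_eq)
  then show ?case
    using orth.reflect[OF w g(1)] by blast
qed

text \<open>The group is totally bounded: matrix entries lie in \<open>[-1, 1]\<close>, so rounding them to multiples of
  \<open>\<delta>\<close> leaves finitely many classes, and one element is chosen from each.\<close>

lemma orth_net:
  assumes "0 < \<delta>"
  obtains V where "finite V" "V \<noteq> {}" "V \<subseteq> orth k"
    "\<And>g. g \<in> orth k \<Longrightarrow> \<exists>w\<in>V. \<forall>i<k. \<forall>l<k. \<bar>w (unit_vec l) i - g (unit_vec l) i\<bar> \<le> \<delta>"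
proof -
  define cell where "cell g = (\<lambda>(i, l). if i < k \<and> l < k then \<lfloor>g (unit_vec l) i / \<delta>\<rfloor> else 0)"
    for g :: "(nat \<Rightarrow> real) \<Rightarrow> nat \<Rightarrow> real"
  define B where "B = \<lceil>1 / \<delta>\<rceil> + 1"
  have entry: "\<bar>g (unit_vec l) i\<bar> \<le> 1" if "g \<in> orth k" "i < k" "l < k" for g i l
  proof -
    have "(g (unit_vec l) i)\<^sup>2 \<le> ip k (unit_vec l) (unit_vec l)"
      using coord_sq_le_ip[OF that(2), of "g (unit_vec l)"] orth_ip[OF that(1)] by simp
    also have "\<dots> = 1"
      using ip_unit_vec[OF that(3), of "unit_vec l"] by (simp add: unit_vec_def)
    finally show ?thesis
      by (simp add: abs_square_le_1)
  qed
  have "cell ` orth k \<subseteq> {f. \<forall>p. (p \<in> {..<k} \<times> {..<k} \<longrightarrow> f p \<in> {- B..B}) \<and> (p \<notin> {..<k} \<times> {..<k} \<longrightarrow> f p = 0)}"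
  proof clarify
    fix g p assume g: "g \<in> orth k"
    have "\<lfloor>g (unit_vec l) i / \<delta>\<rfloor> \<in> {- B..B}" if "i < k" "l < k" for i l
    proof -
      have "- (1 / \<delta>) \<le> g (unit_vec l) i / \<delta>" "g (unit_vec l) i / \<delta> \<le> 1 / \<delta>"
        using entry[OF g that] assms by (auto simp: abs_le_iff divide_simps)
      then show ?thesis
        unfolding B_def atLeastAtMost_iff by (simp add: le_floor_iff floor_le_iff) linarith
    qed
    then show "(p \<in> {..<k} \<times> {..<k} \<longrightarrow> cell g p \<in> {- B..B}) \<and> (p \<notin> {..<k} \<times> {..<k} \<longrightarrow> cell g p = 0)"
      by (cases p) (auto simp: cell_def)
  qed
  then have fin: "finite (cell ` orth k)"
    by (rule finite_subset) (intro finite_set_of_finite_funs; simp)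
  define rep where "rep c = (SOME g. g \<in> orth k \<and> cell g = c)" for c
  have rep: "rep (cell g) \<in> orth k \<and> cell (rep (cell g)) = cell g" if "g \<in> orth k" for g
    unfolding rep_def by (rule someI[of _ g]) (use that in auto)
  show ?thesis
  proof (rule that[of "rep ` cell ` orth k"])
    show "finite (rep ` cell ` orth k)"
      using fin by simp
    show "rep ` cell ` orth k \<noteq> {}"
      using orth.id by blast
    show "rep ` cell ` orth k \<subseteq> orth k"
      using rep by blast
    fix g assume g: "g \<in> orth k"
    define w where "w = rep (cell g)"
    have "\<bar>w (unit_vec l) i - g (unit_vec l) i\<bar> \<le> \<delta>" if "i < k" "l < k" for i l
    proof -
      have "cell w (i, l) = cell g (i, l)"
        using rep[OF g] by (simp add: w_def)
      then have "\<lfloor>w (unit_vec l) i / \<delta>\<rfloor> = \<lfloor>g (unit_vec l) i / \<delta>\<rfloor>"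
        using that by (simp add: cell_def)
      then have "\<bar>w (unit_vec l) i / \<delta> - g (unit_vec l) i / \<delta>\<bar> \<le> 1"
        by linarith
      then have "\<bar>(w (unit_vec l) i - g (unit_vec l) i) / \<delta>\<bar> \<le> 1"
        by (simp add: diff_divide_distrib)
      then show ?thesis
        using assms by (simp add: abs_div_pos[symmetric] pos_divide_le_eq)
    qed
    then show "\<exists>w\<in>rep ` cell ` orth k. \<forall>i<k. \<forall>l<k. \<bar>w (unit_vec l) i - g (unit_vec l) i\<bar> \<le> \<delta>"
      using g unfolding w_def by blast
  qed
qed

section \<open>Invariant averages\<close>

definition right_avg :: "('b \<Rightarrow> 'b) set \<Rightarrow> (('b \<Rightarrow> 'b) \<Rightarrow> real) \<Rightarrow> ('b \<Rightarrow> 'b) \<Rightarrow> real" where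
  "right_avg V \<phi> v = (\<Sum>w\<in>V. \<phi> (v \<circ> w)) / card V"

text \<open>
  A substitute for Haar measure: averaging repeatedly over right translations by the points of a
  finite net makes a function on a totally bounded group nearly constant.  Wherever the averaged
  function is evaluated, one of the translates comes close to a given point; if there the function
  is below the middle of its range, the average stays away from the top of the range by a fixed
  proportion.
\<close>

lemma right_avg_nearly_constant:
  assumes comp: "\<And>g h. g \<in> \<G> \<Longrightarrow> h \<in> \<G> \<Longrightarrow> g \<circ> h \<in> \<G>"
    and inv: "\<And>g. g \<in> \<G> \<Longrightarrow> \<exists>h\<in>\<G>. g \<circ> h = id"
    and one: "id \<in> \<G>"
    and V: "finite V" "V \<noteq> {}" "V \<subseteq> \<G>"
    and net: "\<And>g. g \<in> \<G> \<Longrightarrow> \<exists>w\<in>V. \<forall>v\<in>\<G>. \<forall>h\<in>\<G>. \<bar>\<phi> (v \<circ> w \<circ> h) - \<phi> (v \<circ> g \<circ> h)\<bar> \<le> \<eta>"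
    and bound: "\<And>v. v \<in> \<G> \<Longrightarrow> \<bar>\<phi> v\<bar> \<le> K" and \<eta>: "0 < \<eta>"
  shows "\<exists>m L. \<forall>v\<in>\<G>. L \<le> (right_avg V ^^ m) \<phi> v \<and> (right_avg V ^^ m) \<phi> v \<le> L + 4 * \<eta>"
proof -
  define r where "r = real (card V)"
  have r: "1 \<le> r"
    using V by (simp add: r_def Suc_le_eq card_gt_0_iff)
  define q where "q = 1 - 1 / (4 * r)"
  have q: "0 \<le> q" "q < 1" "1/2 \<le> q"
    using r by (auto simp: q_def field_simps)
  define near where "near \<phi> \<longleftrightarrow> (\<forall>g\<in>\<G>. \<exists>w\<in>V. \<forall>v\<in>\<G>. \<forall>h\<in>\<G>. \<bar>\<phi> (v \<circ> w \<circ> h) - \<phi> (v \<circ> g \<circ> h)\<bar> \<le> \<eta>)"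
    for \<phi> :: "('a \<Rightarrow> 'a) \<Rightarrow> real"
  have avg_le: "right_avg V \<phi> v \<le> B" if "\<And>w. w \<in> V \<Longrightarrow> \<phi> (v \<circ> w) \<le> B" for \<phi> v B
  proof -
    have "(\<Sum>w\<in>V. \<phi> (v \<circ> w)) \<le> (\<Sum>w\<in>V. B)"
      by (intro sum_mono that)
    then show ?thesis
      using r by (simp add: right_avg_def r_def divide_le_eq mult.commute)
  qed
  have avg_ge: "B \<le> right_avg V \<phi> v" if "\<And>w. w \<in> V \<Longrightarrow> B \<le> \<phi> (v \<circ> w)" for \<phi> v B
  proof -
    have "(\<Sum>w\<in>V. B) \<le> (\<Sum>w\<in>V. \<phi> (v \<circ> w))"
      by (intro sum_mono that)
    then show ?thesis
      using r by (simp add: right_avg_def r_def le_divide_eq mult.commute)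
  qed
  have near_avg: "near (right_avg V \<phi>)" if "near \<phi>" for \<phi>
    unfolding near_def
  proof
    fix g assume "g \<in> \<G>"
    with that obtain w where w: "w \<in> V" "\<And>v h. v \<in> \<G> \<Longrightarrow> h \<in> \<G> \<Longrightarrow> \<bar>\<phi> (v \<circ> w \<circ> h) - \<phi> (v \<circ> g \<circ> h)\<bar> \<le> \<eta>"
      unfolding near_def by blast
    have "\<bar>right_avg V \<phi> (v \<circ> w \<circ> h) - right_avg V \<phi> (v \<circ> g \<circ> h)\<bar> \<le> \<eta>" if "v \<in> \<G>" "h \<in> \<G>" for v h
    proof -
      have *: "\<bar>\<phi> (v \<circ> w \<circ> h \<circ> u) - \<phi> (v \<circ> g \<circ> h \<circ> u)\<bar> \<le> \<eta>" if "u \<in> V" for u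
        using w(2)[of v "h \<circ> u"] comp[of h u] V(3) that \<open>v \<in> \<G>\<close> \<open>h \<in> \<G>\<close> by (auto simp: comp_assoc)
      have "\<bar>(\<Sum>u\<in>V. \<phi> (v \<circ> w \<circ> h \<circ> u)) - (\<Sum>u\<in>V. \<phi> (v \<circ> g \<circ> h \<circ> u))\<bar> \<le> (\<Sum>u\<in>V. \<eta>)"
        unfolding sum_subtractf[symmetric] by (intro order_trans[OF sum_abs] sum_mono *)
      then have "\<bar>(\<Sum>u\<in>V. \<phi> (v \<circ> w \<circ> h \<circ> u)) - (\<Sum>u\<in>V. \<phi> (v \<circ> g \<circ> h \<circ> u))\<bar> / r \<le> \<eta>"
        using r by (simp add: r_def divide_le_eq mult.commute)
      then show ?thesis
        using r by (simp add: right_avg_def r_def abs_div_pos[symmetric] flip: diff_divide_distrib)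
    qed
    then show "\<exists>w\<in>V. \<forall>v\<in>\<G>. \<forall>h\<in>\<G>. \<bar>right_avg V \<phi> (v \<circ> w \<circ> h) - right_avg V \<phi> (v \<circ> g \<circ> h)\<bar> \<le> \<eta>"
      using w(1) by blast
  qed
  have contract: "\<exists>L'. \<forall>v\<in>\<G>. L' \<le> right_avg V \<phi> v \<and> right_avg V \<phi> v \<le> L' + max (4 * \<eta>) (q * D)"
    if L: "\<forall>v\<in>\<G>. L \<le> \<phi> v \<and> \<phi> v \<le> L + D" and "near \<phi>" for \<phi> L D
  proof -
    have L1: "L \<le> \<phi> (v \<circ> w)" and L2: "\<phi> (v \<circ> w) \<le> L + D" if "v \<in> \<G>" "w \<in> V" for v w
      using L comp[OF that(1), of w] that V(3) by auto
    have "0 \<le> D"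
      using L one by force
    consider "D \<le> 4 * \<eta>" | "\<forall>v\<in>\<G>. L + D / 2 \<le> \<phi> v" | w0 where "4 * \<eta> < D" "w0 \<in> \<G>" "\<phi> w0 < L + D / 2"
      by fastforce
    then show ?thesis
    proof cases
      case 1
      have "L \<le> right_avg V \<phi> v \<and> right_avg V \<phi> v \<le> L + max (4 * \<eta>) (q * D)" if "v \<in> \<G>" for v
        using avg_le[of \<phi> v "L + D"] avg_ge[of L \<phi> v] L1 L2 that 1 by fastforce
      then show ?thesis
        by blast
    next
      case 2
      have "L + D / 2 \<le> right_avg V \<phi> v \<and> right_avg V \<phi> v \<le> L + D / 2 + max (4 * \<eta>) (q * D)" if v: "v \<in> \<G>" for v
      proof -
        have "L + D / 2 \<le> right_avg V \<phi> v"
          using 2 comp[OF v] V(3) by (intro avg_ge) auto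
        moreover have "right_avg V \<phi> v \<le> L + D"
          using L2[OF v] by (intro avg_le) auto
        moreover have "D / 2 \<le> q * D"
          using q(3) \<open>0 \<le> D\<close> mult_right_mono[of "1/2" q D] by simp
        ultimately show ?thesis
          by linarith
      qed
      then show ?thesis
        by blast
    next
      case 3
      have "L \<le> right_avg V \<phi> v \<and> right_avg V \<phi> v \<le> L + max (4 * \<eta>) (q * D)" if v: "v \<in> \<G>" for v
      proof -
        obtain v' where v': "v' \<in> \<G>" "v \<circ> v' = id"
          using inv[OF v] by blast
        obtain w where w: "w \<in> V" "\<bar>\<phi> (v \<circ> w \<circ> id) - \<phi> (v \<circ> (v' \<circ> w0) \<circ> id)\<bar> \<le> \<eta>"
          using \<open>near \<phi>\<close> comp[OF v'(1) 3(2)] v one unfolding near_def by blast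
        have "v \<circ> (v' \<circ> w0) = w0"
          using v'(2) by (metis comp_assoc id_comp)
        then have low: "\<phi> (v \<circ> w) \<le> L + 3 * D / 4"
          using w(2) 3 by (simp add: abs_le_iff)
        have "(\<Sum>u\<in>V. \<phi> (v \<circ> u)) = \<phi> (v \<circ> w) + (\<Sum>u\<in>V - {w}. \<phi> (v \<circ> u))"
          using w(1) V(1) by (simp add: sum.remove)
        also have "\<dots> \<le> (L + 3 * D / 4) + (\<Sum>u\<in>V - {w}. L + D)"
          using low L2[OF v] by (intro add_mono sum_mono) auto
        also have "\<dots> = (L + q * D) * r"
          using w(1) V(1) r by (simp add: r_def q_def card_Diff_singleton of_nat_diff Suc_le_eq card_gt_0_iff V(2) field_simps)
        finally have "right_avg V \<phi> v \<le> L + q * D"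
          using r by (simp add: right_avg_def r_def divide_le_eq)
        moreover have "L \<le> right_avg V \<phi> v"
          using L1[OF v] by (intro avg_ge) auto
        ultimately show ?thesis
          by linarith
      qed
      then show ?thesis
        by blast
    qed
  qed
  have iter: "near ((right_avg V ^^ m) \<phi>) \<and> (\<exists>L. \<forall>v\<in>\<G>. L \<le> (right_avg V ^^ m) \<phi> v \<and>
      (right_avg V ^^ m) \<phi> v \<le> L + max (4 * \<eta>) (q ^ m * (2 * K)))" for m
  proof (induction m)
    case 0
    have "near \<phi>"
      unfolding near_def using net by blast
    moreover have "- K \<le> \<phi> v \<and> \<phi> v \<le> - K + max (4 * \<eta>) (2 * K)" if "v \<in> \<G>" for v
      using bound[OF that] by linarith
    ultimately show ?case
      by (auto intro!: exI[of _ "- K"])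
  next
    case (Suc m)
    then obtain L where L: "\<forall>v\<in>\<G>. L \<le> (right_avg V ^^ m) \<phi> v \<and>
        (right_avg V ^^ m) \<phi> v \<le> L + max (4 * \<eta>) (q ^ m * (2 * K))"
      by blast
    obtain L' where L': "\<And>v. v \<in> \<G> \<Longrightarrow> L' \<le> right_avg V ((right_avg V ^^ m) \<phi>) v \<and>
        right_avg V ((right_avg V ^^ m) \<phi>) v \<le> L' + max (4 * \<eta>) (q * max (4 * \<eta>) (q ^ m * (2 * K)))"
      using contract[OF L] Suc.IH by blast
    have "q * max (4 * \<eta>) (q ^ m * (2 * K)) \<le> max (4 * \<eta>) (q ^ Suc m * (2 * K))"
    proof -
      have "q * (4 * \<eta>) \<le> 4 * \<eta>"
        using q(1,2) \<eta> by (simp add: mult_left_le_one_le)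
      then show ?thesis
        using q(1) by (simp add: max_mult_distrib_left mult.assoc max.coboundedI1)
    qed
    then have "\<forall>v\<in>\<G>. L' \<le> (right_avg V ^^ Suc m) \<phi> v \<and>
        (right_avg V ^^ Suc m) \<phi> v \<le> L' + max (4 * \<eta>) (q ^ Suc m * (2 * K))"
      using L' by force
    then show ?case
      using near_avg Suc.IH by auto
  qed
  have "(\<lambda>m. q ^ m * (2 * K)) \<longlonglongrightarrow> 0 * (2 * K)"
    using q by (intro tendsto_mult LIMSEQ_power_zero tendsto_const) auto
  then have "eventually (\<lambda>m. q ^ m * (2 * K) < 4 * \<eta>) sequentially"
    using \<eta> by (intro order_tendstoD) auto
  then obtain m where "q ^ m * (2 * K) < 4 * \<eta>"
    by (auto simp: eventually_sequentially)
  then show ?thesis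
    using iter[of m] by (auto simp: max_def)
qed

section \<open>Tuples with the same covariance\<close>

lemma compact_box: "compact {a :: nat \<Rightarrow> real. \<forall>i. a i \<in> (if i < k then {- R..R} else {0})}"
proof -
  have eq: "{a :: nat \<Rightarrow> real. \<forall>i. a i \<in> (if i < k then {- R..R} else {0})}
      = PiE UNIV (\<lambda>i. if i < k then {- R..R} else {0})"
    by (auto simp: PiE_def Pi_def extensional_def)
  have "compactin (product_topology (\<lambda>i. euclidean) UNIV) (PiE UNIV (\<lambda>i::nat. if i < k then {- R..R} else {0}))"
    unfolding compactin_PiE by (auto simp: compactin_euclidean_iff)
  then show ?thesis
    unfolding eq by (simp add: euclidean_product_topology compactin_euclidean_iff)
qed

lemma dist_fun_le:
  fixes a b :: "nat \<Rightarrow> real"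
  assumes "\<And>i. \<bar>a i - b i\<bar> \<le> \<rho>"
  shows "dist a b \<le> 2 * \<rho>"
proof -
  have "dist a b \<le> (\<Sum>n. (1/2) ^ n * \<rho>)"
    unfolding dist_fun_def
  proof (rule suminf_le)
    show "(1/2) ^ n * min (dist (a (from_nat n)) (b (from_nat n))) 1 \<le> (1/2) ^ n * \<rho>" for n
      using assms[of "from_nat n"] by (intro mult_left_mono) (auto simp: dist_real_def)
    show "summable (\<lambda>n. (1/2) ^ n * min (dist (a (from_nat n)) (b (from_nat n))) 1)"
      by (rule summable_comparison_test'[of "\<lambda>n. (1/2) ^ n"])
        (auto simp: abs_mult intro!: mult_left_le_one_le summable_geometric)
    show "summable (\<lambda>n. (1/2) ^ n * \<rho>)"
      by (intro summable_mult2 summable_geometric) simp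
  qed
  also have "\<dots> = 2 * \<rho>"
    by (subst suminf_mult2[symmetric]) (simp_all add: suminf_geometric summable_geometric)
  finally show ?thesis .
qed

text \<open>Coefficient vectors are compared in the product topology of \<open>nat \<Rightarrow> real\<close>, in which the cube is
  compact.\<close>

definition cube :: "nat \<Rightarrow> (nat \<Rightarrow> real) set" where
  "cube k = {a \<in> real_space k. \<forall>i. \<bar>a i\<bar> \<le> 1}"

definition comb :: "nat \<Rightarrow> (nat \<Rightarrow> 'a::real_vector) \<Rightarrow> (nat \<Rightarrow> real) \<Rightarrow> 'a" where
  "comb k x a = (\<Sum>i<k. a i *\<^sub>R x i)"

context seminorm
begin

lemma comb_continuous:
  assumes G: "seminorm_continuous G"
  shows "continuous_on UNIV (\<lambda>a. G (comb k x a))"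
proof -
  have "isCont (\<lambda>a. G (comb k x a)) a0" for a0
    unfolding isCont_def tendsto_iff dist_real_def
  proof (intro allI impI)
    fix e :: real assume "0 < e"
    then obtain \<delta> where \<delta>: "\<delta> > 0" "\<And>y. N (y - comb k x a0) < \<delta> \<Longrightarrow> \<bar>G y - G (comb k x a0)\<bar> < e"
      using G unfolding seminorm_continuous_def by blast
    have N: "N (comb k x a - comb k x a0) \<le> (\<Sum>i<k. \<bar>a i - a0 i\<bar> * N (x i))" for a
    proof -
      have "comb k x a - comb k x a0 = (\<Sum>i<k. (a i - a0 i) *\<^sub>R x i)"
        by (simp add: comb_def sum_subtractf algebra_simps)
      then show ?thesis
        using sum_le[of "\<lambda>i. (a i - a0 i) *\<^sub>R x i" "{..<k}"] by (simp add: scale)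
    qed
    have "continuous_on UNIV (\<lambda>a. \<Sum>i<k. \<bar>a i - a0 i\<bar> * N (x i))"
      by (intro continuous_intros continuous_on_product_coordinates)
    then have "isCont (\<lambda>a. \<Sum>i<k. \<bar>a i - a0 i\<bar> * N (x i)) a0"
      by (simp add: continuous_on_eq_continuous_at)
    then have "((\<lambda>a. \<Sum>i<k. \<bar>a i - a0 i\<bar> * N (x i)) \<longlongrightarrow> 0) (at a0)"
      by (simp add: isCont_def)
    then have "eventually (\<lambda>a. (\<Sum>i<k. \<bar>a i - a0 i\<bar> * N (x i)) < \<delta>) (at a0)"
      using \<delta>(1) by (rule order_tendstoD)
    then show "eventually (\<lambda>a. \<bar>G (comb k x a) - G (comb k x a0)\<bar> < e) (at a0)"
      by (rule eventually_mono) (use N \<delta>(2) in \<open>blast intro: le_less_trans\<close>)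
  qed
  then show ?thesis
    by (simp add: continuous_on_eq_continuous_at)
qed

lemma comb_bounded_uniformly_continuous:
  assumes "seminorm_continuous G"
  shows "\<exists>K. \<forall>a\<in>cube k. \<bar>G (comb k x a)\<bar> \<le> K"
    and "0 < \<epsilon> \<Longrightarrow> \<exists>\<rho>>0. \<forall>a\<in>cube k. \<forall>b\<in>cube k. (\<forall>i<k. \<bar>a i - b i\<bar> \<le> \<rho>) \<longrightarrow> \<bar>G (comb k x a) - G (comb k x b)\<bar> < \<epsilon>"
proof -
  have cube_eq: "cube k = {a. \<forall>i. a i \<in> (if i < k then {- 1..1} else {0})}"
  proof (intro set_eqI iffI)
    fix a :: "nat \<Rightarrow> real" assume "a \<in> cube k"
    then show "a \<in> {a. \<forall>i. a i \<in> (if i < k then {- 1..1} else {0})}"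
      by (auto simp: cube_def real_space_def abs_le_iff)
  next
    fix a :: "nat \<Rightarrow> real" assume a: "a \<in> {a. \<forall>i. a i \<in> (if i < k then {- 1..1} else {0})}"
    have "\<bar>a i\<bar> \<le> 1" "k \<le> i \<Longrightarrow> a i = 0" for i
      using a[simplified, rule_format, of i] by (auto simp: abs_le_iff split: if_splits)
    then show "a \<in> cube k"
      by (simp add: cube_def real_space_def)
  qed
  have "compact (cube k)"
    unfolding cube_eq by (rule compact_box)
  have cont: "continuous_on (cube k) (\<lambda>a. G (comb k x a))"
    using comb_continuous[OF assms(1)] continuous_on_subset by blast
  then have "compact ((\<lambda>a. G (comb k x a)) ` cube k)"
    using \<open>compact (cube k)\<close> by (rule compact_continuous_image)
  then show "\<exists>K. \<forall>a\<in>cube k. \<bar>G (comb k x a)\<bar> \<le> K"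
    using compact_imp_bounded bounded_iff by (metis image_eqI real_norm_def)
  assume "0 < \<epsilon>"
  then obtain d where d: "d > 0" "\<And>a b. a \<in> cube k \<Longrightarrow> b \<in> cube k \<Longrightarrow> dist b a < d \<Longrightarrow> dist (G (comb k x b)) (G (comb k x a)) < \<epsilon>"
    using compact_uniformly_continuous[OF cont \<open>compact (cube k)\<close>] unfolding uniformly_continuous_on_def by metis
  have "\<bar>G (comb k x a) - G (comb k x b)\<bar> < \<epsilon>" if "a \<in> cube k" "b \<in> cube k" "\<forall>i<k. \<bar>a i - b i\<bar> \<le> d / 4" for a b
  proof -
    have "\<bar>a i - b i\<bar> \<le> d / 4" for i
      using that d(1) by (cases "i < k") (auto simp: cube_def real_space_def)
    then have "dist a b \<le> 2 * (d / 4)"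
      by (rule dist_fun_le)
    then show ?thesis
      using d(2)[OF that(2,1)] d(1) by (simp add: dist_real_def)
  qed
  then show "\<exists>\<rho>>0. \<forall>a\<in>cube k. \<forall>b\<in>cube k. (\<forall>i<k. \<bar>a i - b i\<bar> \<le> \<rho>) \<longrightarrow> \<bar>G (comb k x a) - G (comb k x b)\<bar> < \<epsilon>"
    using d(1) by (intro exI[of _ "d / 4"]) auto
qed

text \<open>Random signs are applied to the coefficients in each column of \<open>v\<close>.  Summed over the columns, the
  errors and the main terms add up to those of the tuple \<open>x\<close>, since the rows have norm 1.\<close>

lemma sign_average_of_rotated_tuple:
  assumes par: "\<And>x y. \<bar>G (x + y) + G (x - y) - 2 * G x - 2 * G y\<bar> \<le> 2 * c * ((N x)\<^sup>2 + (N y)\<^sup>2)"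
    and hom: "\<And>r x. G (r *\<^sub>R x) = r\<^sup>2 * G x"
    and "type2 T" and c: "0 \<le> c" and k: "k \<le> 2 ^ m" and v: "v \<in> orth k"
  shows "\<bar>(\<Sum>S\<in>Pow {..<k}. \<Sum>l<k. G (comb k x (flip S (v (unit_vec l))))) / 2 ^ k - (\<Sum>i<k. G (x i))\<bar>
    \<le> c * T * m * (\<Sum>i<k. (N (x i))\<^sup>2)"
proof -
  define z where "z l i = v (unit_vec l) i *\<^sub>R x i" for l i
  have mean: "(\<Sum>S\<in>Pow {..<k}. G (comb k x (flip S (v (unit_vec l))))) / 2 ^ k = rademacher_mean {..<k} (z l) G" for l
  proof -
    have "comb k x (flip S (v (unit_vec l))) = (\<Sum>i<k. if i \<in> S then - z l i else z l i)" for S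
      unfolding comb_def by (intro sum.cong) (auto simp: z_def flip_def)
    then show ?thesis
      by (simp add: rademacher_mean_def)
  qed
  have rows: "(\<Sum>l<k. \<Sum>i<k. (v (unit_vec l) i)\<^sup>2 * f i) = (\<Sum>i<k. f i)" for f :: "nat \<Rightarrow> real"
  proof -
    have "(\<Sum>l<k. \<Sum>i<k. (v (unit_vec l) i)\<^sup>2 * f i) = (\<Sum>i<k. (\<Sum>l<k. (v (unit_vec l) i)\<^sup>2) * f i)"
      by (subst sum.swap) (simp add: sum_distrib_right)
    then show ?thesis
      by (simp add: orth_row[OF v])
  qed
  have "(\<Sum>S\<in>Pow {..<k}. \<Sum>l<k. G (comb k x (flip S (v (unit_vec l))))) / 2 ^ k
      = (\<Sum>l<k. rademacher_mean {..<k} (z l) G)"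
    by (subst sum.swap) (simp only: mean[symmetric] sum_divide_distrib)
  moreover have "(\<Sum>l<k. \<Sum>i<k. G (z l i)) = (\<Sum>i<k. G (x i))"
    by (simp add: z_def hom rows)
  moreover have "\<bar>(\<Sum>l<k. rademacher_mean {..<k} (z l) G) - (\<Sum>l<k. \<Sum>i<k. G (z l i))\<bar>
      \<le> (\<Sum>l<k. c * T * m * (\<Sum>i<k. (N (z l i))\<^sup>2))"
    unfolding sum_subtractf[symmetric]
  proof (intro order_trans[OF sum_abs] sum_mono)
    show "\<bar>rademacher_mean {..<k} (z l) G - (\<Sum>i<k. G (z l i))\<bar> \<le> c * T * m * (\<Sum>i<k. (N (z l i))\<^sup>2)" for l
      by (rule rademacher_mean_quadratic[OF par hom \<open>type2 T\<close> c]) (use k in auto)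
  qed
  moreover have "(\<Sum>l<k. c * T * m * (\<Sum>i<k. (N (z l i))\<^sup>2)) = c * T * m * (\<Sum>i<k. (N (x i))\<^sup>2)"
    by (simp add: z_def scale power_mult_distrib rows flip: sum_distrib_left)
  ultimately show ?thesis
    by (simp only:)
qed

text \<open>
  Two families related by an orthogonal transformation \<open>g\<close> of \<open>\<real>\<^sup>k\<close>.  The function
  \<open>\<phi> v = \<Sum>\<^sub>l G (\<Sum>\<^sub>i (v e\<^sub>l)\<^sub>i y\<^sub>i)\<close> on the orthogonal group, averaged over sign changes to the left of
  \<open>v\<close>, is close to \<open>\<Sum> G (y\<^sub>i)\<close>; averaged over sign changes conjugated by \<open>g\<close>, it is close to
  \<open>\<Sum> G (x\<^sub>i)\<close>.  Both estimates survive averaging over right translations, after which \<open>\<phi>\<close> is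
  nearly constant and the two averages coincide up to a small error.
\<close>

lemma sums_over_congruent_tuples:
  assumes par: "\<And>x y. \<bar>G (x + y) + G (x - y) - 2 * G x - 2 * G y\<bar> \<le> 2 * c * ((N x)\<^sup>2 + (N y)\<^sup>2)"
    and hom: "\<And>r x. G (r *\<^sub>R x) = r\<^sup>2 * G x"
    and cont: "seminorm_continuous G"
    and "type2 T" and c: "0 \<le> c" and k: "k \<le> 2 ^ m"
    and g: "g \<in> orth k" "\<And>a. a \<in> real_space k \<Longrightarrow> comb k y (g a) = comb k x a"
  shows "\<bar>(\<Sum>i<k. G (x i)) - (\<Sum>i<k. G (y i))\<bar>
    \<le> c * T * m * ((\<Sum>i<k. (N (x i))\<^sup>2) + (\<Sum>i<k. (N (y i))\<^sup>2))"
proof -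
  define sx sy where "sx = (\<Sum>i<k. G (x i))" and "sy = (\<Sum>i<k. G (y i))"
  define \<kappa>x \<kappa>y where "\<kappa>x = c * T * m * (\<Sum>i<k. (N (x i))\<^sup>2)" and "\<kappa>y = c * T * m * (\<Sum>i<k. (N (y i))\<^sup>2)"
  define \<phi> where "\<phi> v = (\<Sum>l<k. G (comb k y (v (unit_vec l))))" for v
  define U where "U = cube k"
  have e_U: "v (unit_vec l) \<in> U" if v: "v \<in> orth k" and l: "l < k" for v l
  proof -
    have "\<bar>v (unit_vec l) i\<bar> \<le> 1" for i
    proof (cases "i < k")
      case True
      have "ip k (v (unit_vec l)) (v (unit_vec l)) = 1"
        using ip_unit_vec[OF l, of "unit_vec l"] by (simp add: orth_ip[OF v] unit_vec_def)
      then show ?thesis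
        using coord_sq_le_ip[OF True, of "v (unit_vec l)"] by (simp add: abs_square_le_1)
    next
      case False
      then show ?thesis
        using orth_real_space[OF v real_space_unit_vec[OF l]] by (simp add: real_space_def)
    qed
    then show ?thesis
      unfolding U_def cube_def using orth_real_space[OF v real_space_unit_vec[OF l]] by blast
  qed
  have inv: "\<bar>sx - sy\<bar> \<le> \<kappa>x + \<kappa>y + 4 * \<eta>" if \<eta>: "0 < \<eta>" for \<eta>
  proof -
    obtain \<rho> where \<rho>: "\<rho> > 0" "\<And>a b. a \<in> U \<Longrightarrow> b \<in> U \<Longrightarrow> (\<And>i. i < k \<Longrightarrow> \<bar>a i - b i\<bar> \<le> \<rho>)
        \<Longrightarrow> \<bar>G (comb k y a) - G (comb k y b)\<bar> < \<eta> / (k + 1)"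
      using comb_bounded_uniformly_continuous(2)[OF cont, where x = y and k = k and \<epsilon> = "\<eta> / (k + 1)"] \<eta>
      unfolding U_def by force
    obtain K where K: "\<And>a. a \<in> U \<Longrightarrow> \<bar>G (comb k y a)\<bar> \<le> K"
      using comb_bounded_uniformly_continuous(1)[OF cont, where x = y and k = k] unfolding U_def by blast
    define \<delta> where "\<delta> = \<rho> / (real k + 1)\<^sup>2"
    have \<delta>: "0 < \<delta>"
      using \<rho>(1) by (simp add: \<delta>_def)
    obtain V where V: "finite V" "V \<noteq> {}" "V \<subseteq> orth k"
      "\<And>g. g \<in> orth k \<Longrightarrow> \<exists>w\<in>V. \<forall>i<k. \<forall>l<k. \<bar>w (unit_vec l) i - g (unit_vec l) i\<bar> \<le> \<delta>"
      using orth_net[OF \<delta>, of k] by blast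
    have net: "\<exists>w\<in>V. \<forall>v\<in>orth k. \<forall>h\<in>orth k. \<bar>\<phi> (v \<circ> w \<circ> h) - \<phi> (v \<circ> g \<circ> h)\<bar> \<le> \<eta>" if g: "g \<in> orth k" for g
    proof -
      obtain w where w: "w \<in> V" "\<And>i l. i < k \<Longrightarrow> l < k \<Longrightarrow> \<bar>w (unit_vec l) i - g (unit_vec l) i\<bar> \<le> \<delta>"
        using V(4)[OF g] by blast
      have w_orth: "w \<in> orth k"
        using w(1) V(3) by blast
      have "\<bar>\<phi> (v \<circ> w \<circ> h) - \<phi> (v \<circ> g \<circ> h)\<bar> \<le> \<eta>" if v: "v \<in> orth k" and h: "h \<in> orth k" for v h
      proof -
        have close: "\<bar>v (w (h (unit_vec l))) i - v (g (h (unit_vec l))) i\<bar> \<le> \<rho>" if l: "l < k" and i: "i < k" for l i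
        proof -
          define a where "a = h (unit_vec l)"
          have a: "a \<in> real_space k" "\<And>j. \<bar>a j\<bar> \<le> 1"
            using e_U[OF h l] by (auto simp: a_def U_def cube_def)
          define d where "d = w a - g a"
          have expand: "u a j = (\<Sum>l<k. a l * u (unit_vec l) j)" if "u \<in> orth k" for u j
          proof -
            have "u a = (\<Sum>l<k. u (a l *\<^sub>R unit_vec l))"
              using arg_cong[OF unit_vec_expansion[OF a(1)], of u] by (simp only: orth_sum[OF that])
            then show ?thesis
              by (simp add: orth_scaleR[OF that] sum_fun_apply)
          qed
          have d: "\<bar>d j\<bar> \<le> k * \<delta>" if "j < k" for j
          proof -
            have "d j = (\<Sum>l<k. a l * (w (unit_vec l) j - g (unit_vec l) j))"
              by (simp add: d_def expand[OF w_orth] expand[OF g] sum_subtractf right_diff_distrib)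
            also have "\<bar>\<dots>\<bar> \<le> (\<Sum>l<k. 1 * \<delta>)"
            proof (intro order_trans[OF sum_abs] sum_mono)
              fix l assume "l \<in> {..<k}"
              then show "\<bar>a l * (w (unit_vec l) j - g (unit_vec l) j)\<bar> \<le> 1 * \<delta>"
                unfolding abs_mult using a(2) w(2)[OF that] by (intro mult_mono) auto
            qed
            finally show ?thesis
              by simp
          qed
          have "(v d i)\<^sup>2 \<le> ip k (v d) (v d)"
            by (rule coord_sq_le_ip[OF i])
          also have "\<dots> = (\<Sum>j<k. (d j)\<^sup>2)"
            by (simp add: orth_ip[OF v]) (simp add: ip_def power2_eq_square)
          also have "\<dots> \<le> (\<Sum>j<k. (k * \<delta>)\<^sup>2)"
            using d by (intro sum_mono) (simp add: abs_le_square_iff[symmetric] order_trans[OF _ abs_ge_self])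
          also have "\<dots> = k ^ 3 * \<delta>\<^sup>2"
            by (simp add: power2_eq_square power3_eq_cube)
          also have "\<dots> \<le> (real k + 1) ^ 4 * \<delta>\<^sup>2"
          proof (rule mult_right_mono)
            have "real k ^ 3 \<le> (real k + 1) ^ 3"
              by (rule power_mono) auto
            also have "\<dots> \<le> (real k + 1) ^ 4"
              by (rule power_increasing) auto
            finally show "real (k ^ 3) \<le> (real k + 1) ^ 4"
              by simp
          qed simp
          also have "\<dots> = \<rho>\<^sup>2"
            by (simp add: \<delta>_def power_divide)
          finally have "\<bar>v d i\<bar> \<le> \<rho>"
            using \<rho>(1) by (simp add: power2_le_iff_abs_le)
          moreover have "v d = v (w a) - v (g a)"
            unfolding d_def by (rule orth_diff[OF v])
          ultimately show ?thesis
            by (simp add: a_def)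
        qed
        have "\<bar>\<phi> (v \<circ> w \<circ> h) - \<phi> (v \<circ> g \<circ> h)\<bar> \<le> (\<Sum>l<k. \<eta> / (k + 1))"
          unfolding \<phi>_def sum_subtractf[symmetric]
        proof (intro order_trans[OF sum_abs] sum_mono)
          fix l assume "l \<in> {..<k}"
          then have l: "l < k"
            by simp
          have "v \<circ> w \<circ> h \<in> orth k" "v \<circ> g \<circ> h \<in> orth k"
            using v h w_orth g by (simp_all only: orth_comp)
          from e_U[OF this(1) l] e_U[OF this(2) l] show "\<bar>G (comb k y ((v \<circ> w \<circ> h) (unit_vec l))) - G (comb k y ((v \<circ> g \<circ> h) (unit_vec l)))\<bar> \<le> \<eta> / (k + 1)"
            using close[OF l] by (intro less_imp_le[OF \<rho>(2)]) simp_all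
        qed
        also have "\<dots> \<le> \<eta>"
          using \<eta> by (simp add: field_simps)
        finally show ?thesis .
      qed
      then show ?thesis
        using w(1) by blast
    qed
    have bound: "\<bar>\<phi> v\<bar> \<le> k * K" if "v \<in> orth k" for v
    proof -
      have "\<bar>\<phi> v\<bar> \<le> (\<Sum>l<k. K)"
        unfolding \<phi>_def using e_U[OF that] by (intro order_trans[OF sum_abs] sum_mono K) auto
      then show ?thesis
        by simp
    qed
    have inverse: "\<exists>h\<in>orth k. g \<circ> h = id" if "g \<in> orth k" for g
      using orth_inverse[OF that] by blast
    obtain n L where L: "\<And>v. v \<in> orth k \<Longrightarrow> L \<le> (right_avg V ^^ n) \<phi> v"
      "\<And>v. v \<in> orth k \<Longrightarrow> (right_avg V ^^ n) \<phi> v \<le> L + 4 * \<eta>"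
      using right_avg_nearly_constant[OF orth_comp inverse orth.id V(1-3) net bound \<eta>] by blast
    define mean where "mean \<psi> u v = (\<Sum>S\<in>Pow {..<k}. \<psi> (u \<circ> flip S \<circ> v)) / 2 ^ k"
      for \<psi> :: "((nat \<Rightarrow> real) \<Rightarrow> nat \<Rightarrow> real) \<Rightarrow> real" and u v
    have mean_avg: "mean (right_avg V \<psi>) u v = (\<Sum>w\<in>V. mean \<psi> u (v \<circ> w)) / card V" for \<psi> u v
      unfolding mean_def right_avg_def
      by (simp add: comp_assoc sum.swap[of _ V] flip: sum_divide_distrib)
    have avg_stable: "\<bar>mean ((right_avg V ^^ n) \<phi>) u v - s\<bar> \<le> \<kappa>"
      if "\<And>v. v \<in> orth k \<Longrightarrow> \<bar>mean \<phi> u v - s\<bar> \<le> \<kappa>" "v \<in> orth k" for u v s \<kappa> n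
      using that(2)
    proof (induction n arbitrary: v)
      case 0
      then show ?case
        using that(1) by simp
    next
      case (Suc n)
      have card: "0 < real (card V)"
        using V(1,2) by (simp add: card_gt_0_iff)
      have "mean ((right_avg V ^^ Suc n) \<phi>) u v - s = (\<Sum>w\<in>V. mean ((right_avg V ^^ n) \<phi>) u (v \<circ> w) - s) / card V"
        using card by (simp add: mean_avg sum_subtractf diff_divide_distrib)
      moreover have "\<bar>\<Sum>w\<in>V. mean ((right_avg V ^^ n) \<phi>) u (v \<circ> w) - s\<bar> \<le> (\<Sum>w\<in>V. \<kappa>)"
        using V(3) orth_comp[OF Suc.prems] by (intro order_trans[OF sum_abs] sum_mono Suc.IH) blast
      ultimately show ?case
        using card by (simp add: abs_div_pos[symmetric] divide_le_eq mult.commute)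
    qed
    have "\<bar>mean \<phi> id v - sy\<bar> \<le> \<kappa>y" if "v \<in> orth k" for v
      using sign_average_of_rotated_tuple[OF par hom \<open>type2 T\<close> c k that, of y]
      by (simp add: mean_def \<phi>_def sy_def \<kappa>y_def)
    then have "\<bar>mean ((right_avg V ^^ n) \<phi>) id id - sy\<bar> \<le> \<kappa>y"
      by (rule avg_stable[OF _ orth.id])
    moreover have "\<bar>mean \<phi> g v - sx\<bar> \<le> \<kappa>x" if v: "v \<in> orth k" for v
    proof -
      have "comb k y (g (flip S (v (unit_vec l)))) = comb k x (flip S (v (unit_vec l)))"
        if "S \<in> Pow {..<k}" "l < k" for S l
        using that by (intro g(2) orth_real_space[OF flip_orth] orth_real_space[OF v] real_space_unit_vec) auto
      then have "mean \<phi> g v = (\<Sum>S\<in>Pow {..<k}. \<Sum>l<k. G (comb k x (flip S (v (unit_vec l))))) / 2 ^ k"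
        by (simp add: mean_def \<phi>_def)
      then show ?thesis
        using sign_average_of_rotated_tuple[OF par hom \<open>type2 T\<close> c k v, of x]
        by (simp add: sx_def \<kappa>x_def)
    qed
    then have "\<bar>mean ((right_avg V ^^ n) \<phi>) g id - sx\<bar> \<le> \<kappa>x"
      by (rule avg_stable[OF _ orth.id])
    moreover have "L \<le> mean ((right_avg V ^^ n) \<phi>) u id \<and> mean ((right_avg V ^^ n) \<phi>) u id \<le> L + 4 * \<eta>"
      if u: "u \<in> orth k" for u
    proof -
      have in_orth: "u \<circ> flip S \<circ> id \<in> orth k" if "S \<in> Pow {..<k}" for S
        using flip_orth[of S k] that u by (simp only: comp_id orth_comp Pow_iff)
      have "(\<Sum>S\<in>Pow {..<k}. L) \<le> (\<Sum>S\<in>Pow {..<k}. (right_avg V ^^ n) \<phi> (u \<circ> flip S \<circ> id))"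
        by (intro sum_mono L(1) in_orth)
      moreover have "(\<Sum>S\<in>Pow {..<k}. (right_avg V ^^ n) \<phi> (u \<circ> flip S \<circ> id)) \<le> (\<Sum>S\<in>Pow {..<k}. L + 4 * \<eta>)"
        by (intro sum_mono L(2) in_orth)
      ultimately show ?thesis
        unfolding mean_def by (simp add: card_Pow le_divide_eq divide_le_eq mult.commute)
    qed
    note this[OF orth.id] this[OF g(1)]
    ultimately show ?thesis
      unfolding abs_le_iff by linarith
  qed
  have "\<bar>sx - sy\<bar> \<le> \<kappa>x + \<kappa>y"
  proof (rule field_le_epsilon)
    show "\<bar>sx - sy\<bar> \<le> \<kappa>x + \<kappa>y + e" if "0 < e" for e
      using inv[of "e / 4"] that by simp
  qed
  then show ?thesis
    by (simp add: sx_def sy_def \<kappa>x_def \<kappa>y_def algebra_simps)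
qed

end

section \<open>The spaces \<open>\<ell>\<^sub>p\<^sup>n\<close> and their type 2 constants\<close>

text \<open>
  The two conditions confine \<open>N\<close> between the norms of \<open>\<ell>\<^sub>\<infinity>\<^sup>n\<close> and \<open>\<ell>\<^sub>1\<^sup>n\<close>.  They make \<open>N\<close> a norm on
  \<open>\<real>\<^sup>n\<close> whose topology is the coordinatewise one, and let it ignore the coordinates from \<open>n\<close> on.
\<close>

locale coord_norm = seminorm N for N :: "(nat \<Rightarrow> real) \<Rightarrow> real" and n :: nat +
  assumes coord_le: "i < n \<Longrightarrow> \<bar>x i\<bar> \<le> N x"
    and le_sum_coords: "N x \<le> (\<Sum>i<n. \<bar>x i\<bar>)"

lemma powr_convex_nonneg:
  fixes u v a b p :: real
  assumes p: "1 \<le> p" and nn: "0 \<le> u" "0 \<le> v" "0 \<le> a" "0 \<le> b" and ab: "a + b = 1"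
  shows "(a * u + b * v) powr p \<le> a * u powr p + b * v powr p"
proof -
  have le: "(t * w) powr p \<le> t * w powr p" if "0 \<le> t" "t \<le> 1" "0 \<le> w" for t w :: real
  proof -
    have "t powr p \<le> t"
      using that p powr_mono'[of 1 p t] by (cases "t = 0") auto
    then show ?thesis
      using that by (simp add: powr_mult mult_right_mono)
  qed
  consider "u = 0" | "v = 0" | "0 < u" "0 < v"
    using nn by linarith
  then show ?thesis
  proof cases
    case 1
    then show ?thesis
      using le[of b v] nn ab p by simp
  next
    case 2
    then show ?thesis
      using le[of a u] nn ab p by simp
  next
    case 3
    have "a = 1 - b" "b \<le> 1"
      using nn ab by auto
    then show ?thesis
      using convex_onD[OF powr_convex[OF p], of b u v] 3 nn by simp
  qed
qed

lemma lp_norm_nonneg [simp]: "0 \<le> lp_norm n p x"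
  by (simp add: lp_norm_def)

lemma lp_norm_powr:
  assumes "0 < p"
  shows "lp_norm n p x powr p = (\<Sum>i<n. \<bar>x i\<bar> powr p)"
  using assms by (simp add: lp_norm_def powr_powr sum_nonneg)

lemma lp_norm_le_iff:
  assumes "0 < p" "0 \<le> r"
  shows "lp_norm n p x \<le> r \<longleftrightarrow> (\<Sum>i<n. \<bar>x i\<bar> powr p) \<le> r powr p"
  unfolding lp_norm_powr[OF assms(1), symmetric]
proof
  show "lp_norm n p x powr p \<le> r powr p" if "lp_norm n p x \<le> r"
    using that assms by (intro powr_mono2) auto
  show "lp_norm n p x \<le> r" if "lp_norm n p x powr p \<le> r powr p"
    using that powr_less_mono2[OF assms, of "lp_norm n p x"] by (meson not_le)
qed

lemma lp_norm_scale:
  assumes p: "1 \<le> p"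
  shows "lp_norm n p (r *\<^sub>R x) = \<bar>r\<bar> * lp_norm n p x"
proof -
  have "(\<Sum>i<n. \<bar>(r *\<^sub>R x) i\<bar> powr p) = \<bar>r\<bar> powr p * (\<Sum>i<n. \<bar>x i\<bar> powr p)"
    by (simp add: abs_mult powr_mult sum_distrib_left)
  then show ?thesis
    using p by (simp add: lp_norm_def powr_mult powr_powr sum_nonneg)
qed

text \<open>Minkowski's inequality: on the segment between the two normalized vectors the convex function
  \<open>\<Sum> \<bar>x\<^sub>i\<bar>\<^sup>p\<close> is at most 1.\<close>

lemma lp_norm_triangle:
  assumes p: "1 \<le> p"
  shows "lp_norm n p (x + y) \<le> lp_norm n p x + lp_norm n p y"
proof -
  have zero: "\<forall>i<n. x i = 0" if "lp_norm n p x = 0" for x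
    using that lp_norm_powr[of p n x] p by (simp add: sum_nonneg_eq_0_iff)
  define a b where "a = lp_norm n p x" and "b = lp_norm n p y"
  have "0 \<le> a" "0 \<le> b"
    by (simp_all add: a_def b_def)
  then consider "a = 0" | "b = 0" | "0 < a" "0 < b"
    by linarith
  then show ?thesis
  proof cases
    case 1
    then have "\<forall>i<n. x i = 0"
      using zero[of x] unfolding a_def b_def by blast
    then have "(\<Sum>i<n. \<bar>(x + y) i\<bar> powr p) = (\<Sum>i<n. \<bar>y i\<bar> powr p)"
      by (intro sum.cong) auto
    then have "lp_norm n p (x + y) = b"
      by (simp only: a_def b_def lp_norm_def)
    then show ?thesis
      using 1 by (simp add: a_def b_def)
  next
    case 2
    then have "\<forall>i<n. y i = 0"
      using zero[of y] unfolding a_def b_def by blast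
    then have "(\<Sum>i<n. \<bar>(x + y) i\<bar> powr p) = (\<Sum>i<n. \<bar>x i\<bar> powr p)"
      by (intro sum.cong) auto
    then have "lp_norm n p (x + y) = a"
      by (simp only: a_def b_def lp_norm_def)
    then show ?thesis
      using 2 by (simp add: a_def b_def)
  next
    case 3
    have term_le: "\<bar>x i + y i\<bar> powr p
        \<le> (a + b) powr p * (a / (a + b) * (\<bar>x i\<bar> powr p / a powr p) + b / (a + b) * (\<bar>y i\<bar> powr p / b powr p))" for i
    proof -
      have "\<bar>x i + y i\<bar> powr p \<le> (\<bar>x i\<bar> + \<bar>y i\<bar>) powr p"
        using p by (intro powr_mono2) auto
      also have "\<bar>x i\<bar> + \<bar>y i\<bar> = (a + b) * (a / (a + b) * (\<bar>x i\<bar> / a) + b / (a + b) * (\<bar>y i\<bar> / b))"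
      proof -
        have "a + b \<noteq> 0" "a \<noteq> 0" "b \<noteq> 0"
          using 3 by linarith+
        then show ?thesis
          by (simp add: distrib_left)
      qed
      also have "\<dots> powr p = (a + b) powr p * (a / (a + b) * (\<bar>x i\<bar> / a) + b / (a + b) * (\<bar>y i\<bar> / b)) powr p"
        by (rule powr_mult)
      also have "\<dots> \<le> (a + b) powr p * (a / (a + b) * (\<bar>x i\<bar> / a) powr p + b / (a + b) * (\<bar>y i\<bar> / b) powr p)"
        using 3 by (intro mult_left_mono powr_convex_nonneg p) (auto simp flip: add_divide_distrib)
      also have "\<dots> = (a + b) powr p * (a / (a + b) * (\<bar>x i\<bar> powr p / a powr p) + b / (a + b) * (\<bar>y i\<bar> powr p / b powr p))"
        using 3 by (simp add: powr_divide)
      finally show ?thesis .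
    qed
    have "(\<Sum>i<n. \<bar>(x + y) i\<bar> powr p)
        \<le> (\<Sum>i<n. (a + b) powr p * (a / (a + b) * (\<bar>x i\<bar> powr p / a powr p) + b / (a + b) * (\<bar>y i\<bar> powr p / b powr p)))"
      using term_le by (simp only: plus_fun_apply sum_mono)
    also have "\<dots> = (a + b) powr p * (a / (a + b) * ((\<Sum>i<n. \<bar>x i\<bar> powr p) / a powr p)
        + b / (a + b) * ((\<Sum>i<n. \<bar>y i\<bar> powr p) / b powr p))"
      by (simp only: sum_distrib_left[symmetric] sum.distrib sum_divide_distrib[symmetric])
    also have "\<dots> = (a + b) powr p * (a / (a + b) * (a powr p / a powr p) + b / (a + b) * (b powr p / b powr p))"
      using p by (simp add: a_def b_def lp_norm_powr)
    also have "\<dots> = (a + b) powr p"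
      using 3 by (simp flip: add_divide_distrib)
    finally show ?thesis
      using 3 p by (subst lp_norm_le_iff) (simp_all add: a_def b_def)
  qed
qed

lemma seminorm_le_sum_coords:
  fixes x :: "nat \<Rightarrow> real"
  assumes "seminorm N" and unit: "\<And>i. i < n \<Longrightarrow> N (\<lambda>j. if j = i then 1 else 0) \<le> 1"
    and restr: "N x = N (\<lambda>i. if i < n then x i else 0)"
  shows "N x \<le> (\<Sum>i<n. \<bar>x i\<bar>)"
proof -
  interpret seminorm N by fact
  have "(\<lambda>i. if i < n then x i else 0) = (\<Sum>i<n. x i *\<^sub>R (\<lambda>j. if j = i then 1 else 0))"
  proof
    fix i
    have "(\<Sum>j<n. x j *\<^sub>R (\<lambda>k. if k = j then 1 else 0)) i = (\<Sum>j<n. if j = i then x i else 0)"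
      unfolding sum_fun_apply by (intro sum.cong) auto
    then show "(if i < n then x i else 0) = (\<Sum>j<n. x j *\<^sub>R (\<lambda>k. if k = j then 1 else 0)) i"
      by simp
  qed
  then have "N x \<le> (\<Sum>i<n. N (x i *\<^sub>R (\<lambda>j. if j = i then 1 else 0)))"
    using sum_le restr by simp
  also have "\<dots> \<le> (\<Sum>i<n. \<bar>x i\<bar>)"
    unfolding scale by (intro sum_mono mult_left_le) (auto simp: unit)
  finally show ?thesis .
qed

lemma coord_norm_lp:
  assumes p: "1 \<le> p"
  shows "coord_norm (lp_norm n p) n"
proof -
  interpret seminorm "lp_norm n p"
    by unfold_locales (rule lp_norm_triangle[OF p] lp_norm_scale[OF p])+
  show ?thesis
  proof
    fix i and x :: "nat \<Rightarrow> real" assume i: "i < n"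
    have "\<bar>x i\<bar> = (\<bar>x i\<bar> powr p) powr (1 / p)"
      using p by (simp add: powr_powr)
    also have "\<dots> \<le> lp_norm n p x"
      unfolding lp_norm_def using p i by (intro powr_mono2 member_le_sum[of i "{..<n}" "\<lambda>i. \<bar>x i\<bar> powr p"]) auto
    finally show "\<bar>x i\<bar> \<le> lp_norm n p x" .
  next
    fix x :: "nat \<Rightarrow> real"
    show "lp_norm n p x \<le> (\<Sum>i<n. \<bar>x i\<bar>)"
    proof (rule seminorm_le_sum_coords[OF seminorm_axioms])
      fix i assume "i < n"
      have "(\<Sum>j<n. \<bar>if j = i then 1 else 0 :: real\<bar> powr p) = (\<Sum>j<n. if j = i then 1 else 0)"
        using p by (intro sum.cong) auto
      then show "lp_norm n p (\<lambda>j. if j = i then 1 else 0) \<le> 1"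
        using \<open>i < n\<close> by (simp add: lp_norm_def)
    qed (simp add: lp_norm_def)
  qed
qed

lemma linf_norm_le_iff:
  assumes "1 \<le> n"
  shows "linf_norm n x \<le> r \<longleftrightarrow> (\<forall>i<n. \<bar>x i\<bar> \<le> r)"
proof -
  have "(\<lambda>i. \<bar>x i\<bar>) ` {..<n} \<noteq> {}"
    using assms by (simp add: lessThan_empty_iff)
  then show ?thesis
    by (auto simp: linf_norm_def)
qed

lemma coord_norm_linf:
  assumes n: "1 \<le> n"
  shows "coord_norm (linf_norm n) n"
proof -
  have coord: "\<bar>x i\<bar> \<le> linf_norm n x" if "i < n" for x i
    using linf_norm_le_iff[OF n, of x "linf_norm n x"] that by simp
  have nonneg: "0 \<le> linf_norm n x" for x
    using coord[of 0 x] n by (meson abs_ge_zero less_le_trans order_trans zero_less_one)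
  interpret seminorm "linf_norm n"
  proof
    fix x y :: "nat \<Rightarrow> real"
    show "linf_norm n (x + y) \<le> linf_norm n x + linf_norm n y"
      unfolding linf_norm_le_iff[OF n]
    proof (intro allI impI)
      fix i assume "i < n"
      then show "\<bar>(x + y) i\<bar> \<le> linf_norm n x + linf_norm n y"
        using coord[of i x] coord[of i y] by simp
    qed
  next
    fix r :: real and x :: "nat \<Rightarrow> real"
    show "linf_norm n (r *\<^sub>R x) = \<bar>r\<bar> * linf_norm n x"
    proof (rule antisym)
      show "linf_norm n (r *\<^sub>R x) \<le> \<bar>r\<bar> * linf_norm n x"
        unfolding linf_norm_le_iff[OF n] by (auto simp: abs_mult intro!: mult_left_mono coord)
      show "\<bar>r\<bar> * linf_norm n x \<le> linf_norm n (r *\<^sub>R x)"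
      proof (cases "r = 0")
        case True
        then show ?thesis
          using nonneg[of "r *\<^sub>R x"] by simp
      next
        case False
        have "linf_norm n x \<le> linf_norm n (r *\<^sub>R x) / \<bar>r\<bar>"
          unfolding linf_norm_le_iff[OF n]
        proof (intro allI impI)
          fix i assume "i < n"
          then show "\<bar>x i\<bar> \<le> linf_norm n (r *\<^sub>R x) / \<bar>r\<bar>"
            using coord[of i "r *\<^sub>R x"] False by (simp add: abs_mult pos_le_divide_eq mult.commute)
        qed
        then show ?thesis
          using False by (simp add: pos_le_divide_eq mult.commute)
      qed
    qed
  qed
  show ?thesis
  proof
    show "linf_norm n x \<le> (\<Sum>i<n. \<bar>x i\<bar>)" for x
      unfolding linf_norm_le_iff[OF n] using member_le_sum[of _ "{..<n}" "\<lambda>i. \<bar>x i\<bar>"] by auto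
  qed (rule coord)
qed

lemma cosh_le_exp_half_square: "cosh (u::real) \<le> exp (u\<^sup>2 / 2)"
proof -
  have *: "ln (cosh u) \<le> u\<^sup>2 / 2" if u: "0 \<le> u" for u :: real
  proof -
    have tanh_le: "tanh v \<le> v" if "0 \<le> v" for v :: real
    proof -
      have "0 - tanh 0 \<le> v - tanh v"
      proof (rule DERIV_nonneg_imp_nondecreasing[OF that])
        fix x :: real
        have "((\<lambda>v. v - tanh v) has_real_derivative 1 - (1 - (tanh x)\<^sup>2)) (at x)"
          by (auto intro!: derivative_eq_intros)
        then show "\<exists>y. ((\<lambda>v. v - tanh v) has_real_derivative y) (at x) \<and> 0 \<le> y"
          by (intro exI conjI) auto
      qed
      then show ?thesis
        by simp
    qed
    have "0\<^sup>2 / 2 - ln (cosh 0) \<le> u\<^sup>2 / 2 - ln (cosh u)"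
    proof (rule DERIV_nonneg_imp_nondecreasing[OF u])
      fix x :: real assume "0 \<le> x"
      have "((\<lambda>u. u\<^sup>2 / 2 - ln (cosh u)) has_real_derivative x - tanh x) (at x)"
        by (auto intro!: derivative_eq_intros simp: tanh_def)
      then show "\<exists>y. ((\<lambda>u. u\<^sup>2 / 2 - ln (cosh u)) has_real_derivative y) (at x) \<and> 0 \<le> y"
        using tanh_le[OF \<open>0 \<le> x\<close>] by (intro exI conjI) auto
    qed
    then show ?thesis
      by simp
  qed
  have "ln (cosh u) \<le> u\<^sup>2 / 2"
    using *[of "\<bar>u\<bar>"] by simp
  then have "exp (ln (cosh u)) \<le> exp (u\<^sup>2 / 2)"
    by (simp only: exp_le_cancel_iff)
  then show ?thesis
    by (simp add: cosh_real_pos)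
qed

lemma rademacher_mean_exp:
  fixes t :: "'i \<Rightarrow> real"
  assumes "finite I"
  shows "rademacher_mean I t (\<lambda>s. exp (l * s)) \<le> exp (l\<^sup>2 * (\<Sum>i\<in>I. (t i)\<^sup>2) / 2)"
  using assms
proof (induction I rule: finite_induct)
  case (insert i I)
  have "rademacher_mean (insert i I) t (\<lambda>s. exp (l * s)) = cosh (l * t i) * rademacher_mean I t (\<lambda>s. exp (l * s))"
  proof -
    have e: "exp (l * (t i + s)) = exp (l * t i) * exp (l * s)"
      "exp (l * (- t i + s)) = exp (- (l * t i)) * exp (l * s)" for s
      by (simp_all add: algebra_simps flip: exp_add)
    show ?thesis
      unfolding rademacher_mean_insert[OF insert.hyps] e rademacher_mean_cmult
      by (simp add: cosh_field_def field_simps)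
  qed
  also have "\<dots> \<le> exp ((l * t i)\<^sup>2 / 2) * exp (l\<^sup>2 * (\<Sum>i\<in>I. (t i)\<^sup>2) / 2)"
    using insert.IH by (intro mult_mono cosh_le_exp_half_square)
      (auto simp: rademacher_mean_def intro!: sum_nonneg divide_nonneg_nonneg)
  also have "\<dots> = exp (l\<^sup>2 * (\<Sum>i\<in>insert i I. (t i)\<^sup>2) / 2)"
    using insert.hyps by (simp add: power_mult_distrib add_divide_distrib distrib_left flip: exp_add)
  finally show ?case .
qed simp

text \<open>Khinchine's inequality with the optimal order of growth in \<open>p\<close>, from the subgaussian exponential
  moments; \<open>l\<close> is the value that minimizes the resulting bound.\<close>

lemma khinchine:
  fixes t :: "'i \<Rightarrow> real"
  assumes "finite I" and p: "0 < p"
  shows "rademacher_mean I t (\<lambda>s. \<bar>s\<bar> powr p) \<le> 2 * exp (- p / 2) * (p * (\<Sum>i\<in>I. (t i)\<^sup>2)) powr (p / 2)"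
proof -
  define v where "v = (\<Sum>i\<in>I. (t i)\<^sup>2)"
  have "0 \<le> v"
    by (simp add: v_def sum_nonneg)
  show ?thesis
  proof (cases "v = 0")
    case True
    then have "t i = 0" if "i \<in> I" for i
      using that \<open>finite I\<close> by (simp add: v_def sum_nonneg_eq_0_iff)
    then have "(\<Sum>i\<in>I. if i \<in> S then - t i else t i) = 0" for S
      by (intro sum.neutral) auto
    then show ?thesis
      by (simp add: rademacher_mean_def)
  next
    case False
    then have v: "0 < v"
      using \<open>0 \<le> v\<close> by simp
    define l where "l = sqrt (p / v)"
    have l: "0 < l" "l\<^sup>2 * v = p"
      using p v by (simp_all add: l_def)
    have pl: "p / l = sqrt (p * v)"
      using p v by (simp add: l_def real_sqrt_divide real_sqrt_mult field_simps)
    have pw: "\<bar>s\<bar> powr p \<le> (p * v) powr (p / 2) * exp (- p) * (exp (l * s) + exp (- l * s))" for s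
    proof -
      have "l * \<bar>s\<bar> / p \<le> exp (l * \<bar>s\<bar> / p - 1)"
        using exp_ge_add_one_self[of "l * \<bar>s\<bar> / p - 1"] by simp
      then have "\<bar>s\<bar> \<le> p / l * exp (l * \<bar>s\<bar> / p - 1)"
        using p l(1) by (simp add: field_simps)
      then have "\<bar>s\<bar> powr p \<le> (sqrt (p * v) * exp (l * \<bar>s\<bar> / p - 1)) powr p"
        unfolding pl using p by (intro powr_mono2) auto
      also have "\<dots> = (p * v) powr (p / 2) * exp (p * (l * \<bar>s\<bar> / p - 1))"
        using p v by (simp add: powr_mult powr_half_sqrt[symmetric] powr_powr exp_powr_real mult.commute)
      also have "p * (l * \<bar>s\<bar> / p - 1) = - p + l * \<bar>s\<bar>"
        using p by (simp add: field_simps)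
      also have "exp (- p + l * \<bar>s\<bar>) \<le> exp (- p) * (exp (l * s) + exp (- l * s))"
        unfolding exp_add by (intro mult_left_mono) (auto simp: abs_if)
      finally show ?thesis
        by (simp add: mult.assoc mult_left_mono)
    qed
    have "rademacher_mean I t (\<lambda>s. \<bar>s\<bar> powr p)
        \<le> rademacher_mean I t (\<lambda>s. (p * v) powr (p / 2) * exp (- p) * (exp (l * s) + exp (- l * s)))"
      by (rule rademacher_mean_mono) (rule pw)
    also have "\<dots> = (p * v) powr (p / 2) * exp (- p) *
        (rademacher_mean I t (\<lambda>s. exp (l * s)) + rademacher_mean I t (\<lambda>s. exp (- l * s)))"
      by (simp only: rademacher_mean_cmult rademacher_mean_add)
    also have "\<dots> \<le> (p * v) powr (p / 2) * exp (- p) * (exp (p / 2) + exp (p / 2))"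
      using rademacher_mean_exp[OF \<open>finite I\<close>, of t l] rademacher_mean_exp[OF \<open>finite I\<close>, of t "- l"] l(2)
      by (intro mult_left_mono add_mono) (simp_all add: v_def)
    also have "\<dots> = 2 * (exp (- p) * exp (p / 2)) * (p * v) powr (p / 2)"
      by simp
    also have "exp (- p) * exp (p / 2) = exp (- p / 2)"
      by (simp flip: exp_add)
    finally show ?thesis
      by (simp add: v_def)
  qed
qed

lemma rademacher_mean_coord:
  "rademacher_mean I x (\<lambda>z. F (z c)) = rademacher_mean I (\<lambda>i. x i c) F"
  for x :: "'i \<Rightarrow> 'j \<Rightarrow> real"
proof -
  have "(\<Sum>i\<in>I. if i \<in> S then - x i else x i) c = (\<Sum>i\<in>I. if i \<in> S then - x i c else x i c)" for S
    unfolding sum_fun_apply by (intro sum.cong) auto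
  then show ?thesis
    by (simp add: rademacher_mean_def)
qed

text \<open>
  For \<open>p \<ge> 2\<close> Khinchine's inequality in each coordinate gives the mean of the \<open>p\<close>-th power of the
  norm; the square functions are then added up by Minkowski's inequality in \<open>\<ell>\<^bsub>p/2\<^esub>\<close>.
\<close>

lemma lp_type2:
  assumes p: "2 \<le> p"
  shows "seminorm.type2 (lp_norm n p) p"
proof -
  interpret coord_norm "lp_norm n p" n
    using p by (intro coord_norm_lp) simp
  show ?thesis
    unfolding type2_def
  proof (intro allI impI)
    fix I :: "nat set" and x :: "nat \<Rightarrow> nat \<Rightarrow> real" assume I: "finite I"
    define W where "W = (\<Sum>i\<in>I. (lp_norm n p (x i))\<^sup>2)"
    have "0 \<le> W"
      by (simp add: W_def sum_nonneg)
    define v where "v c = (\<Sum>i\<in>I. (x i c)\<^sup>2)" for c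
    interpret half: coord_norm "lp_norm n (p / 2)" n
      using p by (intro coord_norm_lp) simp
    have sq: "lp_norm n (p / 2) (\<lambda>c. (z c)\<^sup>2) = (lp_norm n p z)\<^sup>2" for z
    proof -
      have "\<bar>(z c)\<^sup>2\<bar> powr (p / 2) = \<bar>z c\<bar> powr p" for c
      proof (cases "z c = 0")
        case False
        then have "\<bar>(z c)\<^sup>2\<bar> = \<bar>z c\<bar> powr 2"
          by simp
        then show ?thesis
          by (simp only: powr_powr) simp
      qed simp
      moreover have "s powr (2 / p) = (s powr (1 / p))\<^sup>2" if "0 \<le> s" for s :: real
      proof (cases "s = 0")
        case False
        then have "(s powr (1 / p))\<^sup>2 = (s powr (1 / p)) powr 2"
          using that by simp
        then show ?thesis
          by (simp only: powr_powr) simp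
      qed simp
      ultimately show ?thesis
        by (simp add: lp_norm_def sum_nonneg)
    qed
    have v_nonneg: "0 \<le> v c" for c
      by (simp add: v_def sum_nonneg)
    have "lp_norm n (p / 2) v \<le> W"
    proof -
      have "v = (\<Sum>i\<in>I. (\<lambda>c. (x i c)\<^sup>2))"
        by (rule ext) (simp add: v_def sum_fun_apply)
      then show ?thesis
        using half.sum_le[of "\<lambda>i c. (x i c)\<^sup>2" I] by (simp add: W_def sq)
    qed
    then have sum_v: "(\<Sum>c<n. v c powr (p / 2)) \<le> W powr (p / 2)"
      using p \<open>0 \<le> W\<close> v_nonneg by (simp add: lp_norm_le_iff)
    have moment: "rademacher_mean I x (\<lambda>z. lp_norm n p z powr p) \<le> (p * W) powr (p / 2)"
    proof -
      have "rademacher_mean I x (\<lambda>z. lp_norm n p z powr p) = (\<Sum>c<n. rademacher_mean I (\<lambda>i. x i c) (\<lambda>s. \<bar>s\<bar> powr p))"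
        using p by (simp add: lp_norm_powr rademacher_mean_sum rademacher_mean_coord[where F = "\<lambda>s. \<bar>s\<bar> powr p"])
      also have "\<dots> \<le> (\<Sum>c<n. 2 * exp (- p / 2) * (p * v c) powr (p / 2))"
        using p I unfolding v_def by (intro sum_mono khinchine) auto
      also have "\<dots> = 2 * exp (- p / 2) * p powr (p / 2) * (\<Sum>c<n. v c powr (p / 2))"
        using p v_nonneg by (simp add: powr_mult sum_distrib_left mult.assoc)
      also have "\<dots> \<le> 2 * exp (- p / 2) * p powr (p / 2) * W powr (p / 2)"
        using sum_v by (intro mult_left_mono) auto
      also have "\<dots> = 2 * exp (- p / 2) * (p * W) powr (p / 2)"
        using p \<open>0 \<le> W\<close> by (simp add: powr_mult)
      also have "\<dots> \<le> 1 * (p * W) powr (p / 2)"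
      proof (rule mult_right_mono)
        have "2 \<le> exp (1::real)"
          using exp_ge_add_one_self[of 1] by simp
        also have "\<dots> \<le> exp (p / 2)"
          using p by simp
        finally show "2 * exp (- p / 2) \<le> 1"
          by (simp add: exp_minus field_simps)
      qed simp
      finally show ?thesis
        by simp
    qed
    show "rademacher_mean I x (\<lambda>z. (lp_norm n p z)\<^sup>2) \<le> p * (\<Sum>i\<in>I. (lp_norm n p (x i))\<^sup>2)"
    proof (cases "W = 0")
      case True
      then have zero: "lp_norm n p (x i) = 0" if "i \<in> I" for i
        using that I by (simp add: W_def sum_nonneg_eq_0_iff)
      have "lp_norm n p (\<Sum>i\<in>I. if i \<in> S then - x i else x i) = 0" for S
      proof -
        have "(\<Sum>i\<in>I. lp_norm n p (if i \<in> S then - x i else x i)) = 0"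
          by (intro sum.neutral) (auto simp: zero)
        then show ?thesis
          using sum_le[of "\<lambda>i. if i \<in> S then - x i else x i" I] by (simp add: order_antisym)
      qed
      then show ?thesis
        using p by (simp add: rademacher_mean_def sum_nonneg)
    next
      case False
      then have W: "0 < p * W"
        using \<open>0 \<le> W\<close> p by simp
      define m where "m = (p * W) powr (p / 2)"
      have m: "0 < m" "m powr (2 / p) = p * W"
        using W p False by (simp_all add: m_def powr_powr)
      \<comment> \<open>the tangent of the concave function \<open>s \<mapsto> s\<^bsup>2/p\<^esup>\<close> at \<open>m\<close>\<close>
      have tangent: "(lp_norm n p z)\<^sup>2 \<le> p * W * (1 - 2 / p) + 2 * W / m * lp_norm n p z powr p" for z
      proof (cases "lp_norm n p z = 0")
        case True
        moreover have "0 \<le> p * W * (1 - 2 / p)"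
          using \<open>0 \<le> W\<close> p by (intro mult_nonneg_nonneg) auto
        ultimately show ?thesis
          by simp
      next
        case nz: False
        define s where "s = lp_norm n p z powr p"
        have s: "0 < s" "s powr (2 / p) = (lp_norm n p z)\<^sup>2"
          using nz p lp_norm_nonneg[of n p z] by (simp_all add: s_def powr_powr)
        have "(s / m) powr (2 / p) * 1 powr (1 - 2 / p) \<le> 2 / p * (s / m) + (1 - 2 / p) * 1"
          using s m p by (intro Youngs_inequality_0) auto
        then have "m powr (2 / p) * (s / m) powr (2 / p) \<le> m powr (2 / p) * (2 / p * (s / m) + (1 - 2 / p))"
          by (intro mult_left_mono) auto
        moreover have "m powr (2 / p) * (s / m) powr (2 / p) = s powr (2 / p)"
          using m(1) s(1) by (simp flip: powr_mult)
        moreover have "p * W * (2 / p * (s / m)) = 2 * W / m * s"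
          using p by simp
        ultimately show ?thesis
          unfolding m(2) s(2) by (simp add: distrib_left s_def)
      qed
      have "rademacher_mean I x (\<lambda>z. (lp_norm n p z)\<^sup>2)
          \<le> rademacher_mean I x (\<lambda>z. p * W * (1 - 2 / p) + 2 * W / m * lp_norm n p z powr p)"
        by (rule rademacher_mean_mono) (rule tangent)
      also have "\<dots> = p * W * (1 - 2 / p) + 2 * W / m * rademacher_mean I x (\<lambda>z. lp_norm n p z powr p)"
        using I by (simp only: rademacher_mean_add rademacher_mean_cmult rademacher_mean_const)
      also have "\<dots> \<le> p * W * (1 - 2 / p) + 2 * W / m * m"
        using moment m(1) \<open>0 \<le> W\<close> unfolding m_def[symmetric] by (intro add_left_mono mult_left_mono) auto
      also have "\<dots> = p * W"
      proof -
        have "p * W * (2 / p) = 2 * W"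
          using p by simp
        then show ?thesis
          using m(1) by (simp add: right_diff_distrib)
      qed
      finally show ?thesis
        by (simp add: W_def)
    qed
  qed
qed

text \<open>With \<open>p\<close> of order \<open>ln n\<close> the norms of \<open>\<ell>\<^sub>p\<^sup>n\<close> and \<open>\<ell>\<^sub>\<infinity>\<^sup>n\<close> differ by a factor of at most \<open>e\<close>.\<close>

lemma linf_type2:
  assumes n: "1 \<le> n"
  shows "seminorm.type2 (linf_norm n) (9 * max 2 (ln n))"
proof -
  interpret coord_norm "linf_norm n" n
    using n by (rule coord_norm_linf)
  define p where "p = max 2 (ln (real n))"
  have p: "2 \<le> p"
    by (simp add: p_def)
  interpret lp: coord_norm "lp_norm n p" n
    using p by (intro coord_norm_lp) simp
  have le_lp: "linf_norm n x \<le> lp_norm n p x" for x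
    unfolding linf_norm_le_iff[OF n] using lp.coord_le by blast
  have "real n powr (1 / p) \<le> 3"
  proof -
    have "ln (real n) / p \<le> 1"
      using p by (simp add: p_def divide_le_eq)
    then have "real n powr (1 / p) \<le> exp 1"
      using n by (simp add: powr_def)
    then show ?thesis
      using exp_le by linarith
  qed
  moreover have "lp_norm n p x \<le> real n powr (1 / p) * linf_norm n x" for x
  proof -
    have "(\<Sum>i<n. \<bar>x i\<bar> powr p) \<le> (\<Sum>i<n. linf_norm n x powr p)"
      using p coord_le by (intro sum_mono powr_mono2) auto
    also have "\<dots> = (real n powr (1 / p) * linf_norm n x) powr p"
      using n p by (simp add: powr_mult powr_powr)
    finally show ?thesis
      using p by (subst lp_norm_le_iff) auto
  qed
  ultimately have lp_le: "lp_norm n p x \<le> 3 * linf_norm n x" for x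
    by (meson mult_right_mono nonneg order_trans)
  show ?thesis
    unfolding type2_def p_def[symmetric]
  proof (intro allI impI)
    fix I :: "nat set" and x :: "nat \<Rightarrow> nat \<Rightarrow> real" assume I: "finite I"
    have "rademacher_mean I x (\<lambda>z. (linf_norm n z)\<^sup>2) \<le> rademacher_mean I x (\<lambda>z. (lp_norm n p z)\<^sup>2)"
      by (intro rademacher_mean_mono power_mono le_lp) simp
    also have "\<dots> \<le> p * (\<Sum>i\<in>I. (lp_norm n p (x i))\<^sup>2)"
      using lp_type2[OF p, of n] I unfolding lp.type2_def by blast
    also have "\<dots> \<le> p * (\<Sum>i\<in>I. (3 * linf_norm n (x i))\<^sup>2)"
      using p by (intro mult_left_mono sum_mono power_mono lp_le) auto
    also have "\<dots> = 9 * p * (\<Sum>i\<in>I. (linf_norm n (x i))\<^sup>2)"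
      by (simp add: power_mult_distrib sum_distrib_left mult_ac)
    finally show "rademacher_mean I x (\<lambda>z. (linf_norm n z)\<^sup>2) \<le> 9 * p * (\<Sum>i\<in>I. (linf_norm n (x i))\<^sup>2)" .
  qed
qed

section \<open>The upper bounds\<close>

lemma shift_eq: "shift x j h = x + real j *\<^sub>R h"
  by (simp add: shift_def fun_eq_iff)

lemma diff3_eq: "diff3 f h x = third_diff f h x"
  by (simp add: diff3_def third_diff_def shift_eq numeral_3_eq_3 numeral_2_eq_2)

definition quadratic :: "nat \<Rightarrow> real \<Rightarrow> (nat \<Rightarrow> real) \<Rightarrow> (nat \<Rightarrow> real) \<Rightarrow> (nat \<Rightarrow> real) \<Rightarrow> real" where
  "quadratic n a t q x = a + (\<Sum>i<n. t i * x i) + (\<Sum>c<n*n. q c * (x (c div n) * x (c mod n)))"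

lemma third_diff_quadratic: "third_diff (quadratic n a t q) h x = 0"
proof -
  have lin: "(\<Sum>i<n. t i * (x + 3 *\<^sub>R h) i) - 3 * (\<Sum>i<n. t i * (x + 2 *\<^sub>R h) i) + 3 * (\<Sum>i<n. t i * (x + h) i)
      - (\<Sum>i<n. t i * x i) = 0"
    unfolding sum_distrib_left sum.distrib[symmetric] sum_subtractf[symmetric]
    by (intro sum.neutral) (simp add: algebra_simps)
  have quad: "(\<Sum>c<n*n. q c * ((x + 3 *\<^sub>R h) (c div n) * (x + 3 *\<^sub>R h) (c mod n)))
      - 3 * (\<Sum>c<n*n. q c * ((x + 2 *\<^sub>R h) (c div n) * (x + 2 *\<^sub>R h) (c mod n)))
      + 3 * (\<Sum>c<n*n. q c * ((x + h) (c div n) * (x + h) (c mod n)))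
      - (\<Sum>c<n*n. q c * (x (c div n) * x (c mod n))) = 0"
    unfolding sum_distrib_left sum.distrib[symmetric] sum_subtractf[symmetric]
    by (intro sum.neutral) (simp add: algebra_simps)
  show ?thesis
    unfolding third_diff_def quadratic_def using lin quad by (simp add: distrib_left)
qed

lemma polys_upto_add:
  assumes "\<phi> \<in> polys_upto n d" "\<psi> \<in> polys_upto n d"
  shows "(\<lambda>x. \<phi> x + \<psi> x) \<in> polys_upto n d"
proof -
  obtain a b where "\<phi> = (\<lambda>x. \<Sum>\<alpha>\<in>multi_indices n d. a \<alpha> * (\<Prod>i<n. x i ^ \<alpha> i))"
    "\<psi> = (\<lambda>x. \<Sum>\<alpha>\<in>multi_indices n d. b \<alpha> * (\<Prod>i<n. x i ^ \<alpha> i))"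
    using assms unfolding polys_upto_def by blast
  then have "(\<lambda>x. \<phi> x + \<psi> x) = (\<lambda>x. \<Sum>\<alpha>\<in>multi_indices n d. (a \<alpha> + b \<alpha>) * (\<Prod>i<n. x i ^ \<alpha> i))"
    by (simp add: sum.distrib distrib_right)
  then show ?thesis
    unfolding polys_upto_def by (intro CollectI exI[of _ "\<lambda>\<alpha>. a \<alpha> + b \<alpha>"])
qed

lemma polys_upto_monomial:
  assumes "\<alpha> \<in> multi_indices n d"
  shows "(\<lambda>x. c * (\<Prod>i<n. x i ^ \<alpha> i)) \<in> polys_upto n d"
proof -
  have "(\<Sum>\<beta>\<in>multi_indices n d. (if \<beta> = \<alpha> then c else 0) * (\<Prod>i<n. x i ^ \<beta> i)) = c * (\<Prod>i<n. x i ^ \<alpha> i)" for x :: "nat \<Rightarrow> real"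
  proof -
    have "(\<Sum>\<beta>\<in>multi_indices n d. (if \<beta> = \<alpha> then c else 0) * (\<Prod>i<n. x i ^ \<beta> i))
        = (\<Sum>\<beta>\<in>multi_indices n d. if \<beta> = \<alpha> then c * (\<Prod>i<n. x i ^ \<alpha> i) else 0)"
      by (intro sum.cong) auto
    then show ?thesis
      using assms finite_multi_indices by simp
  qed
  then show ?thesis
    unfolding polys_upto_def by (intro CollectI exI[of _ "\<lambda>\<beta>. if \<beta> = \<alpha> then c else 0"]) simp
qed

lemma polys_upto_zero: "(\<lambda>x. 0) \<in> polys_upto n d"
  unfolding polys_upto_def by (intro CollectI exI[of _ "\<lambda>\<beta>. 0"]) simp

lemma polys_upto_sum:
  assumes "finite I" "\<And>i. i \<in> I \<Longrightarrow> \<phi> i \<in> polys_upto n d"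
  shows "(\<lambda>x. \<Sum>i\<in>I. \<phi> i x) \<in> polys_upto n d"
  using assms
proof (induction I rule: finite_induct)
  case empty
  then show ?case
    using polys_upto_zero by simp
next
  case (insert i I)
  have "(\<lambda>x. \<phi> i x + (\<Sum>i\<in>I. \<phi> i x)) \<in> polys_upto n d"
    using insert.prems insert.IH by (intro polys_upto_add) auto
  then show ?case
    using insert.hyps by simp
qed

lemma quadratic_in_polys: "quadratic n a t q \<in> polys_upto n 2"
proof -
  have const: "(\<lambda>x. a) \<in> polys_upto n 2"
    using polys_upto_monomial[of "\<lambda>_. 0" n 2 a] by (simp add: multi_indices_def)
  have prod_delta: "(\<Prod>j<n. x j ^ (if j = i then 1 else 0)) = x i" if "i < n" for i and x :: "nat \<Rightarrow> real"
  proof -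
    have "(\<Prod>j<n. x j ^ (if j = i then 1 else 0)) = (\<Prod>j<n. if j = i then x i else 1)"
      by (intro prod.cong) auto
    then show ?thesis
      using that by simp
  qed
  have lin: "(\<lambda>x. c * x i) \<in> polys_upto n 2" if i: "i < n" for c i
  proof -
    have "(\<lambda>j. if j = i then 1 else 0) \<in> multi_indices n 2"
      using i by (auto simp: multi_indices_def)
    then show ?thesis
      using polys_upto_monomial[of "\<lambda>j. if j = i then 1 else 0" n 2 c] prod_delta[OF i] by simp
  qed
  have quad: "(\<lambda>x. c * (x i * x j)) \<in> polys_upto n 2" if i: "i < n" and j: "j < n" for c i j
  proof -
    let ?\<alpha> = "\<lambda>k. (if k = i then 1 else 0) + (if k = j then 1 else 0) :: nat"
    have "?\<alpha> \<in> multi_indices n 2"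
      using i j by (auto simp: multi_indices_def sum.distrib)
    moreover have "(\<Prod>k<n. x k ^ ?\<alpha> k) = x i * x j" for x :: "nat \<Rightarrow> real"
      using prod_delta[OF i] prod_delta[OF j] by (simp only: power_add prod.distrib)
    ultimately show ?thesis
      using polys_upto_monomial[of ?\<alpha> n 2 c] by simp
  qed
  have "(\<lambda>x. \<Sum>i<n. t i * x i) \<in> polys_upto n 2"
    by (intro polys_upto_sum lin) auto
  moreover have "(\<lambda>x. \<Sum>c<n*n. q c * (x (c div n) * x (c mod n))) \<in> polys_upto n 2"
  proof (intro polys_upto_sum quad)
    fix c assume "c \<in> {..<n*n}"
    then show "c div n < n" "c mod n < n"
      by (auto simp: less_mult_imp_div_less) (metis mod_less_divisor mult_0 not_gr_zero not_less_zero)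
  qed auto
  ultimately have "(\<lambda>x. a + (\<Sum>i<n. t i * x i) + (\<Sum>c<n*n. q c * (x (c div n) * x (c mod n)))) \<in> polys_upto n 2"
    by (intro polys_upto_add const)
  then show ?thesis
    by (simp add: quadratic_def[abs_def])
qed

lemma sum_div_mod: "(\<Sum>c<n*n. f (c div n) (c mod n)) = (\<Sum>i<n. \<Sum>j<n. f i j)"
  for f :: "nat \<Rightarrow> nat \<Rightarrow> real"
proof -
  have "(\<Sum>c<n*n. f (c div n) (c mod n)) = (\<Sum>(i, j)\<in>{..<n} \<times> {..<n}. f i j)"
  proof (rule sum.reindex_bij_witness[where i = "\<lambda>(i, j). i * n + j" and j = "\<lambda>c. (c div n, c mod n)"])
    fix c assume c: "c \<in> {..<n*n}"
    then have "0 < n"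
      by (cases n) auto
    then show "(c div n, c mod n) \<in> {..<n} \<times> {..<n}"
      using c by (auto simp: less_mult_imp_div_less)
  next
    fix b assume "b \<in> {..<n} \<times> {..<n}"
    then obtain i j where b: "b = (i, j)" "i < n" "j < n"
      by auto
    have "i * n + j < (i + 1) * n"
      using b by simp
    also have "\<dots> \<le> n * n"
      using b by (intro mult_right_mono) auto
    finally show "(case b of (i, j) \<Rightarrow> i * n + j) \<in> {..<n*n}"
      using b by simp
    show "((case b of (i, j) \<Rightarrow> i * n + j) div n, (case b of (i, j) \<Rightarrow> i * n + j) mod n) = b"
      using b by simp
  qed auto
  then show ?thesis
    by (simp add: sum.cartesian_product)
qed

text \<open>The properties of the form \<open>\<beta>\<close> in the homogeneous decomposition, with the constant \<open>70\<close> obtained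
  there.\<close>

definition (in seminorm) approx_bilinear :: "('a \<Rightarrow> 'a \<Rightarrow> real) \<Rightarrow> bool" where
  "approx_bilinear \<beta> \<longleftrightarrow> (\<forall>x y. \<beta> x y = \<beta> y x) \<and> (\<forall>r x y. \<beta> (r *\<^sub>R x) y = r * \<beta> x y) \<and>
     (\<forall>x x' y. \<bar>\<beta> (x + x') y - \<beta> x y - \<beta> x' y\<bar> \<le> 70 * (N x + N x') * N y) \<and>
     seminorm_continuous (\<lambda>x. \<beta> x x)"

context coord_norm
begin

definition approx_by_quadratic :: "real \<Rightarrow> bool" where
  "approx_by_quadratic A \<longleftrightarrow> (\<forall>\<beta>. approx_bilinear \<beta> \<longrightarrow>
     (\<exists>q. \<forall>x\<in>real_space n. \<bar>\<beta> x x - (\<Sum>c<n*n. q c * (x (c div n) * x (c mod n)))\<bar> \<le> A * (N x)\<^sup>2))"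

text \<open>
  The function \<open>\<beta> x x\<close> satisfies the parallelogram law approximately.  Two families with the same
  \<open>\<Sum> x \<otimes> x\<close> are, read coordinate by coordinate, two \<open>n\<close>-tuples of vectors in \<open>\<real>\<^sup>k\<close> with the same Gram
  matrix; the orthogonal map between these turns one family into the other.
\<close>

lemma approx_by_quadratic_type2:
  assumes T: "type2 T" and m: "n * n + 1 \<le> 2 ^ m" and n: "0 < n"
  shows "approx_by_quadratic (280 * T * m)"
  unfolding approx_by_quadratic_def
proof (intro allI impI)
  fix \<beta> assume "approx_bilinear \<beta>"
  then have sym: "\<beta> x y = \<beta> y x" and hom: "\<beta> (r *\<^sub>R x) y = r * \<beta> x y"
    and add: "\<bar>\<beta> (x + x') y - \<beta> x y - \<beta> x' y\<bar> \<le> 70 * (N x + N x') * N y"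
    and cont: "seminorm_continuous (\<lambda>x. \<beta> x x)" for x x' y r
    unfolding approx_bilinear_def by blast+
  have hom2: "\<beta> (r *\<^sub>R x) (r *\<^sub>R x) = r\<^sup>2 * \<beta> x x" for r x
    using hom[of r x "r *\<^sub>R x"] sym[of x "r *\<^sub>R x"] hom[of r x x] by (simp add: power2_eq_square)
  have square: "\<bar>\<beta> (x + y) (x + y) - \<beta> x x - 2 * \<beta> x y - \<beta> y y\<bar> \<le> 140 * (N x + N y)\<^sup>2" for x y
  proof -
    let ?s = "N x + N y"
    have s: "0 \<le> ?s"
      using nonneg[of x] nonneg[of y] by linarith
    have "70 * ?s * N (x + y) \<le> 70 * ?s * ?s"
      using s triangle[of x y] by (intro mult_left_mono) auto
    moreover have "70 * ?s * N x + 70 * ?s * N y = 70 * ?s * ?s"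
      by (simp add: algebra_simps)
    ultimately show ?thesis
      using add[of x y "x + y"] add[of x y x] add[of x y y] sym[of x "x + y"] sym[of y "x + y"] sym[of x y]
      unfolding power2_eq_square abs_le_iff by linarith
  qed
  have par: "\<bar>\<beta> (x + y) (x + y) + \<beta> (x - y) (x - y) - 2 * \<beta> x x - 2 * \<beta> y y\<bar> \<le> 2 * 280 * ((N x)\<^sup>2 + (N y)\<^sup>2)" for x y
  proof -
    have "\<beta> (- y) (- y) = \<beta> y y" "\<beta> x (- y) = - \<beta> x y"
      using hom2[of "-1" y] hom[of "-1" y x] sym[of x y] sym[of x "- y"] by simp_all
    then have "\<bar>\<beta> (x + y) (x + y) + \<beta> (x - y) (x - y) - 2 * \<beta> x x - 2 * \<beta> y y\<bar> \<le> 280 * (N x + N y)\<^sup>2"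
      using square[of x y] square[of x "- y"] by (simp add: abs_le_iff)
    also have "(N x + N y)\<^sup>2 \<le> 2 * ((N x)\<^sup>2 + (N y)\<^sup>2)"
      using zero_le_power2[of "N x - N y"] by (simp add: power2_eq_square algebra_simps)
    finally show ?thesis
      by simp
  qed
  have "\<bar>(\<Sum>i<k. \<beta> (x i) (x i)) - (\<Sum>i<k. \<beta> (y i) (y i))\<bar>
      \<le> 280 * T * m * ((\<Sum>i<k. (N (x i))\<^sup>2) + (\<Sum>i<k. (N (y i))\<^sup>2))"
    if k: "k \<le> n * n + 1" and x: "\<And>i. i < k \<Longrightarrow> x i \<in> real_space n" and y: "\<And>i. i < k \<Longrightarrow> y i \<in> real_space n"
      and cov: "\<And>a b. a < n \<Longrightarrow> b < n \<Longrightarrow> (\<Sum>i<k. x i a * x i b) = (\<Sum>i<k. y i a * y i b)"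
    for k and x y :: "nat \<Rightarrow> nat \<Rightarrow> real"
  proof -
    define row where "row z c = (\<lambda>i. if i < k then z i c else 0)" for z :: "nat \<Rightarrow> nat \<Rightarrow> real" and c
    have row: "row z c \<in> real_space k" for z c
      by (simp add: row_def real_space_def)
    have ip_row: "ip k a (row z c) = (\<Sum>i<k. a i * z i c)" for a z c
      unfolding ip_def row_def by (intro sum.cong) auto
    have "ip k (row x c) (row x d) = ip k (row y c) (row y d)" if "c < n" "d < n" for c d
    proof -
      have "ip k (row z c) (row z d) = (\<Sum>i<k. z i c * z i d)" for z
        unfolding ip_row by (intro sum.cong) (auto simp: row_def)
      then show ?thesis
        using cov[OF that] by simp
    qed
    then obtain g where g: "g \<in> orth k" "\<And>c. c < n \<Longrightarrow> g (row x c) = row y c"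
      using gram_congruence[of n "row x" k "row y"] row by blast
    have "comb k y (g a) = comb k x a" if "a \<in> real_space k" for a
    proof
      fix c :: nat
      have coord: "comb k z b c = (\<Sum>i<k. b i * z i c)" for z b
        by (simp add: comb_def sum_fun_apply)
      show "comb k y (g a) c = comb k x a c"
      proof (cases "c < n")
        case True
        have "(\<Sum>i<k. g a i * y i c) = ip k (g a) (g (row x c))"
          by (simp only: g(2)[OF True] ip_row)
        also have "\<dots> = ip k a (row x c)"
          by (rule orth_ip[OF g(1)])
        finally show ?thesis
          by (simp only: coord ip_row)
      next
        case False
        then have "x i c = 0" "y i c = 0" if "i < k" for i
          using x[OF that] y[OF that] by (auto simp: real_space_def)
        then show ?thesis
          by (simp add: coord)
      qed
    qed
    then show ?thesis
      using k m by (intro sums_over_congruent_tuples[OF par hom2 cont T _ _ g(1)]) auto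
  qed
  then obtain q where "\<And>x. x \<in> real_space n \<Longrightarrow>
      \<bar>\<beta> x x - (\<Sum>c<n*n. q c * (x (c div n) * x (c mod n)))\<bar> \<le> 280 * T * m * (N x)\<^sup>2"
    using approx_by_quadratic_form[OF seminorm_axioms n hom2, where M = "280 * T * m"] by blast
  then show "\<exists>q. \<forall>x\<in>real_space n. \<bar>\<beta> x x - (\<Sum>c<n*n. q c * (x (c div n) * x (c mod n)))\<bar> \<le> 280 * T * m * (N x)\<^sup>2"
    by blast
qed

lemma diff_pointwise: "(\<lambda>i. x i - y i) = x - y" for x y :: "nat \<Rightarrow> real"
  by (simp add: fun_eq_iff)

lemma metric_space: "Metric_space (real_space n) (\<lambda>x y. N (\<lambda>i. x i - y i))"
  unfolding diff_pointwise
proof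
  show "N (x - y) = N (y - x)" for x y
    by (rule minus_commute)
  show "N (x - z) \<le> N (x - y) + N (y - z)" for x y z
    using triangle[of "x - y" "y - z"] by simp
  show "N (x - y) = 0 \<longleftrightarrow> x = y" if "x \<in> real_space n" "y \<in> real_space n" for x y
  proof
    assume "N (x - y) = 0"
    show "x = y"
    proof
      fix i show "x i = y i"
        using coord_le[of i "x - y"] \<open>N (x - y) = 0\<close> that by (cases "i < n") (auto simp: real_space_def)
    qed
  qed simp
qed simp

lemma cont_on_ball_iff:
  "f \<in> cont_on_ball n N \<longleftrightarrow>
    (\<forall>x\<in>unit_cball n N. \<forall>\<epsilon>>0. \<exists>\<delta>>0. \<forall>y\<in>unit_cball n N. N (y - x) < \<delta> \<longrightarrow> \<bar>f y - f x\<bar> < \<epsilon>)"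
proof -
  interpret M: Metric_space "real_space n" "\<lambda>x y. N (\<lambda>i. x i - y i)"
    by (rule metric_space)
  let ?B = "unit_cball n N"
  let ?X = "subtopology M.mtopology ?B"
  have sub: "?B \<subseteq> real_space n"
    by (auto simp: unit_cball_def)
  then have top: "topspace ?X = ?B"
    by auto
  have mball: "y \<in> M.mball x r \<longleftrightarrow> N (y - x) < r" if "x \<in> ?B" "y \<in> ?B" for x y r
  proof -
    have "N (\<lambda>i. x i - y i) = N (y - x)"
      unfolding diff_pointwise by (rule minus_commute)
    then show ?thesis
      using that sub by (simp add: subset_iff)
  qed
  show ?thesis
  proof
    assume "f \<in> cont_on_ball n N"
    then have f: "continuous_map ?X euclideanreal f"
      by (simp add: cont_on_ball_def)
    show "\<forall>x\<in>?B. \<forall>\<epsilon>>0. \<exists>\<delta>>0. \<forall>y\<in>?B. N (y - x) < \<delta> \<longrightarrow> \<bar>f y - f x\<bar> < \<epsilon>"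
    proof (intro ballI allI impI)
      fix x and \<epsilon> :: real assume x: "x \<in> ?B" and \<epsilon>: "0 < \<epsilon>"
      have "openin ?X {z \<in> topspace ?X. f z \<in> ball (f x) \<epsilon>}"
        using f by (rule openin_continuous_map_preimage) simp
      then obtain T where T: "openin M.mtopology T" "{z \<in> ?B. f z \<in> ball (f x) \<epsilon>} = T \<inter> ?B"
        unfolding openin_subtopology top by blast
      have "x \<in> {z \<in> ?B. f z \<in> ball (f x) \<epsilon>}"
        using x \<epsilon> by simp
      then have "x \<in> T"
        using T(2) by blast
      then obtain r where r: "r > 0" "M.mball x r \<subseteq> T"
        using T(1) unfolding M.openin_mtopology by blast
      have "\<bar>f y - f x\<bar> < \<epsilon>" if y: "y \<in> ?B" "N (y - x) < r" for y
      proof -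
        have "y \<in> T \<inter> ?B"
          using mball[OF x y(1)] y r(2) by blast
        then have "f y \<in> ball (f x) \<epsilon>"
          using T(2) by blast
        then show ?thesis
          by (simp add: dist_real_def abs_minus_commute)
      qed
      then show "\<exists>\<delta>>0. \<forall>y\<in>?B. N (y - x) < \<delta> \<longrightarrow> \<bar>f y - f x\<bar> < \<epsilon>"
        using r(1) by blast
    qed
  next
    assume cont: "\<forall>x\<in>?B. \<forall>\<epsilon>>0. \<exists>\<delta>>0. \<forall>y\<in>?B. N (y - x) < \<delta> \<longrightarrow> \<bar>f y - f x\<bar> < \<epsilon>"
    have "openin ?X {z \<in> topspace ?X. f z \<in> U}" if U: "open U" for U
      unfolding top
    proof (subst openin_subopen, intro ballI)
      fix x assume x: "x \<in> {z \<in> ?B. f z \<in> U}"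
      then obtain \<epsilon> where \<epsilon>: "\<epsilon> > 0" "ball (f x) \<epsilon> \<subseteq> U"
        using U openE by blast
      then obtain \<delta> where \<delta>: "\<delta> > 0" "\<And>y. y \<in> ?B \<Longrightarrow> N (y - x) < \<delta> \<Longrightarrow> \<bar>f y - f x\<bar> < \<epsilon>"
        using cont x by blast
      have "openin ?X (M.mball x \<delta> \<inter> ?B)"
        by (rule openin_subtopology_Int) simp
      moreover have "x \<in> M.mball x \<delta> \<inter> ?B"
        using mball[of x x \<delta>] x \<delta>(1) by simp
      moreover have "M.mball x \<delta> \<inter> ?B \<subseteq> {z \<in> ?B. f z \<in> U}"
      proof
        fix y assume y: "y \<in> M.mball x \<delta> \<inter> ?B"
        then have "\<bar>f y - f x\<bar> < \<epsilon>"
          using mball[of x y \<delta>] x by (intro \<delta>(2)) auto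
        then have "f y \<in> ball (f x) \<epsilon>"
          by (simp add: dist_real_def abs_minus_commute)
        then show "y \<in> {z \<in> ?B. f z \<in> U}"
          using y \<epsilon>(2) by blast
      qed
      ultimately show "\<exists>T. openin ?X T \<and> x \<in> T \<and> T \<subseteq> {z \<in> ?B. f z \<in> U}"
        by blast
    qed
    then show "f \<in> cont_on_ball n N"
      by (simp add: cont_on_ball_def continuous_map_def)
  qed
qed

lemma tendsto_coordinatewise: "((\<lambda>y. N (y - x)) \<longlongrightarrow> 0) (at x within S)"
proof (rule tendsto_sandwich[of "\<lambda>_. 0" _ _ "\<lambda>y. \<Sum>i<n. \<bar>y i - x i\<bar>"])
  have "continuous_on UNIV (\<lambda>y. \<Sum>i<n. \<bar>y i - x i\<bar>)"
    by (intro continuous_intros continuous_on_product_coordinates)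
  then have "isCont (\<lambda>y. \<Sum>i<n. \<bar>y i - x i\<bar>) x"
    by (simp add: continuous_on_eq_continuous_at)
  then have "((\<lambda>y. \<Sum>i<n. \<bar>y i - x i\<bar>) \<longlongrightarrow> 0) (at x)"
    by (simp add: isCont_def)
  then show "((\<lambda>y. \<Sum>i<n. \<bar>y i - x i\<bar>) \<longlongrightarrow> 0) (at x within S)"
    by (rule tendsto_within_subset) simp
  show "\<forall>\<^sub>F y in at x within S. N (y - x) \<le> (\<Sum>i<n. \<bar>y i - x i\<bar>)"
    using le_sum_coords[of "_ - x"] by simp
qed auto

lemma bounded_on_ball:
  assumes "f \<in> cont_on_ball n N"
  shows "\<exists>K. \<forall>x\<in>unit_cball n N. \<bar>f x\<bar> \<le> K"
proof -
  let ?B = "unit_cball n N"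
  let ?C = "{a :: nat \<Rightarrow> real. \<forall>i. a i \<in> (if i < n then {- 1..1} else {0})}"
  have "isCont N x" for x
  proof -
    have "((\<lambda>y. N y - N x) \<longlongrightarrow> 0) (at x)"
      by (rule Lim_null_comparison[OF _ tendsto_coordinatewise[of x UNIV]]) (simp add: abs_diff_le)
    then show ?thesis
      unfolding isCont_def by (simp add: LIM_zero_iff)
  qed
  then have "closed {x. N x \<le> 1}"
    by (intro closed_Collect_le continuous_intros) (simp add: continuous_on_eq_continuous_at)
  then have "compact (?C \<inter> {x. N x \<le> 1})"
    by (intro compact_Int_closed compact_box)
  also have "?C \<inter> {x. N x \<le> 1} = ?B"
  proof (intro set_eqI iffI)
    fix x assume x: "x \<in> ?C \<inter> {x. N x \<le> 1}"
    have "x i = 0" if "n \<le> i" for i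
      using x that by (auto dest: spec[of _ i])
    then show "x \<in> ?B"
      using x by (simp add: unit_cball_def real_space_def)
  next
    fix x assume x: "x \<in> ?B"
    have "x i \<in> (if i < n then {- 1..1} else {0})" for i
      using x coord_le[of i x] by (auto simp: unit_cball_def real_space_def abs_le_iff)
    then show "x \<in> ?C \<inter> {x. N x \<le> 1}"
      using x by (simp add: unit_cball_def)
  qed
  finally have "compact ?B" .
  moreover have "continuous_on ?B f"
    unfolding continuous_on_def tendsto_iff dist_real_def
  proof (intro ballI allI impI)
    fix x and \<epsilon> :: real assume x: "x \<in> ?B" and "0 < \<epsilon>"
    then obtain \<delta> where \<delta>: "\<delta> > 0" "\<And>y. y \<in> ?B \<Longrightarrow> N (y - x) < \<delta> \<Longrightarrow> \<bar>f y - f x\<bar> < \<epsilon>"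
      using assms unfolding cont_on_ball_iff by blast
    have "\<forall>\<^sub>F y in at x within ?B. N (y - x) < \<delta>"
      using tendsto_coordinatewise \<delta>(1) by (rule order_tendstoD)
    moreover have "\<forall>\<^sub>F y in at x within ?B. y \<in> ?B"
      by (simp add: eventually_at_filter)
    ultimately show "\<forall>\<^sub>F y in at x within ?B. \<bar>f y - f x\<bar> < \<epsilon>"
      by eventually_elim (rule \<delta>(2))
  qed
  ultimately have "bounded (f ` ?B)"
    by (intro compact_imp_bounded compact_continuous_image)
  then show ?thesis
    unfolding bounded_iff by (auto simp: real_norm_def)
qed

text \<open>
  The decomposition is applied to \<open>f (x/4)\<close>, so that it approximates \<open>f\<close> on the ball of radius
  \<open>1/4\<close>.  The error \<open>E\<close> has the same third differences as \<open>f\<close>, and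
  \<open>E (3h) = 3 E (2h) - 3 E h + E 0 \<plusminus> 1\<close> carries a bound from one ball to the ball of radius \<open>3/2\<close>
  times as large; four steps suffice because \<open>(3/2)\<^sup>4 > 4\<close>.
\<close>

lemma whitney3_upper:
  assumes A: "approx_by_quadratic A" "0 \<le> A" and m: "n + 1 \<le> 2 ^ m"
  shows "whitney3 n N \<le> ereal (2401 * (105 + 70 * real m + A / 2) + 400)"
  unfolding whitney3_def
proof (rule SUP_least)
  fix f assume "f \<in> {f \<in> cont_on_ball n N. omega3 n N f \<le> 1}"
  then have f: "f \<in> cont_on_ball n N" and omega: "omega3 n N f \<le> 1"
    by auto
  let ?B = "unit_cball n N"
  have f3: "\<bar>third_diff f h x\<bar> \<le> 1"
    if "x \<in> real_space n" "h \<in> real_space n" "N x \<le> 1" "N (x + h) \<le> 1" "N (x + 2 *\<^sub>R h) \<le> 1" "N (x + 3 *\<^sub>R h) \<le> 1" for x h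
  proof -
    have "shift x j h \<in> ?B" if "j \<le> 3" for j
    proof -
      have "j = 0 \<or> j = 1 \<or> j = 2 \<or> j = 3"
        using that by linarith
      then show ?thesis
        using \<open>x \<in> real_space n\<close> \<open>h \<in> real_space n\<close> \<open>N x \<le> 1\<close> \<open>N (x + h) \<le> 1\<close> \<open>N (x + 2 *\<^sub>R h) \<le> 1\<close> \<open>N (x + 3 *\<^sub>R h) \<le> 1\<close>
        unfolding shift_eq unit_cball_def by (auto simp: real_space_def)
    qed
    then have "ereal \<bar>diff3 f h x\<bar> \<le> omega3 n N f"
      unfolding omega3_def using that(1,2) by (intro SUP_upper2[of "(x, h)"]) auto
    then show ?thesis
      using omega by (simp add: diff3_eq order_trans[of _ "omega3 n N f"] one_ereal_def flip: ereal_less_eq(3))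
  qed
  obtain K where K: "\<And>x. x \<in> ?B \<Longrightarrow> \<bar>f x\<bar> \<le> K"
    using bounded_on_ball[OF f] by blast
  \<comment> \<open>the projection to \<open>\<real>\<^sup>n\<close> extends \<open>f\<close> to all sequences, on which the seminorm \<open>N\<close> lives\<close>
  define \<pi> where "\<pi> x = (\<lambda>i. if i < n then x i else 0)" for x :: "nat \<Rightarrow> real"
  have \<pi>_add: "\<pi> (x + y) = \<pi> x + \<pi> y" and \<pi>_scale: "\<pi> (r *\<^sub>R x) = r *\<^sub>R \<pi> x" and \<pi>_diff: "\<pi> (x - y) = \<pi> x - \<pi> y"
    and \<pi>_space: "\<pi> x \<in> real_space n" for x y r
    by (auto simp: \<pi>_def fun_eq_iff real_space_def)
  have N_\<pi>: "N (\<pi> x) = N x" for x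
    using le_sum_coords[of "\<pi> x - x"] abs_diff_le[of "\<pi> x" x] by (simp add: \<pi>_def)
  define f' where "f' x = f ((1/4) *\<^sub>R \<pi> x)" for x
  have in_B: "(1/4) *\<^sub>R \<pi> x \<in> ?B" if "N x \<le> 4" for x
    using that by (simp add: unit_cball_def real_space_scaleR \<pi>_space scale N_\<pi>)
  have f'3: "\<bar>third_diff f' h x\<bar> \<le> 1"
    if "N x \<le> 4" "N (x + h) \<le> 4" "N (x + 2 *\<^sub>R h) \<le> 4" "N (x + 3 *\<^sub>R h) \<le> 4" for x h
  proof -
    let ?x = "(1/4) *\<^sub>R \<pi> x" and ?h = "(1/4) *\<^sub>R \<pi> h"
    have pts: "(1/4) *\<^sub>R \<pi> (x + h) = ?x + ?h" "(1/4) *\<^sub>R \<pi> (x + 2 *\<^sub>R h) = ?x + 2 *\<^sub>R ?h"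
      "(1/4) *\<^sub>R \<pi> (x + 3 *\<^sub>R h) = ?x + 3 *\<^sub>R ?h"
      by (simp_all add: \<pi>_add \<pi>_scale scaleR_add_right)
    have "third_diff f' h x = third_diff f ?h ?x"
      unfolding third_diff_def f'_def pts by simp
    moreover have "\<bar>third_diff f ?h ?x\<bar> \<le> 1"
      using in_B[OF that(1)] in_B[OF that(2)] in_B[OF that(3)] in_B[OF that(4)]
      unfolding pts by (intro f3) (auto simp: unit_cball_def real_space_scaleR \<pi>_space)
    ultimately show ?thesis
      by simp
  qed
  have f'_bound: "\<bar>f' x\<bar> \<le> K" if "N x \<le> 4" for x
    unfolding f'_def by (rule K[OF in_B[OF that]])
  have f'_cont: "\<exists>\<delta>>0. \<forall>y. N y \<le> 4 \<longrightarrow> N (y - x) < \<delta> \<longrightarrow> \<bar>f' y - f' x\<bar> < \<epsilon>"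
    if x4: "N x \<le> 4" and \<epsilon>: "0 < \<epsilon>" for x \<epsilon>
  proof -
    obtain \<delta> where \<delta>: "\<delta> > 0" "\<And>y. y \<in> ?B \<Longrightarrow> N (y - (1/4) *\<^sub>R \<pi> x) < \<delta> \<Longrightarrow> \<bar>f y - f ((1/4) *\<^sub>R \<pi> x)\<bar> < \<epsilon>"
      using f in_B[OF x4] \<epsilon> unfolding cont_on_ball_iff by blast
    have "\<bar>f' y - f' x\<bar> < \<epsilon>" if "N y \<le> 4" "N (y - x) < \<delta>" for y
    proof -
      have "N ((1/4) *\<^sub>R \<pi> y - (1/4) *\<^sub>R \<pi> x) = N (y - x) / 4"
        using scale[of "1/4" "\<pi> (y - x)"] N_\<pi>[of "y - x"] by (simp add: \<pi>_diff scaleR_diff_right)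
      then have "N ((1/4) *\<^sub>R \<pi> y - (1/4) *\<^sub>R \<pi> x) < \<delta>"
        using that(2) nonneg[of "y - x"] by linarith
      then show ?thesis
        unfolding f'_def using in_B[OF that(1)] by (intro \<delta>(2))
    qed
    then show ?thesis
      using \<delta>(1) by blast
  qed
  obtain F \<beta> where F: "\<And>r x. F (r *\<^sub>R x) = r * F x" "\<And>x y. \<bar>F (x + y) - F x - F y\<bar> \<le> 70 * (N x + N y)"
    and \<beta>_props: "\<And>x y. \<beta> x y = \<beta> y x" "\<And>r x y. \<beta> (r *\<^sub>R x) y = r * \<beta> x y"
      "\<And>x x' y. \<bar>\<beta> (x + x') y - \<beta> x y - \<beta> x' y\<bar> \<le> 70 * (N x + N x') * N y"
      "seminorm_continuous (\<lambda>x. \<beta> x x)"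
    and approx: "\<And>x. N x \<le> 1 \<Longrightarrow> \<bar>f' x - f' 0 - F x - \<beta> x x / 2\<bar> \<le> 105"
  proof (rule homogeneous_decomposition[of f' K], goal_cases)
    case (1 x h)
    show ?case
      by (rule f'3[OF 1(2-5)])
  next
    case (2 x)
    show ?case
      by (rule f'_bound[OF 2(2)])
  next
    case (3 x \<epsilon>)
    show ?case
      by (rule f'_cont[OF 3(2,3)])
  next
    case (4 F \<beta>)
    show ?case
      by (rule 4(1)[OF 4(2-8)])
  qed
  have \<beta>: "approx_bilinear \<beta>"
    unfolding approx_bilinear_def by (intro conjI allI \<beta>_props)
  obtain t where t: "\<And>x. x \<in> real_space n \<Longrightarrow> \<bar>F x - (\<Sum>i<n. t i * x i)\<bar> \<le> 70 * m * N x"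
    using approx_by_linear_form[OF seminorm_axioms F _ m] by auto
  obtain q where q: "\<And>x. x \<in> real_space n \<Longrightarrow>
      \<bar>\<beta> x x - (\<Sum>c<n*n. q c * (x (c div n) * x (c mod n)))\<bar> \<le> A * (N x)\<^sup>2"
    using A(1) \<beta> unfolding approx_by_quadratic_def by blast
  define \<phi> where "\<phi> = quadratic n (f 0) (\<lambda>i. 4 * t i) (\<lambda>c. 8 * q c)"
  define E where "E x = f x - \<phi> x" for x
  define K0 where "K0 = 105 + 70 * real m + A / 2"
  have small: "\<bar>E x\<bar> \<le> K0" if x: "x \<in> real_space n" "N x \<le> 1/4" for x
  proof -
    define z where "z = 4 *\<^sub>R x"
    have z: "z \<in> real_space n" "N z \<le> 1"
      using x by (simp_all add: z_def real_space_scaleR scale)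
    have "\<pi> z = z"
      using z(1) by (auto simp: \<pi>_def real_space_def fun_eq_iff)
    then have "f' z = f x" "f' 0 = f 0"
      using \<pi>_scale[of 0 0] by (simp_all add: f'_def z_def)
    then have "\<bar>f x - f 0 - F z - \<beta> z z / 2\<bar> \<le> 105"
      using approx[OF z(2)] by simp
    moreover have "\<bar>F z - (\<Sum>i<n. t i * z i)\<bar> \<le> 70 * m"
      using t[OF z(1)] mult_left_mono[OF z(2), of "70 * m"] by simp
    moreover have "\<bar>\<beta> z z - (\<Sum>c<n*n. q c * (z (c div n) * z (c mod n)))\<bar> \<le> A"
    proof -
      have "(N z)\<^sup>2 \<le> 1"
        using z(2) by (simp add: power_le_one)
      then show ?thesis
        using q[OF z(1)] mult_left_mono[of "(N z)\<^sup>2" 1 A] A(2) by simp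
    qed
    moreover have "\<phi> x = f 0 + (\<Sum>i<n. t i * z i) + (\<Sum>c<n*n. q c * (z (c div n) * z (c mod n))) / 2"
      by (simp add: \<phi>_def quadratic_def z_def sum_divide_distrib sum_distrib_left mult_ac)
    ultimately show ?thesis
      unfolding E_def K0_def abs_le_iff by simp
  qed
  have grow: "\<forall>x\<in>?B. N x \<le> 3/2 * r \<longrightarrow> \<bar>E x\<bar> \<le> 7 * K + 1"
    if r: "0 \<le> r" and small: "\<forall>x\<in>?B. N x \<le> r \<longrightarrow> \<bar>E x\<bar> \<le> K" for r K
  proof (intro ballI impI)
    fix x assume x: "x \<in> ?B" "N x \<le> 3/2 * r"
    let ?h = "(1/3) *\<^sub>R x"
    have h: "0 + 3 *\<^sub>R ?h = x" "0 + 2 *\<^sub>R ?h = (2/3) *\<^sub>R x" "0 + ?h = ?h"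
      by simp_all
    have space: "x \<in> real_space n" "N x \<le> 1" "0 \<in> real_space n"
      using x(1) by (auto simp: unit_cball_def real_space_def)
    have "\<bar>third_diff f ?h 0\<bar> \<le> 1"
      using space by (intro f3; (unfold h)?) (auto simp: real_space_scaleR scale)
    moreover have "third_diff E ?h 0 = third_diff f ?h 0"
      using third_diff_quadratic[of n "f 0" "\<lambda>i. 4 * t i" "\<lambda>c. 8 * q c" ?h 0]
      by (simp add: third_diff_def E_def \<phi>_def)
    ultimately have "\<bar>E x - 3 * E ((2/3) *\<^sub>R x) + 3 * E ?h - E 0\<bar> \<le> 1"
      unfolding third_diff_def h by simp
    moreover have "\<bar>E ((2/3) *\<^sub>R x)\<bar> \<le> K" "\<bar>E ?h\<bar> \<le> K" "\<bar>E 0\<bar> \<le> K"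
    proof -
      have E_le: "\<bar>E y\<bar> \<le> K" if "y \<in> real_space n" "N y \<le> r" "N y \<le> 1" for y
        using small that by (simp add: unit_cball_def)
      have norms: "N ((2/3) *\<^sub>R x) = 2/3 * N x" "N ?h = 1/3 * N x"
        by (simp_all add: scale)
      have "2/3 * N x \<le> r" "1/3 * N x \<le> r" "2/3 * N x \<le> 1" "1/3 * N x \<le> 1"
        using x(2) space(2) r nonneg[of x] by linarith+
      note le = this[folded norms]
      show "\<bar>E ((2/3) *\<^sub>R x)\<bar> \<le> K"
        by (rule E_le[OF real_space_scaleR[OF space(1)] le(1,3)])
      show "\<bar>E ?h\<bar> \<le> K"
        by (rule E_le[OF real_space_scaleR[OF space(1)] le(2,4)])
      show "\<bar>E 0\<bar> \<le> K"
        using r space(3) by (intro E_le) simp_all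
    qed
    ultimately show "\<bar>E x\<bar> \<le> 7 * K + 1"
      unfolding abs_le_iff by linarith
  qed
  have "\<forall>x\<in>?B. N x \<le> 1/4 \<longrightarrow> \<bar>E x\<bar> \<le> K0"
    using small by (simp add: unit_cball_def)
  from grow[OF _ this] have "\<forall>x\<in>?B. N x \<le> 3/8 \<longrightarrow> \<bar>E x\<bar> \<le> 7 * K0 + 1"
    by simp
  from grow[OF _ this] have "\<forall>x\<in>?B. N x \<le> 9/16 \<longrightarrow> \<bar>E x\<bar> \<le> 49 * K0 + 8"
    by (simp add: add.commute)
  from grow[OF _ this] have "\<forall>x\<in>?B. N x \<le> 27/32 \<longrightarrow> \<bar>E x\<bar> \<le> 343 * K0 + 57"
    by (simp add: add.commute)
  from grow[OF _ this] have final: "\<forall>x\<in>?B. N x \<le> 81/64 \<longrightarrow> \<bar>E x\<bar> \<le> 2401 * K0 + 400"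
    by (simp add: add.commute)
  have "E3 n N f \<le> (SUP x\<in>?B. ereal \<bar>f x - \<phi> x\<bar>)"
    unfolding E3_def \<phi>_def by (rule INF_lower[OF quadratic_in_polys])
  also have "\<dots> \<le> ereal (2401 * K0 + 400)"
  proof (rule SUP_least)
    fix x assume "x \<in> ?B"
    then show "ereal \<bar>f x - \<phi> x\<bar> \<le> ereal (2401 * K0 + 400)"
      using final by (simp add: E_def unit_cball_def)
  qed
  finally show "E3 n N f \<le> ereal (2401 * (105 + 70 * real m + A / 2) + 400)"
    by (simp add: K0_def)
qed

end

text \<open>In \<open>\<ell>\<^sub>1\<^sup>n\<close> every vector is a sum of multiples of the unit vectors whose norms add up to its own, so
  the matrix of \<open>\<beta>\<close> itself is the quadratic form.\<close>

lemma approx_by_quadratic_l1: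
  assumes m: "n \<le> 2 ^ m"
  shows "coord_norm.approx_by_quadratic (lp_norm n 1) n (140 * m)"
proof -
  interpret coord_norm "lp_norm n 1" n
    by (rule coord_norm_lp) simp
  have N1: "lp_norm n 1 x = (\<Sum>i<n. \<bar>x i\<bar>)" for x
    by (simp add: lp_norm_def sum_nonneg)
  have Ne: "lp_norm n 1 (unit_vec i) = 1" if "i < n" for i
  proof -
    have "(\<Sum>j<n. \<bar>unit_vec i j\<bar>) = (\<Sum>j<n. if j = i then 1 else 0)"
      by (intro sum.cong) (auto simp: unit_vec_def)
    then show ?thesis
      using that by (simp add: N1)
  qed
  show ?thesis
    unfolding approx_by_quadratic_def
  proof (intro allI impI)
    fix \<beta> assume "approx_bilinear \<beta>"
    then have sym: "\<beta> x y = \<beta> y x" and hom: "\<beta> (r *\<^sub>R x) y = r * \<beta> x y"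
      and add: "\<bar>\<beta> (x + x') y - \<beta> x y - \<beta> x' y\<bar> \<le> 70 * (lp_norm n 1 x + lp_norm n 1 x') * lp_norm n 1 y" for x x' y r
      unfolding approx_bilinear_def by blast+
    have expand: "\<bar>\<beta> x y - (\<Sum>i<n. x i * \<beta> (unit_vec i) y)\<bar> \<le> 70 * m * lp_norm n 1 x * lp_norm n 1 y"
      if "x \<in> real_space n" for x y
    proof -
      have "\<bar>\<beta> (\<Sum>i<n. x i *\<^sub>R unit_vec i) y - (\<Sum>i<n. \<beta> (x i *\<^sub>R unit_vec i) y)\<bar>
          \<le> 70 * lp_norm n 1 y * m * (\<Sum>i<n. lp_norm n 1 (x i *\<^sub>R unit_vec i))"
        using add m by (intro approx_additive_sum[where F = "\<lambda>x. \<beta> x y"]) (auto simp: mult_ac)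
      moreover have "(\<Sum>i<n. lp_norm n 1 (x i *\<^sub>R unit_vec i)) = lp_norm n 1 x"
        unfolding N1[of x] by (intro sum.cong) (auto simp: scale Ne)
      ultimately show ?thesis
        using unit_vec_expansion[OF that] by (simp add: hom mult_ac)
    qed
    have "\<bar>\<beta> x x - (\<Sum>c<n*n. \<beta> (unit_vec (c mod n)) (unit_vec (c div n)) * (x (c div n) * x (c mod n)))\<bar>
        \<le> 140 * m * (lp_norm n 1 x)\<^sup>2" if x: "x \<in> real_space n" for x
    proof -
      let ?N = "lp_norm n 1 x"
      have inner: "\<bar>x i * \<beta> (unit_vec i) x - (\<Sum>j<n. \<beta> (unit_vec j) (unit_vec i) * (x i * x j))\<bar> \<le> 70 * m * ?N * \<bar>x i\<bar>"
        if i: "i < n" for i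
      proof -
        have "\<bar>\<beta> (unit_vec i) x - (\<Sum>j<n. x j * \<beta> (unit_vec j) (unit_vec i))\<bar> \<le> 70 * m * ?N"
          using expand[OF x, of "unit_vec i"] sym[of x "unit_vec i"] Ne[OF i] by simp
        then have "\<bar>x i\<bar> * \<bar>\<beta> (unit_vec i) x - (\<Sum>j<n. x j * \<beta> (unit_vec j) (unit_vec i))\<bar> \<le> \<bar>x i\<bar> * (70 * m * ?N)"
          by (intro mult_left_mono) auto
        moreover have "x i * \<beta> (unit_vec i) x - (\<Sum>j<n. \<beta> (unit_vec j) (unit_vec i) * (x i * x j))
            = x i * (\<beta> (unit_vec i) x - (\<Sum>j<n. x j * \<beta> (unit_vec j) (unit_vec i)))"
          by (simp add: right_diff_distrib sum_distrib_left mult_ac)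
        ultimately show ?thesis
          by (simp only: abs_mult mult_ac)
      qed
      have "\<bar>(\<Sum>i<n. x i * \<beta> (unit_vec i) x) - (\<Sum>i<n. \<Sum>j<n. \<beta> (unit_vec j) (unit_vec i) * (x i * x j))\<bar>
          \<le> (\<Sum>i<n. 70 * m * ?N * \<bar>x i\<bar>)"
        unfolding sum_subtractf[symmetric] by (intro order_trans[OF sum_abs] sum_mono inner) simp
      also have "\<dots> = 70 * m * ?N * ?N"
        by (simp add: N1 flip: sum_distrib_left)
      finally have "\<bar>(\<Sum>i<n. x i * \<beta> (unit_vec i) x) - (\<Sum>c<n*n. \<beta> (unit_vec (c mod n)) (unit_vec (c div n)) * (x (c div n) * x (c mod n)))\<bar>
          \<le> 70 * m * ?N * ?N"
        by (simp only: sum_div_mod[where f = "\<lambda>i j. \<beta> (unit_vec j) (unit_vec i) * (x i * x j)"])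
      then show ?thesis
        using expand[OF x, of x] unfolding power2_eq_square by linarith
    qed
    then show "\<exists>q. \<forall>x\<in>real_space n. \<bar>\<beta> x x - (\<Sum>c<n*n. q c * (x (c div n) * x (c mod n)))\<bar> \<le> 140 * m * (lp_norm n 1 x)\<^sup>2"
      by (intro exI[of _ "\<lambda>c. \<beta> (unit_vec (c mod n)) (unit_vec (c div n))"] ballI)
  qed
qed

section \<open>Lower bounds: general facts\<close>

lemma quadratic_add:
  "quadratic n a t q x + quadratic n a' t' q' x = quadratic n (a + a') (\<lambda>i. t i + t' i) (\<lambda>c. q c + q' c) x"
  by (simp add: quadratic_def sum.distrib distrib_right)

lemma quadratic_cmult: "r * quadratic n a t q x = quadratic n (r * a) (\<lambda>i. r * t i) (\<lambda>c. r * q c) x"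
  by (simp add: quadratic_def distrib_left sum_distrib_left mult.assoc)

text \<open>Splitting off one factor, constants are reached from a monomial of degree 2 in two steps.\<close>

lemma monomial_step:
  fixes \<alpha> :: "nat \<Rightarrow> nat"
  assumes "(\<Sum>i<n. \<alpha> i) = Suc d"
  obtains i \<alpha>' where "i < n" "(\<Sum>i<n. \<alpha>' i) = d"
    "\<And>x :: nat \<Rightarrow> real. (\<Prod>i<n. x i ^ \<alpha> i) = x i * (\<Prod>i<n. x i ^ \<alpha>' i)"
proof -
  have "\<exists>i<n. \<alpha> i \<noteq> 0"
  proof (rule ccontr)
    assume "\<not> (\<exists>i<n. \<alpha> i \<noteq> 0)"
    then have "(\<Sum>i<n. \<alpha> i) = 0"
      by simp
    then show False
      using assms by simp
  qed
  then obtain i where i: "i < n" "\<alpha> i \<noteq> 0"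
    by blast
  define \<alpha>' where "\<alpha>' j = (if j = i then \<alpha> i - 1 else \<alpha> j)" for j
  have \<alpha>: "\<alpha> j = \<alpha>' j + (if j = i then 1 else 0)" for j
    using i by (simp add: \<alpha>'_def)
  have "(\<Sum>j<n. \<alpha> j) = (\<Sum>j<n. \<alpha>' j) + 1"
    unfolding \<alpha> sum.distrib using i by simp
  then have "(\<Sum>j<n. \<alpha>' j) = d"
    using assms by simp
  moreover have "(\<Prod>j<n. x j ^ \<alpha> j) = x i * (\<Prod>j<n. x j ^ \<alpha>' j)" for x :: "nat \<Rightarrow> real"
  proof -
    have "(\<Prod>j<n. x j ^ (if j = i then 1 else 0)) = (\<Prod>j<n. if j = i then x i else 1)"
      by (intro prod.cong) auto
    then show ?thesis
      unfolding \<alpha> power_add prod.distrib using i by simp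
  qed
  ultimately show ?thesis
    using that i(1) by blast
qed

lemma polys_upto_2_quadratic:
  assumes "\<phi> \<in> polys_upto n 2"
  shows "\<exists>a t q. \<phi> = quadratic n a t q"
proof -
  define R where "R \<psi> \<longleftrightarrow> (\<exists>a t q. \<forall>x. \<psi> x = quadratic n a t q x)" for \<psi> :: "(nat \<Rightarrow> real) \<Rightarrow> real"
  have R_add: "R (\<lambda>x. \<psi> x + \<psi>' x)" if A: "R \<psi>" and B: "R \<psi>'" for \<psi> \<psi>'
  proof -
    obtain a t q a' t' q' where "\<And>x. \<psi> x = quadratic n a t q x" "\<And>x. \<psi>' x = quadratic n a' t' q' x"
      using A B unfolding R_def by blast
    then have "\<psi> x + \<psi>' x = quadratic n (a + a') (\<lambda>i. t i + t' i) (\<lambda>c. q c + q' c) x" for x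
      by (simp only: quadratic_add)
    then show ?thesis
      unfolding R_def by (intro exI allI)
  qed
  have R_cmult: "R (\<lambda>x. r * \<psi> x)" if A: "R \<psi>" for \<psi> r
  proof -
    obtain a t q where "\<And>x. \<psi> x = quadratic n a t q x"
      using A unfolding R_def by blast
    then have "r * \<psi> x = quadratic n (r * a) (\<lambda>i. r * t i) (\<lambda>c. r * q c) x" for x
      by (simp only: quadratic_cmult)
    then show ?thesis
      unfolding R_def by (intro exI allI)
  qed
  have R_const: "R (\<lambda>x. a)" for a
    unfolding R_def
    by (intro exI[of _ a] exI[of _ "\<lambda>_. 0"]) (simp add: quadratic_def)
  have R_lin: "R (\<lambda>x. x i)" if i: "i < n" for i
  proof -
    have "(\<Sum>j<n. (if j = i then 1 else 0) * x j) = (\<Sum>j<n. if j = i then x i else 0)" for x :: "nat \<Rightarrow> real"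
      by (intro sum.cong) auto
    then have "x i = quadratic n 0 (\<lambda>j. if j = i then 1 else 0) (\<lambda>_. 0) x" for x
      using i by (simp add: quadratic_def)
    then show ?thesis
      unfolding R_def by (intro exI allI)
  qed
  have R_quad: "R (\<lambda>x. x i * x j)" if i: "i < n" and j: "j < n" for i j
  proof -
    have "i * n + j < (i + 1) * n"
      using j by simp
    also have "\<dots> \<le> n * n"
      using i by (intro mult_right_mono) auto
    finally have lt: "i * n + j < n * n" .
    have "(\<Sum>c<n*n. (if c = i * n + j then 1 else 0) * (x (c div n) * x (c mod n)))
        = (\<Sum>c<n*n. if c = i * n + j then x i * x j else 0)" for x :: "nat \<Rightarrow> real"
      using j by (intro sum.cong) auto
    then have "x i * x j = quadratic n 0 (\<lambda>_. 0) (\<lambda>c. if c = i * n + j then 1 else 0) x" for x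
      using lt by (simp add: quadratic_def)
    then show ?thesis
      unfolding R_def by (intro exI allI)
  qed
  have R_mono: "R (\<lambda>x. \<Prod>i<n. x i ^ \<alpha> i)" if \<alpha>: "\<alpha> \<in> multi_indices n 2" for \<alpha>
  proof -
    have const: "(\<Prod>i<n. x i ^ \<alpha> i) = 1" if "(\<Sum>i<n. \<alpha> i) = 0" for \<alpha> :: "nat \<Rightarrow> nat" and x :: "nat \<Rightarrow> real"
      using that by simp
    have "(\<Sum>i<n. \<alpha> i) = 0 \<or> (\<Sum>i<n. \<alpha> i) = Suc 0 \<or> (\<Sum>i<n. \<alpha> i) = Suc (Suc 0)"
    proof -
      have "(\<Sum>i<n. \<alpha> i) \<le> 2"
        using \<alpha> unfolding multi_indices_def by blast
      then show ?thesis
        by linarith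
    qed
    then show ?thesis
    proof (elim disjE)
      assume 1: "(\<Sum>i<n. \<alpha> i) = 0"
      show ?thesis
        using R_const[of 1] const[OF 1] by (simp only:)
    next
      assume 2: "(\<Sum>i<n. \<alpha> i) = Suc 0"
      obtain i \<alpha>' where i: "i < n" "(\<Sum>i<n. \<alpha>' i) = 0" "\<And>x :: nat \<Rightarrow> real. (\<Prod>i<n. x i ^ \<alpha> i) = x i * (\<Prod>i<n. x i ^ \<alpha>' i)"
        by (rule monomial_step[OF 2]) blast
      show ?thesis
        using R_lin[OF i(1)] by (simp only: i(3) const[OF i(2)] mult_1_right)
    next
      assume 3: "(\<Sum>i<n. \<alpha> i) = Suc (Suc 0)"
      obtain i \<alpha>' where i: "i < n" "(\<Sum>i<n. \<alpha>' i) = Suc 0" "\<And>x :: nat \<Rightarrow> real. (\<Prod>i<n. x i ^ \<alpha> i) = x i * (\<Prod>i<n. x i ^ \<alpha>' i)"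
        by (rule monomial_step[OF 3]) blast
      obtain j \<alpha>'' where j: "j < n" "(\<Sum>i<n. \<alpha>'' i) = 0" "\<And>x :: nat \<Rightarrow> real. (\<Prod>i<n. x i ^ \<alpha>' i) = x j * (\<Prod>i<n. x i ^ \<alpha>'' i)"
        by (rule monomial_step[OF i(2)]) blast
      show ?thesis
        using R_quad[OF i(1) j(1)] by (simp only: i(3) j(3) const[OF j(2)] mult_1_right)
    qed
  qed
  obtain a where \<phi>: "\<phi> = (\<lambda>x. \<Sum>\<alpha>\<in>multi_indices n 2. a \<alpha> * (\<Prod>i<n. x i ^ \<alpha> i))"
    using assms unfolding polys_upto_def by blast
  have "R (\<lambda>x. \<Sum>\<alpha>\<in>S. a \<alpha> * (\<Prod>i<n. x i ^ \<alpha> i))" if "finite S" "S \<subseteq> multi_indices n 2" for S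
    using that
  proof (induction S rule: finite_induct)
    case empty
    show ?case
      using R_const[of 0] by (simp only: sum.empty)
  next
    case (insert \<alpha> S)
    have "R (\<lambda>x. a \<alpha> * (\<Prod>i<n. x i ^ \<alpha> i) + (\<Sum>\<alpha>\<in>S. a \<alpha> * (\<Prod>i<n. x i ^ \<alpha> i)))"
      using insert.prems insert.IH by (intro R_add R_cmult R_mono) auto
    then show ?case
      by (simp only: sum.insert[OF insert.hyps])
  qed
  then have "R \<phi>"
    unfolding \<phi> using finite_multi_indices by blast
  then show ?thesis
    unfolding R_def fun_eq_iff .
qed

context coord_norm
begin

text \<open>If \<open>x\<close> and \<open>x + 3h\<close> are in the unit ball, then \<open>N (3h) \<le> 2\<close>; so steps of norm at most 1 suffice.\<close>

lemma whitney3_lower: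
  assumes cont: "continuous_on UNIV f"
    and f3: "\<And>x h. x \<in> real_space n \<Longrightarrow> h \<in> real_space n \<Longrightarrow> N h \<le> 1 \<Longrightarrow> \<bar>third_diff f h x\<bar> \<le> D"
    and far: "\<And>a t q. \<exists>x\<in>unit_cball n N. d \<le> \<bar>f x - quadratic n a t q x\<bar>"
    and D: "0 < D"
  shows "ereal (d / D) \<le> whitney3 n N"
proof -
  let ?B = "unit_cball n N"
  define g where "g x = f x / D" for x
  have cont_g: "g \<in> cont_on_ball n N"
    unfolding cont_on_ball_iff
  proof (intro ballI allI impI)
    fix x and \<epsilon> :: real assume x: "x \<in> ?B" and "0 < \<epsilon>"
    have "continuous_on UNIV g"
      unfolding g_def using cont D by (intro continuous_intros) auto
    then obtain \<delta> where \<delta>: "\<delta> > 0" "\<And>y. dist y x < \<delta> \<Longrightarrow> dist (g y) (g x) < \<epsilon>"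
      using \<open>0 < \<epsilon>\<close> unfolding continuous_on_iff by (metis UNIV_I)
    have "\<bar>g y - g x\<bar> < \<epsilon>" if y: "y \<in> ?B" "N (y - x) < \<delta> / 4" for y
    proof -
      have "\<bar>y i - x i\<bar> \<le> \<delta> / 4" for i
        using coord_le[of i "y - x"] x y \<delta>(1) by (cases "i < n") (auto simp: unit_cball_def real_space_def)
      then have "dist y x \<le> 2 * (\<delta> / 4)"
        by (rule dist_fun_le)
      then show ?thesis
        using \<delta>(2)[of y] \<delta>(1) by (simp add: dist_real_def)
    qed
    then show "\<exists>\<delta>>0. \<forall>y\<in>?B. N (y - x) < \<delta> \<longrightarrow> \<bar>g y - g x\<bar> < \<epsilon>"
      using \<delta>(1) by (intro exI[of _ "\<delta> / 4"]) auto
  qed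
  have "omega3 n N g \<le> 1"
    unfolding omega3_def
  proof (intro SUP_least, clarify)
    fix x h assume x: "x \<in> real_space n" and h: "h \<in> real_space n" and pts: "\<forall>j\<le>3. shift x j h \<in> ?B"
    have "N (shift x 0 h) \<le> 1" "N (shift x 3 h) \<le> 1"
      using pts by (auto simp: unit_cball_def)
    then have "N (3 *\<^sub>R h) \<le> 2"
      using triangle_diff[of "x + 3 *\<^sub>R h" x] by (simp add: shift_eq)
    then have "\<bar>third_diff f h x\<bar> \<le> D"
      using x h by (intro f3) (simp_all add: scale)
    moreover have "third_diff g h x = third_diff f h x / D"
      by (simp add: third_diff_def g_def add_divide_distrib diff_divide_distrib)
    ultimately show "ereal \<bar>diff3 g h x\<bar> \<le> 1"
      using D by (simp add: diff3_eq abs_div_pos[symmetric] one_ereal_def)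
  qed
  moreover have "ereal (d / D) \<le> E3 n N g"
    unfolding E3_def
  proof (rule INF_greatest)
    fix \<phi> assume "\<phi> \<in> polys_upto n 2"
    then obtain a t q where \<phi>: "\<phi> = quadratic n a t q"
      using polys_upto_2_quadratic by blast
    obtain x where x: "x \<in> ?B" "d \<le> \<bar>f x - D * \<phi> x\<bar>"
      using far[of "D * a" "\<lambda>i. D * t i" "\<lambda>c. D * q c"] unfolding \<phi> quadratic_cmult by blast
    have "\<bar>f x - D * \<phi> x\<bar> = D * \<bar>g x - \<phi> x\<bar>"
    proof -
      have "f x - D * \<phi> x = D * (g x - \<phi> x)"
        using D by (simp add: g_def right_diff_distrib)
      then show ?thesis
        using D by (simp add: abs_mult)
    qed
    then have "d / D \<le> \<bar>g x - \<phi> x\<bar>"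
      using x(2) D by (simp add: divide_le_eq mult.commute)
    then show "ereal (d / D) \<le> (SUP x\<in>?B. ereal \<bar>g x - \<phi> x\<bar>)"
      using x(1) by (intro SUP_upper2[of x]) auto
  qed
  ultimately show ?thesis
    unfolding whitney3_def using cont_g by (intro SUP_upper2[of g]) auto
qed

text \<open>
  The cube of a coordinate has third differences \<open>6 h\<^sub>0\<^sup>3\<close>, and these are not changed by subtracting a
  quadratic polynomial.  With the largest step \<open>h\<^sub>0 = 2/3\<close> on the segment from \<open>-e\<close> to \<open>e\<close> the third
  difference is \<open>16/9\<close>, and its coefficients have absolute values adding up to \<open>8\<close>.
\<close>

lemma whitney3_lower_constant:
  assumes n: "1 \<le> n"
  shows "ereal (1 / 27) \<le> whitney3 n N"
proof -
  define e where "e = unit_vec 0"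
  have e: "e \<in> real_space n" "N e \<le> 1" "e 0 = 1"
  proof -
    have "(\<Sum>i<n. \<bar>e i\<bar>) = (\<Sum>i<n. if i = 0 then 1 else 0)"
      by (intro sum.cong) (auto simp: e_def unit_vec_def)
    then show "N e \<le> 1"
      using le_sum_coords[of e] n by simp
  qed (use n in \<open>auto simp: e_def unit_vec_def real_space_def\<close>)
  define f where "f x = (x 0) ^ 3" for x :: "nat \<Rightarrow> real"
  have f3: "third_diff f h x = 6 * (h 0) ^ 3" for x h
    by (simp add: third_diff_def f_def power3_eq_cube algebra_simps)
  have "ereal ((2/9) / 6) \<le> whitney3 n N"
  proof (rule whitney3_lower)
    show "continuous_on UNIV f"
      unfolding f_def by (intro continuous_intros continuous_on_product_coordinates)
    show "\<bar>third_diff f h x\<bar> \<le> 6" if "N h \<le> 1" for x h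
    proof -
      have "\<bar>h 0\<bar> ^ 3 \<le> 1"
        using coord_le[of 0 h] n that by (intro power_le_one) auto
      then show ?thesis
        by (simp add: f3 abs_mult power_abs)
    qed
    fix a t q
    define E where "E x = f x - quadratic n a t q x" for x
    have "third_diff E h x = 6 * (h 0) ^ 3" for h x
      using third_diff_quadratic[of n a t q h x] f3[of h x] by (simp add: third_diff_def E_def)
    moreover have "- e + 3 *\<^sub>R ((2/3) *\<^sub>R e) = 1 *\<^sub>R e" "- e + 2 *\<^sub>R ((2/3) *\<^sub>R e) = (1/3) *\<^sub>R e"
      "- e + (2/3) *\<^sub>R e = (- (1/3)) *\<^sub>R e" "- e = (-1) *\<^sub>R e"
      by (auto simp: fun_eq_iff)
    ultimately have "E (1 *\<^sub>R e) - 3 * E ((1/3) *\<^sub>R e) + 3 * E ((- (1/3)) *\<^sub>R e) - E ((-1) *\<^sub>R e) = 6 * ((2/3) * e 0) ^ 3"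
      unfolding third_diff_def by (metis real_scaleR_def scaleR_fun_apply)
    then have "2/9 \<le> \<bar>E (1 *\<^sub>R e)\<bar> \<or> 2/9 \<le> \<bar>E ((1/3) *\<^sub>R e)\<bar> \<or> 2/9 \<le> \<bar>E ((- (1/3)) *\<^sub>R e)\<bar> \<or> 2/9 \<le> \<bar>E ((-1) *\<^sub>R e)\<bar>"
      unfolding e(3) power3_eq_cube by (simp add: abs_if) linarith
    moreover have "r *\<^sub>R e \<in> unit_cball n N" if "\<bar>r\<bar> \<le> 1" for r
      using scale_le[OF that, of e] e by (simp add: unit_cball_def real_space_scaleR)
    then have "1 *\<^sub>R e \<in> unit_cball n N" "(1/3) *\<^sub>R e \<in> unit_cball n N" "(- (1/3)) *\<^sub>R e \<in> unit_cball n N" "(-1) *\<^sub>R e \<in> unit_cball n N"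
      by (simp_all only:)
    ultimately show "\<exists>x\<in>unit_cball n N. 2/9 \<le> \<bar>f x - quadratic n a t q x\<bar>"
      unfolding E_def by blast
  qed simp
  then show ?thesis
    by simp
qed

end

section \<open>The functions \<open>t ln \<bar>t\<bar>\<close> and \<open>t\<^sup>2 ln \<bar>t\<bar>\<close>\<close>

definition xlnx :: "real \<Rightarrow> real" where "xlnx t = t * ln \<bar>t\<bar>"
definition x2lnx :: "real \<Rightarrow> real" where "x2lnx t = t * xlnx t"

lemma continuous_xlnx: "continuous_on UNIV xlnx"
proof -
  have "isCont xlnx t" for t
  proof (cases "t = 0")
    case False
    have "isCont (\<lambda>t. t * ln \<bar>t\<bar>) t"
      using False by (intro continuous_intros) auto
    then show ?thesis
      by (simp add: xlnx_def[abs_def])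
  next
    case True
    have bound: "\<bar>xlnx s\<bar> \<le> 2 * sqrt \<bar>s\<bar>" if "\<bar>s\<bar> < 1" "s \<noteq> 0" for s
    proof -
      define r where "r = sqrt \<bar>s\<bar>"
      have r: "0 < r" "r < 1" "\<bar>s\<bar> = r\<^sup>2"
        using that by (simp_all add: r_def)
      have "ln (1 / r) \<le> 1 / r - 1"
        using r by (intro ln_le_minus_one) simp
      then have "- ln r \<le> 1 / r"
        using r by (simp add: ln_div)
      then have "r\<^sup>2 * (2 * - ln r) \<le> r\<^sup>2 * (2 * (1 / r))"
        by (intro mult_left_mono) auto
      also have "\<dots> = 2 * r"
        using r by (simp add: power2_eq_square)
      finally have "r\<^sup>2 * (2 * - ln r) \<le> 2 * r" .
      then have "r\<^sup>2 * \<bar>2 * ln r\<bar> \<le> 2 * r"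
      proof -
        have "\<bar>2 * ln r\<bar> = 2 * - ln r"
          using r ln_less_zero[of r] by simp
        then show ?thesis
          using \<open>r\<^sup>2 * (2 * - ln r) \<le> 2 * r\<close> by (simp only:)
      qed
      moreover have "ln \<bar>s\<bar> = 2 * ln r"
        using r by (simp add: ln_realpow)
      ultimately show ?thesis
        unfolding xlnx_def abs_mult r_def[symmetric] by (simp only: r(3))
    qed
    have "(\<lambda>s. 2 * sqrt \<bar>s\<bar>) \<midarrow>0\<rightarrow> 2 * sqrt \<bar>0\<bar>"
      by (intro tendsto_intros)
    then have "(\<lambda>s. 2 * sqrt \<bar>s\<bar>) \<midarrow>0\<rightarrow> 0"
      by simp
    moreover have "eventually (\<lambda>s. norm (xlnx s) \<le> 2 * sqrt \<bar>s\<bar>) (at 0)"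
      unfolding eventually_at by (intro exI[of _ 1]) (auto simp: dist_real_def intro: bound)
    ultimately have "xlnx \<midarrow>0\<rightarrow> 0"
      by (rule Lim_null_comparison[rotated])
    then show ?thesis
      using True by (simp add: isCont_def xlnx_def)
  qed
  then show ?thesis
    by (simp add: continuous_on_eq_continuous_at)
qed

lemma continuous_x2lnx: "continuous_on UNIV x2lnx"
  unfolding x2lnx_def[abs_def] by (intro continuous_intros continuous_xlnx)

text \<open>On the compact interval between the two ranges covered by \<open>far\<close> and by symmetry, continuity is
  enough.\<close>

lemma bounded_third_diff_unit_step:
  assumes cont: "continuous_on UNIV \<psi>"
    and far: "\<And>s. 1 \<le> s \<Longrightarrow> \<bar>third_diff \<psi> 1 s\<bar> \<le> 2"
    and sym: "(\<forall>s. \<psi> (- s) = \<psi> s) \<or> (\<forall>s. \<psi> (- s) = - \<psi> s)"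
  shows "\<exists>C>0. \<forall>s. \<bar>third_diff \<psi> 1 (s::real)\<bar> \<le> C"
proof -
  have "continuous_on {- 4..1} (third_diff \<psi> 1)"
    unfolding third_diff_def[abs_def]
    by (intro continuous_intros continuous_on_compose2[OF cont]) auto
  then have "bounded (third_diff \<psi> 1 ` {- 4..1})"
    by (intro compact_imp_bounded compact_continuous_image) auto
  then have "\<exists>C. \<forall>s\<in>{- 4..1}. \<bar>third_diff \<psi> 1 s\<bar> \<le> C"
    by (simp add: bounded_iff)
  then obtain C where C: "\<And>s. s \<in> {- 4..1} \<Longrightarrow> \<bar>third_diff \<psi> 1 s\<bar> \<le> C"
    by blast
  have "\<bar>third_diff \<psi> 1 s\<bar> \<le> max C 2" for s
  proof -
    consider "1 \<le> s" | "s \<in> {- 4..1}" | "s < - 4"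
      by force
    then show ?thesis
    proof cases
      case 3
      have e: "- (s + 3) + 3 = - s" "- (s + 3) + 2 = - (s + 1)" "- (s + 3) + 1 = - (s + 2)"
        by simp_all
      have "\<bar>third_diff \<psi> 1 (- (s + 3))\<bar> = \<bar>third_diff \<psi> 1 s\<bar>"
        using sym unfolding third_diff_def real_scaleR_def mult_1_right e
      proof
        assume even: "\<forall>s. \<psi> (- s) = \<psi> s"
        show "\<bar>\<psi> (- s) - 3 * \<psi> (- (s + 1)) + 3 * \<psi> (- (s + 2)) - \<psi> (- (s + 3))\<bar> = \<bar>\<psi> (s + 3) - 3 * \<psi> (s + 2) + 3 * \<psi> (s + 1) - \<psi> s\<bar>"
          unfolding even[rule_format] by linarith
      next
        assume odd: "\<forall>s. \<psi> (- s) = - \<psi> s"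
        show "\<bar>\<psi> (- s) - 3 * \<psi> (- (s + 1)) + 3 * \<psi> (- (s + 2)) - \<psi> (- (s + 3))\<bar> = \<bar>\<psi> (s + 3) - 3 * \<psi> (s + 2) + 3 * \<psi> (s + 1) - \<psi> s\<bar>"
          unfolding odd[rule_format] by linarith
      qed
      then show ?thesis
        using far[of "- (s + 3)"] 3 by simp
    qed (use far[of s] C[of s] in auto)
  qed
  then show ?thesis
    by (intro exI[of _ "max C 2"]) auto
qed

lemma second_diff_xlnx:
  assumes s: "1 \<le> s"
  shows "0 \<le> xlnx (s + 2) - 2 * xlnx (s + 1) + xlnx s" "xlnx (s + 2) - 2 * xlnx (s + 1) + xlnx s \<le> 1"
proof -
  define g where "g s = (s + 1) * ln (s + 1) - s * ln s" for s :: real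
  have "(g has_real_derivative ln ((x + 1) / x)) (at x)" if "s \<le> x" for x
    unfolding g_def using s that by (auto intro!: derivative_eq_intros simp: ln_div)
  then have "\<exists>z. s < z \<and> z < s + 1 \<and> g (s + 1) - g s = (s + 1 - s) * ln ((z + 1) / z)"
    by (intro MVT2) auto
  then obtain z where z: "s < z" "g (s + 1) - g s = ln ((z + 1) / z)"
    by auto
  have "xlnx (s + 2) - 2 * xlnx (s + 1) + xlnx s = g (s + 1) - g s"
    using s by (simp add: g_def xlnx_def algebra_simps)
  moreover have "0 \<le> ln ((z + 1) / z)"
    using z s by (intro ln_ge_zero) (simp add: field_simps)
  moreover have "ln ((z + 1) / z) \<le> (z + 1) / z - 1"
    using z s by (intro ln_le_minus_one) simp
  moreover have "(z + 1) / z - 1 \<le> 1"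
    using z s by (simp add: field_simps)
  ultimately show "0 \<le> xlnx (s + 2) - 2 * xlnx (s + 1) + xlnx s" "xlnx (s + 2) - 2 * xlnx (s + 1) + xlnx s \<le> 1"
    using z(2) by linarith+
qed

text \<open>By the functional equation \<open>xlnx (h v) = h xlnx v + (h ln \<bar>h\<bar>) v\<close> the step can be normalized to 1,
  since third differences annihilate the linear term.\<close>

lemma third_diff_xlnx: "\<exists>C>0. \<forall>t h. \<bar>third_diff xlnx h t\<bar> \<le> C * \<bar>h\<bar>"
proof -
  have "\<bar>third_diff xlnx 1 s\<bar> \<le> 2" if s: "1 \<le> s" for s
    using second_diff_xlnx[OF s] second_diff_xlnx[of "s + 1"] s
    by (simp add: third_diff_def add.assoc abs_le_iff)
  then obtain C where C: "C > 0" "\<And>s. \<bar>third_diff xlnx 1 s\<bar> \<le> C"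
    using bounded_third_diff_unit_step[OF continuous_xlnx] by (auto simp: xlnx_def)
  have "\<bar>third_diff xlnx h t\<bar> \<le> C * \<bar>h\<bar>" for t h
  proof (cases "h = 0")
    case False
    define u where "u = t / h"
    have t: "t = h * u"
      using False by (simp add: u_def)
    have hom: "xlnx (h * v) = h * xlnx v + h * ln \<bar>h\<bar> * v" for v
      using False by (cases "v = 0") (simp_all add: xlnx_def abs_mult ln_mult algebra_simps)
    have pts: "h * u + 3 *\<^sub>R h = h * (u + 3)" "h * u + 2 *\<^sub>R h = h * (u + 2)" "h * u + h = h * (u + 1)"
      by (simp_all add: algebra_simps)
    have "third_diff xlnx h t = h * third_diff xlnx 1 u"
      unfolding third_diff_def t pts hom by (simp add: algebra_simps)
    then show ?thesis
      using mult_left_mono[OF C(2)[of u], of "\<bar>h\<bar>"] by (simp add: abs_mult mult.commute)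
  qed (simp add: third_diff_def)
  then show ?thesis
    using C(1) by blast
qed

text \<open>The step is normalized as for \<open>xlnx\<close>; here the correction term is quadratic, which is still
  annihilated.  For \<open>s \<ge> 1\<close> the mean value theorem leads back to second differences of \<open>xlnx\<close>.\<close>

lemma third_diff_x2lnx: "\<exists>C>0. \<forall>t h. \<bar>third_diff x2lnx h t\<bar> \<le> C * h\<^sup>2"
proof -
  have "\<bar>third_diff x2lnx 1 s\<bar> \<le> 2" if s: "1 \<le> s" for s
  proof -
    define k where "k s = (s + 2)\<^sup>2 * ln (s + 2) - 2 * ((s + 1)\<^sup>2 * ln (s + 1)) + s\<^sup>2 * ln s" for s :: real
    define k' where "k' s = 2 * ((s + 2) * ln (s + 2)) - 4 * ((s + 1) * ln (s + 1)) + 2 * (s * ln s)" for s :: real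
    have deriv: "((\<lambda>s. (s + c)\<^sup>2 * ln (s + c)) has_real_derivative 2 * ((x + c) * ln (x + c)) + (x + c)) (at x)"
      if "0 < x + c" for x c :: real
    proof -
      have "((\<lambda>s. (s + c)\<^sup>2 * ln (s + c)) has_real_derivative 2 * (x + c) * ln (x + c) + (1 / (x + c)) * (x + c)\<^sup>2) (at x)"
        using that by (auto intro!: derivative_eq_intros)
      moreover have "(1 / (x + c)) * (x + c)\<^sup>2 = x + c"
        using that by (simp add: power2_eq_square)
      ultimately show ?thesis
        by (simp only: mult.assoc)
    qed
    have "(k has_real_derivative k' x) (at x)" if "s \<le> x" for x
    proof -
      have "((\<lambda>s. (s + 2)\<^sup>2 * ln (s + 2) - 2 * ((s + 1)\<^sup>2 * ln (s + 1)) + (s + 0)\<^sup>2 * ln (s + 0)) has_real_derivative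
          (2 * ((x + 2) * ln (x + 2)) + (x + 2)) - 2 * (2 * ((x + 1) * ln (x + 1)) + (x + 1)) + (2 * ((x + 0) * ln (x + 0)) + (x + 0))) (at x)"
        using s that by (intro DERIV_add DERIV_diff DERIV_cmult deriv) auto
      moreover have "(2 * ((x + 2) * ln (x + 2)) + (x + 2)) - 2 * (2 * ((x + 1) * ln (x + 1)) + (x + 1))
          + (2 * ((x + 0) * ln (x + 0)) + (x + 0)) = k' x"
        by (simp add: k'_def)
      ultimately show ?thesis
        unfolding k_def[abs_def] by (simp only: add_0_right)
    qed
    then have "\<exists>z. s < z \<and> z < s + 1 \<and> k (s + 1) - k s = (s + 1 - s) * k' z"
      by (intro MVT2) auto
    then obtain z where z: "s < z" "k (s + 1) - k s = k' z"
      by auto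
    have "k' z = 2 * (xlnx (z + 2) - 2 * xlnx (z + 1) + xlnx z)"
      using z s by (simp add: k'_def xlnx_def)
    then have "\<bar>k' z\<bar> \<le> 2"
      using second_diff_xlnx[of z] z s by simp
    moreover have "third_diff x2lnx 1 s = k (s + 1) - k s"
      using s by (simp add: third_diff_def k_def x2lnx_def xlnx_def power2_eq_square add.assoc algebra_simps)
    ultimately show ?thesis
      using z(2) by simp
  qed
  then obtain C where C: "C > 0" "\<And>s. \<bar>third_diff x2lnx 1 s\<bar> \<le> C"
    using bounded_third_diff_unit_step[OF continuous_x2lnx] by (auto simp: x2lnx_def xlnx_def)
  have "\<bar>third_diff x2lnx h t\<bar> \<le> C * h\<^sup>2" for t h
  proof (cases "h = 0")
    case False
    define u where "u = t / h"
    have t: "t = h * u"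
      using False by (simp add: u_def)
    have hom: "x2lnx (h * v) = h\<^sup>2 * x2lnx v + h\<^sup>2 * ln \<bar>h\<bar> * (v * v)" for v
      using False by (cases "v = 0") (simp_all add: x2lnx_def xlnx_def abs_mult ln_mult power2_eq_square algebra_simps)
    have pts: "h * u + 3 *\<^sub>R h = h * (u + 3)" "h * u + 2 *\<^sub>R h = h * (u + 2)" "h * u + h = h * (u + 1)"
      by (simp_all add: algebra_simps)
    have "third_diff x2lnx h t = h\<^sup>2 * third_diff x2lnx 1 u"
      unfolding third_diff_def t pts hom by (simp add: algebra_simps)
    then show ?thesis
      using mult_left_mono[OF C(2)[of u], of "h\<^sup>2"] by (simp add: abs_mult mult.commute)
  qed (simp add: third_diff_def)
  then show ?thesis
    using C(1) by blast
qed

section \<open>Walsh functions and bent functions\<close>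

text \<open>The characters of the group of subsets of \<open>A\<close> with the symmetric difference:
  \<open>(-1)\<^bsup>\<bar>A \<inter> a \<inter> x\<bar>\<^esup>\<close>.\<close>

definition walsh :: "nat set \<Rightarrow> nat set \<Rightarrow> nat set \<Rightarrow> real" where
  "walsh A a x = (\<Prod>i\<in>A. if i \<in> a \<and> i \<in> x then -1 else 1)"

lemma walsh_commute: "walsh A a x = walsh A x a"
  unfolding walsh_def by (intro prod.cong) auto

lemma walsh_square: "walsh A a x * walsh A a x = 1"
  unfolding walsh_def prod.distrib[symmetric] by (intro prod.neutral) auto

lemma abs_walsh: "\<bar>walsh A a x\<bar> = 1"
  using walsh_square[of A a x] by (metis abs_mult_self_eq abs_one mult_1_right abs_square_eq_1 power2_eq_square)

lemma walsh_mult: "walsh A a x * walsh A b x = walsh A (a - b \<union> (b - a)) x"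
  unfolding walsh_def prod.distrib[symmetric] by (intro prod.cong) auto

lemma sum_Pow_prod:
  fixes f :: "'a \<Rightarrow> real"
  assumes "finite A"
  shows "(\<Sum>x\<in>Pow A. \<Prod>i\<in>A. if i \<in> x then f i else 1) = (\<Prod>i\<in>A. f i + 1)"
  using assms
proof (induction A rule: finite_induct)
  case (insert a A)
  have inj: "inj_on (insert a) (Pow A)"
    using insert.hyps by (auto simp: inj_on_def)
  have "(\<Sum>x\<in>Pow (insert a A). \<Prod>i\<in>insert a A. if i \<in> x then f i else 1)
      = (\<Sum>x\<in>Pow A. \<Prod>i\<in>insert a A. if i \<in> x then f i else 1)
        + (\<Sum>x\<in>insert a ` Pow A. \<Prod>i\<in>insert a A. if i \<in> x then f i else 1)"
    unfolding Pow_insert using insert.hyps by (intro sum.union_disjoint) auto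
  also have "(\<Sum>x\<in>insert a ` Pow A. \<Prod>i\<in>insert a A. if i \<in> x then f i else 1)
      = (\<Sum>x\<in>Pow A. f a * (\<Prod>i\<in>A. if i \<in> x then f i else 1))"
    unfolding sum.reindex[OF inj] o_def
  proof (intro sum.cong refl)
    fix x assume "x \<in> Pow A"
    have "(\<Prod>i\<in>A. if i \<in> insert a x then f i else 1) = (\<Prod>i\<in>A. if i \<in> x then f i else 1)"
      using insert.hyps by (intro prod.cong) auto
    then show "(\<Prod>i\<in>insert a A. if i \<in> insert a x then f i else 1) = f a * (\<Prod>i\<in>A. if i \<in> x then f i else 1)"
      unfolding prod.insert[OF insert.hyps] by simp
  qed
  also have "(\<Sum>x\<in>Pow A. \<Prod>i\<in>insert a A. if i \<in> x then f i else 1) = (\<Sum>x\<in>Pow A. \<Prod>i\<in>A. if i \<in> x then f i else 1)"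
    using insert.hyps by (intro sum.cong refl) (auto simp: prod.insert)
  finally show ?case
    using insert by (simp add: algebra_simps flip: sum_distrib_left)
qed simp

lemma walsh_orthogonal:
  assumes A: "finite A" and a: "a \<subseteq> A" and b: "b \<subseteq> A"
  shows "(\<Sum>x\<in>Pow A. walsh A a x * walsh A b x) = (if a = b then 2 ^ card A else 0)"
proof -
  define c where "c = a - b \<union> (b - a)"
  have "(\<Sum>x\<in>Pow A. walsh A a x * walsh A b x) = (\<Sum>x\<in>Pow A. walsh A c x)"
    by (simp only: walsh_mult c_def)
  also have "\<dots> = (\<Sum>x\<in>Pow A. \<Prod>i\<in>A. if i \<in> x then (if i \<in> c then -1 else 1) else 1)"
    unfolding walsh_def by (intro sum.cong prod.cong refl) auto
  also have "\<dots> = (\<Prod>i\<in>A. (if i \<in> c then -1 else 1) + 1)"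
    by (rule sum_Pow_prod[OF A])
  also have "\<dots> = (if a = b then 2 ^ card A else 0)"
  proof (cases "a = b")
    case True
    then show ?thesis
      by (simp add: c_def)
  next
    case False
    then obtain i where "i \<in> A" "i \<in> c"
      using a b by (auto simp: c_def)
    then show ?thesis
      using False A by (auto intro!: prod_zero)
  qed
  finally show ?thesis .
qed

text \<open>
  Two orthogonal bases of \<open>\<real>\<^sup>M\<close>, \<open>M = 4\<^sup>m\<close>, all of whose vectors have entries \<open>\<plusminus>1\<close> and which are
  moreover unbiased: every vector of one has coefficients of equal modulus in the other.  The first
  consists of the characters of \<open>G \<times> G\<close> with \<open>G\<close> elementary abelian of order \<open>2\<^sup>m\<close>, the second of
  their products with the bent function \<open>(x, y) \<mapsto> (-1)\<^bsup>\<bar>x \<inter> y\<bar>\<^esup>\<close>.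
\<close>

lemma unbiased_bases:
  fixes M m :: nat
  assumes M: "M = 4 ^ m"
  obtains P :: "(nat set \<times> nat set) set" and w u :: "nat set \<times> nat set \<Rightarrow> nat \<Rightarrow> real" where
    "finite P" "card P = M"
    "\<And>l. l \<in> P \<Longrightarrow> w l \<in> real_space M" "\<And>l. l \<in> P \<Longrightarrow> u l \<in> real_space M"
    "\<And>l i. l \<in> P \<Longrightarrow> i < M \<Longrightarrow> \<bar>w l i\<bar> = 1" "\<And>l i. l \<in> P \<Longrightarrow> i < M \<Longrightarrow> \<bar>u l i\<bar> = 1"
    "\<And>i j. i < M \<Longrightarrow> j < M \<Longrightarrow> (\<Sum>l\<in>P. w l i * w l j) = (if i = j then real M else 0)"
    "\<And>i j. i < M \<Longrightarrow> j < M \<Longrightarrow> (\<Sum>l\<in>P. u l i * u l j) = (if i = j then real M else 0)"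
    "\<And>k l. k \<in> P \<Longrightarrow> l \<in> P \<Longrightarrow> ip M (w k) (w l) = (if k = l then real M else 0)"
    "\<And>k l. k \<in> P \<Longrightarrow> l \<in> P \<Longrightarrow> \<bar>ip M (u k) (w l)\<bar> = 2 ^ m"
proof -
  define A where "A = {..<m}"
  have A: "finite A" "card A = m"
    by (simp_all add: A_def)
  define P where "P = Pow A \<times> Pow A"
  have P: "finite P" "card P = M"
    using A by (simp_all add: M P_def card_cartesian_product card_Pow power_mult_distrib[symmetric])
  obtain e where e: "bij_betw e {..<M} P"
    using ex_bij_betw_nat_finite[OF P(1)] P(2) by (auto simp: atLeast0LessThan)
  have eP: "e i \<in> P" if "i < M" for i
    using e that by (auto simp: bij_betw_def)
  have e_inj: "e i = e j \<longleftrightarrow> i = j" if "i < M" "j < M" for i j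
    using e that by (auto simp: bij_betw_def inj_on_def)
  define ch where "ch l z = walsh A (fst l) (fst z) * walsh A (snd l) (snd z)" for l z
  define \<beta> where "\<beta> l z = walsh A (fst z) (snd z) * ch l z" for l z
  have orth_ch: "(\<Sum>z\<in>P. ch k z * ch l z) = (if k = l then real M else 0)" if "k \<in> P" "l \<in> P" for k l
  proof -
    have "(\<Sum>z\<in>P. ch k z * ch l z)
        = (\<Sum>x\<in>Pow A. \<Sum>y\<in>Pow A. (walsh A (fst k) x * walsh A (fst l) x) * (walsh A (snd k) y * walsh A (snd l) y))"
      unfolding P_def sum.cartesian_product ch_def by (intro sum.cong) (auto simp: mult_ac)
    also have "\<dots> = (\<Sum>x\<in>Pow A. walsh A (fst k) x * walsh A (fst l) x) * (\<Sum>y\<in>Pow A. walsh A (snd k) y * walsh A (snd l) y)"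
      by (simp only: sum_product)
    also have "\<dots> = (if k = l then real M else 0)"
      using that A by (cases k; cases l) (simp add: M P_def walsh_orthogonal power_mult_distrib[symmetric])
    finally show ?thesis .
  qed
  have ch_commute: "ch k l = ch l k" for k l
    by (simp add: ch_def walsh_commute[of A "fst k"] walsh_commute[of A "snd k"])
  have dual_ch: "(\<Sum>l\<in>P. ch l y * ch l z) = (if y = z then real M else 0)" if "y \<in> P" "z \<in> P" for y z
    using orth_ch[OF that] by (simp add: ch_commute)
  have dual_\<beta>: "(\<Sum>l\<in>P. \<beta> l y * \<beta> l z) = (if y = z then real M else 0)" if "y \<in> P" "z \<in> P" for y z
  proof -
    have "(\<Sum>l\<in>P. \<beta> l y * \<beta> l z)
        = walsh A (fst y) (snd y) * walsh A (fst z) (snd z) * (\<Sum>l\<in>P. ch l y * ch l z)"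
      by (simp add: \<beta>_def sum_distrib_left mult_ac)
    then show ?thesis
      using dual_ch[OF that] by (simp add: walsh_square)
  qed
  have bent: "\<bar>\<Sum>z\<in>P. \<beta> k z * ch l z\<bar> = 2 ^ m" if "k \<in> P" "l \<in> P" for k l
  proof -
    define c d where "c = fst k - fst l \<union> (fst l - fst k)" and "d = snd k - snd l \<union> (snd l - snd k)"
    have d: "d \<subseteq> A"
      using that by (auto simp: d_def P_def)
    have "(\<Sum>z\<in>P. \<beta> k z * ch l z)
        = (\<Sum>x\<in>Pow A. \<Sum>y\<in>Pow A. walsh A x y * (walsh A (fst k) x * walsh A (fst l) x) * (walsh A (snd k) y * walsh A (snd l) y))"
      unfolding P_def sum.cartesian_product \<beta>_def ch_def by (intro sum.cong) (auto simp: mult_ac)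
    also have "\<dots> = (\<Sum>x\<in>Pow A. walsh A c x * (\<Sum>y\<in>Pow A. walsh A x y * walsh A d y))"
      unfolding walsh_mult[of A "fst k" _ "fst l"] walsh_mult[of A "snd k" _ "snd l"] c_def[symmetric] d_def[symmetric]
      by (simp add: sum_distrib_left mult_ac)
    also have "\<dots> = (\<Sum>x\<in>Pow A. if x = d then walsh A c d * 2 ^ m else 0)"
      using A d by (intro sum.cong) (auto simp: walsh_orthogonal)
    also have "\<dots> = walsh A c d * 2 ^ m"
      using A d by simp
    finally show ?thesis
      by (simp add: abs_mult abs_walsh)
  qed
  define w u where "w l i = (if i < M then ch l (e i) else 0)" and "u l i = (if i < M then \<beta> l (e i) else 0)"
    for l and i :: nat
  have ip_sum: "(\<Sum>i<M. f (e i)) = (\<Sum>z\<in>P. f z)" for f :: "nat set \<times> nat set \<Rightarrow> real"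
    by (rule sum.reindex_bij_betw[OF e])
  show ?thesis
  proof (rule that[OF P])
    show "w l \<in> real_space M" "u l \<in> real_space M" for l
      by (simp_all add: real_space_def w_def u_def)
    show "\<bar>w l i\<bar> = 1" "\<bar>u l i\<bar> = 1" if "i < M" for l i
      using that by (simp_all add: w_def u_def \<beta>_def ch_def abs_mult abs_walsh)
    show "(\<Sum>l\<in>P. w l i * w l j) = (if i = j then real M else 0)" "(\<Sum>l\<in>P. u l i * u l j) = (if i = j then real M else 0)"
      if "i < M" "j < M" for i j
      using that eP by (simp_all add: w_def u_def dual_ch dual_\<beta> e_inj)
    show "ip M (w k) (w l) = (if k = l then real M else 0)" if "k \<in> P" "l \<in> P" for k l
    proof -
      have "ip M (w k) (w l) = (\<Sum>i<M. ch k (e i) * ch l (e i))"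
        unfolding ip_def by (intro sum.cong) (auto simp: w_def)
      then show ?thesis
        using orth_ch[OF that] ip_sum[of "\<lambda>z. ch k z * ch l z"] by simp
    qed
    show "\<bar>ip M (u k) (w l)\<bar> = 2 ^ m" if "k \<in> P" "l \<in> P" for k l
    proof -
      have "ip M (u k) (w l) = (\<Sum>i<M. \<beta> k (e i) * ch l (e i))"
        unfolding ip_def by (intro sum.cong) (auto simp: w_def u_def)
      then show ?thesis
        using bent[OF that] ip_sum[of "\<lambda>z. \<beta> k z * ch l z"] by simp
    qed
  qed
qed

section \<open>The lower bounds\<close>

lemma (in coord_norm) scaled_point_in_ball:
  assumes "v \<in> real_space n" "N v \<le> 1"
  shows "v \<in> unit_cball n N" "- v \<in> unit_cball n N"
  using assms by (simp_all add: unit_cball_def real_space_def)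

text \<open>
  The function is \<open>\<Sum> t\<^sup>2 ln \<bar>t\<bar>\<close> in the coordinates with respect to the first of two unbiased bases.
  Any quadratic form has the same sum over both bases, since for each of them \<open>\<Sum> v \<otimes> v\<close> is the
  same multiple of the identity, but the function itself takes values of different size on them:
  the vectors of the first basis have one nonzero coordinate, those of the second are spread out.
  Because all vectors have entries \<open>\<plusminus>1\<close>, suitable multiples lie on the unit sphere of \<open>\<ell>\<^sub>p\<^sup>n\<close> for
  every \<open>p\<close>.
\<close>

lemma (in coord_norm) whitney3_lower_log:
  fixes M :: nat and s C :: real
  assumes M: "M = 4 ^ m" "M \<le> n" and m: "1 \<le> m" and s: "0 < s"
    and s1: "\<And>v. v \<in> real_space M \<Longrightarrow> (\<And>i. i < M \<Longrightarrow> \<bar>v i\<bar> = 1) \<Longrightarrow> N (s *\<^sub>R v) \<le> 1"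
    and s2: "\<And>h. (\<Sum>i<M. (h i)\<^sup>2) \<le> real M * s\<^sup>2 * (N h)\<^sup>2"
    and C: "0 < C" "\<And>t h. \<bar>third_diff x2lnx h t\<bar> \<le> C * h\<^sup>2"
  shows "ereal (ln M / (4 * C)) \<le> whitney3 n N"
proof -
  have realM: "real M = 4 ^ m" "0 < real M"
    using M by simp_all
  obtain P :: "(nat set \<times> nat set) set" and w u :: "nat set \<times> nat set \<Rightarrow> nat \<Rightarrow> real"
    where P: "finite P" "card P = M"
    and space: "\<And>l. l \<in> P \<Longrightarrow> w l \<in> real_space M" "\<And>l. l \<in> P \<Longrightarrow> u l \<in> real_space M"
    and entries: "\<And>l i. l \<in> P \<Longrightarrow> i < M \<Longrightarrow> \<bar>w l i\<bar> = 1" "\<And>l i. l \<in> P \<Longrightarrow> i < M \<Longrightarrow> \<bar>u l i\<bar> = 1"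
    and frame: "\<And>i j. i < M \<Longrightarrow> j < M \<Longrightarrow> (\<Sum>l\<in>P. w l i * w l j) = (if i = j then real M else 0)"
      "\<And>i j. i < M \<Longrightarrow> j < M \<Longrightarrow> (\<Sum>l\<in>P. u l i * u l j) = (if i = j then real M else 0)"
    and ips: "\<And>k l. k \<in> P \<Longrightarrow> l \<in> P \<Longrightarrow> ip M (w k) (w l) = (if k = l then real M else 0)"
      "\<And>k l. k \<in> P \<Longrightarrow> l \<in> P \<Longrightarrow> \<bar>ip M (u k) (w l)\<bar> = 2 ^ m"
  proof (rule unbiased_bases[OF M(1)], goal_cases)
    case (1 P w u)
    show ?case
      by (rule 1(1)[of P w u]) (fact 1)+
  qed
  define f where "f x = (\<Sum>l\<in>P. x2lnx (ip M x (w l)))" for x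
  define D where "D = C * (real M)\<^sup>2 * s\<^sup>2"
  define d where "d = s\<^sup>2 * (real M)\<^sup>2 * ln M / 4"
  have D: "0 < D"
    using C(1) s realM(2) by (simp add: D_def)
  have even: "x2lnx (- t) = x2lnx t" for t
    by (simp add: x2lnx_def xlnx_def)
  have even_abs: "x2lnx t = x2lnx \<bar>t\<bar>" for t
    by (simp add: abs_if even)
  have "ereal (d / D) \<le> whitney3 n N"
  proof (rule whitney3_lower)
    show "continuous_on UNIV f"
      unfolding f_def ip_def
      by (intro continuous_intros continuous_on_compose2[OF continuous_x2lnx] continuous_on_product_coordinates) auto
    show "\<bar>third_diff f h x\<bar> \<le> D" if h: "N h \<le> 1" for x h
    proof -
      have "third_diff f h x = (\<Sum>l\<in>P. third_diff x2lnx (ip M h (w l)) (ip M x (w l)))"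
        by (simp add: third_diff_def f_def ip_add ip_scaleR sum.distrib sum_subtractf sum_distrib_left)
      also have "\<bar>\<dots>\<bar> \<le> (\<Sum>l\<in>P. C * (ip M h (w l))\<^sup>2)"
        by (intro order_trans[OF sum_abs] sum_mono C(2))
      also have "\<dots> = C * (M * (\<Sum>i<M. (h i)\<^sup>2))"
      proof -
        have "(\<Sum>l\<in>P. (ip M h (w l))\<^sup>2) = (\<Sum>l\<in>P. \<Sum>i<M. \<Sum>j<M. h i * h j * (w l i * w l j))"
          unfolding ip_def power2_eq_square sum_product by (intro sum.cong refl) (simp add: mult_ac)
        also have "\<dots> = (\<Sum>i<M. \<Sum>j<M. h i * h j * (\<Sum>l\<in>P. w l i * w l j))"
          by (subst sum.swap, intro sum.cong refl, subst sum.swap) (simp add: sum_distrib_left)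
        also have "\<dots> = (\<Sum>i<M. \<Sum>j<M. if j = i then M * (h i)\<^sup>2 else 0)"
          using frame(1) realM by (intro sum.cong refl) (auto simp: power2_eq_square)
        also have "\<dots> = M * (\<Sum>i<M. (h i)\<^sup>2)"
          by (simp add: sum_distrib_left)
        finally show ?thesis
          by (simp add: sum_distrib_left[symmetric])
      qed
      also have "\<dots> \<le> C * (M * (M * s\<^sup>2 * (N h)\<^sup>2))"
        using C(1) realM(2) by (intro mult_left_mono s2) auto
      also have "\<dots> \<le> C * (M * (M * s\<^sup>2 * 1))"
        using C(1) realM(2) h by (intro mult_left_mono) (auto simp: power_le_one)
      finally show ?thesis
        by (simp add: D_def power2_eq_square mult_ac)
    qed
    fix a t q
    define E where "E x = f x - quadratic n a t q x" for x
    have even_quadratic: "quadratic n a t q v + quadratic n a t q (- v) = 2 * a + 2 * (\<Sum>c<n*n. q c * (v (c div n) * v (c mod n)))" for v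
      by (simp add: quadratic_def sum_negf)
    have trace: "(\<Sum>l\<in>P. \<Sum>c<n*n. q c * ((s *\<^sub>R w l) (c div n) * (s *\<^sub>R w l) (c mod n)))
        = (\<Sum>l\<in>P. \<Sum>c<n*n. q c * ((s *\<^sub>R u l) (c div n) * (s *\<^sub>R u l) (c mod n)))"
    proof -
      have pair: "(\<Sum>l\<in>P. w l i * w l j) = (\<Sum>l\<in>P. u l i * u l j)" for i j
      proof (cases "i < M \<and> j < M")
        case True
        then show ?thesis
          using frame by simp
      next
        case False
        then have "w l i * w l j = 0" "u l i * u l j = 0" if "l \<in> P" for l
          using space[OF that] by (auto simp: real_space_def not_less)
        then have "(\<Sum>l\<in>P. w l i * w l j) = 0" "(\<Sum>l\<in>P. u l i * u l j) = 0"
          by (intro sum.neutral ballI; simp only:)+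
        then show ?thesis
          by simp
      qed
      have "(\<Sum>l\<in>P. \<Sum>c<n*n. q c * ((s *\<^sub>R v l) (c div n) * (s *\<^sub>R v l) (c mod n)))
          = (\<Sum>c<n*n. q c * s\<^sup>2 * (\<Sum>l\<in>P. v l (c div n) * v l (c mod n)))" for v
        by (subst sum.swap) (simp add: sum_distrib_left power2_eq_square mult_ac)
      then show ?thesis
        by (simp only: pair)
    qed
    have f_w: "f (r *\<^sub>R w k) = x2lnx (s * M)" if "k \<in> P" "\<bar>r\<bar> = s" for k r
    proof -
      have "f (r *\<^sub>R w k) = (\<Sum>l\<in>P. if l = k then x2lnx (s * M) else 0)"
        unfolding f_def
      proof (intro sum.cong refl)
        fix l assume "l \<in> P"
        have "x2lnx (r * M) = x2lnx (s * M)"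
          using even[of "s * M"] that(2) s by (auto simp: abs_if split: if_splits)
        then show "x2lnx (ip M (r *\<^sub>R w k) (w l)) = (if l = k then x2lnx (s * M) else 0)"
          using ips(1)[OF that(1) \<open>l \<in> P\<close>] realM(1) by (auto simp: ip_scaleR x2lnx_def)
      qed
      then show ?thesis
        using P(1) that(1) by simp
    qed
    have f_u: "f (r *\<^sub>R u k) = M * x2lnx (s * 2 ^ m)" if "k \<in> P" "\<bar>r\<bar> = s" for k r
    proof -
      have "f (r *\<^sub>R u k) = (\<Sum>l\<in>P. x2lnx (s * 2 ^ m))"
        unfolding f_def
      proof (intro sum.cong refl)
        fix l assume "l \<in> P"
        have "\<bar>ip M (r *\<^sub>R u k) (w l)\<bar> = s * 2 ^ m"
          using ips(2)[OF that(1) \<open>l \<in> P\<close>] that(2) by (simp add: ip_scaleR abs_mult)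
        then show "x2lnx (ip M (r *\<^sub>R u k) (w l)) = x2lnx (s * 2 ^ m)"
          using even_abs[of "ip M (r *\<^sub>R u k) (w l)"] by (simp only:)
      qed
      then show ?thesis
        using P by simp
    qed
    \<comment> \<open>the value of \<open>f\<close> at \<open>\<plusminus>s\<close> times a vector of the first basis exceeds that for the second by \<open>2 d\<close>\<close>
    have gap: "x2lnx (s * M) - M * x2lnx (s * 2 ^ m) = 2 * d"
    proof -
      have x2lnx_pos: "x2lnx t = t\<^sup>2 * ln t" if "0 < t" for t
        using that by (simp add: x2lnx_def xlnx_def power2_eq_square)
      have M_square: "real M = (2 ^ m)\<^sup>2"
        by (simp add: realM(1) power2_eq_square flip: power_mult_distrib)
      have ln_M: "ln (real M) = 2 * ln (2 ^ m)"
        unfolding M_square by (rule ln_realpow[of _ 2, simplified])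
      have "x2lnx (s * M) = s\<^sup>2 * (real M)\<^sup>2 * (ln s + ln M)"
        using s realM(2) by (simp add: x2lnx_pos ln_mult_pos power_mult_distrib)
      moreover have "M * x2lnx (s * 2 ^ m) = M * (s\<^sup>2 * (2 ^ m)\<^sup>2 * (ln s + ln (2 ^ m)))"
        using s by (simp add: x2lnx_pos ln_mult_pos power_mult_distrib)
      moreover have "M * (s\<^sup>2 * (2 ^ m)\<^sup>2 * (ln s + ln (2 ^ m))) = s\<^sup>2 * (real M)\<^sup>2 * (ln s + ln (2 ^ m))"
        unfolding M_square[symmetric] by (simp only: power2_eq_square[of "real M"] mult_ac)
      ultimately show ?thesis
        unfolding d_def by (simp add: algebra_simps ln_M)
    qed
    have points: "s *\<^sub>R v \<in> unit_cball n N" "- (s *\<^sub>R v) \<in> unit_cball n N"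
      if "v \<in> real_space M" "\<And>i. i < M \<Longrightarrow> \<bar>v i\<bar> = 1" for v
    proof -
      have "s *\<^sub>R v \<in> real_space n"
        using that(1) M(2) by (simp add: real_space_def)
      then show "s *\<^sub>R v \<in> unit_cball n N" "- (s *\<^sub>R v) \<in> unit_cball n N"
        using s1[OF that] by (simp_all only: scaled_point_in_ball)
    qed
    \<comment> \<open>the signs remove the linear part of the polynomial, the sum over \<open>l\<close> its quadratic part\<close>
    define b where "b l = E (s *\<^sub>R w l) + E (- (s *\<^sub>R w l)) - E (s *\<^sub>R u l) - E (- (s *\<^sub>R u l))" for l
    have "(\<Sum>l\<in>P. b l) = 4 * M * d"
    proof -
      have minus: "f (- (s *\<^sub>R v)) = f ((- s) *\<^sub>R v)" for v
        by simp
      have b_eq: "b l = 4 * d - 2 * (\<Sum>c<n*n. q c * ((s *\<^sub>R w l) (c div n) * (s *\<^sub>R w l) (c mod n)))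
          + 2 * (\<Sum>c<n*n. q c * ((s *\<^sub>R u l) (c div n) * (s *\<^sub>R u l) (c mod n)))" if "l \<in> P" for l
        unfolding b_def E_def
        using f_w[OF that, of s] f_w[OF that, of "- s"] f_u[OF that, of s] f_u[OF that, of "- s"] s gap
          even_quadratic[of "s *\<^sub>R w l"] even_quadratic[of "s *\<^sub>R u l"] minus[of "w l"] minus[of "u l"]
        by linarith
      have "(\<Sum>l\<in>P. b l) = (\<Sum>l\<in>P. 4 * d - 2 * (\<Sum>c<n*n. q c * ((s *\<^sub>R w l) (c div n) * (s *\<^sub>R w l) (c mod n)))
          + 2 * (\<Sum>c<n*n. q c * ((s *\<^sub>R u l) (c div n) * (s *\<^sub>R u l) (c mod n))))"
        by (intro sum.cong refl b_eq)
      also have "\<dots> = 4 * M * d"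
        using trace P(2) by (simp only: sum.distrib sum_subtractf sum_distrib_left[symmetric] sum_constant)
      finally show ?thesis .
    qed
    then have "\<exists>l\<in>P. 4 * d \<le> b l"
    proof -
      have "P \<noteq> {}"
        using P(2) realM(2) by auto
      show ?thesis
      proof (rule ccontr)
        assume "\<not> (\<exists>l\<in>P. 4 * d \<le> b l)"
        then have "(\<Sum>l\<in>P. b l) < (\<Sum>l\<in>P. 4 * d)"
          using P(1) \<open>P \<noteq> {}\<close> by (intro sum_strict_mono) (auto simp: not_le)
        then show False
          using \<open>(\<Sum>l\<in>P. b l) = 4 * M * d\<close> P(2) by simp
      qed
    qed
    then obtain l where l: "l \<in> P" "4 * d \<le> b l"
      by blast
    then have "d \<le> \<bar>E (s *\<^sub>R w l)\<bar> \<or> d \<le> \<bar>E (- (s *\<^sub>R w l))\<bar> \<or> d \<le> \<bar>E (s *\<^sub>R u l)\<bar> \<or> d \<le> \<bar>E (- (s *\<^sub>R u l))\<bar>"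
      unfolding b_def by linarith
    then show "\<exists>x\<in>unit_cball n N. d \<le> \<bar>f x - quadratic n a t q x\<bar>"
      using points[OF space(1)[OF l(1)] entries(1)[OF l(1)]] points[OF space(2)[OF l(1)] entries(2)[OF l(1)]]
      unfolding E_def by blast
  qed (rule D)
  moreover have "d / D = ln M / (4 * C)"
    using s realM(2) C(1) by (simp add: d_def D_def)
  ultimately show ?thesis
    by simp
qed

text \<open>Hoelder's inequality for the exponents \<open>p/2\<close> and its conjugate, applied to the first \<open>M\<close>
  coordinates and obtained from Young's inequality after normalization by \<open>\<theta>\<close>.\<close>

lemma sum_squares_le_lp_norm:
  fixes p :: real
  assumes p: "2 \<le> p" and M: "0 < M" "M \<le> n"
  shows "(\<Sum>i<M. (h i)\<^sup>2) \<le> real M * (real M powr (- 1 / p))\<^sup>2 * (lp_norm n p h)\<^sup>2"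
proof (cases "lp_norm n p h = 0")
  case True
  interpret coord_norm "lp_norm n p" n
    using p by (intro coord_norm_lp) simp
  have "h i = 0" if "i < M" for i
    using coord_le[of i h] True that M(2) by simp
  then show ?thesis
    using True by simp
next
  case False
  then have N: "0 < lp_norm n p h"
    using lp_norm_nonneg[of n p h] by linarith
  define \<theta> where "\<theta> = lp_norm n p h * real M powr (- 1 / p)"
  have \<theta>: "0 < \<theta>"
    using N M(1) by (simp add: \<theta>_def)
  have \<theta>p: "\<theta> powr p = lp_norm n p h powr p / M"
    using p M(1) by (simp add: \<theta>_def powr_mult powr_divide powr_powr powr_minus_divide)
  have young: "(h i)\<^sup>2 / \<theta>\<^sup>2 \<le> 2 / p * (\<bar>h i\<bar> powr p / \<theta> powr p) + (1 - 2 / p)" for i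
  proof (cases "h i = 0")
    case True
    then show ?thesis
      using p by simp
  next
    case False
    have "(\<bar>h i\<bar> powr p / \<theta> powr p) powr (2 / p) * 1 powr (1 - 2 / p)
        \<le> 2 / p * (\<bar>h i\<bar> powr p / \<theta> powr p) + (1 - 2 / p) * 1"
      using False \<theta> p by (intro Youngs_inequality_0) auto
    moreover have "(\<bar>h i\<bar> powr p / \<theta> powr p) powr (2 / p) = (h i)\<^sup>2 / \<theta>\<^sup>2"
      using False \<theta> p by (simp add: powr_divide powr_powr)
    ultimately show ?thesis
      by simp
  qed
  have "(\<Sum>i<M. (h i)\<^sup>2) / \<theta>\<^sup>2 \<le> (\<Sum>i<M. 2 / p * (\<bar>h i\<bar> powr p / \<theta> powr p) + (1 - 2 / p))"
    unfolding sum_divide_distrib by (intro sum_mono young)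
  also have "\<dots> = 2 / p * ((\<Sum>i<M. \<bar>h i\<bar> powr p) / \<theta> powr p) + M * (1 - 2 / p)"
    by (simp add: sum.distrib sum_distrib_left sum_divide_distrib)
  also have "\<dots> \<le> 2 / p * M + M * (1 - 2 / p)"
  proof (intro add_right_mono mult_left_mono)
    have "(\<Sum>i<M. \<bar>h i\<bar> powr p) \<le> (\<Sum>i<n. \<bar>h i\<bar> powr p)"
      using M(2) by (intro sum_mono2) auto
    also have "\<dots> = lp_norm n p h powr p"
      using p by (simp add: lp_norm_powr)
    finally show "(\<Sum>i<M. \<bar>h i\<bar> powr p) / \<theta> powr p \<le> M"
      using N M(1) unfolding \<theta>p by (simp add: field_simps)
  qed (use p in auto)
  also have "\<dots> = M"
    by (simp add: algebra_simps)
  finally have "(\<Sum>i<M. (h i)\<^sup>2) \<le> M * \<theta>\<^sup>2"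
    using \<theta> by (simp add: divide_le_eq)
  then show ?thesis
    by (simp add: \<theta>_def power_mult_distrib mult_ac)
qed

lemma whitney3_lp_lower:
  assumes p: "2 \<le> p" and M: "M = 4 ^ m" "M \<le> n" and m: "1 \<le> m"
    and C: "0 < C" "\<And>t h. \<bar>third_diff x2lnx h t\<bar> \<le> C * h\<^sup>2"
  shows "ereal (ln (real M) / (4 * C)) \<le> whitney3 n (lp_norm n p)"
proof -
  interpret coord_norm "lp_norm n p" n
    using p by (intro coord_norm_lp) simp
  have M0: "0 < M"
    using M by simp
  show ?thesis
  proof (rule whitney3_lower_log[where s = "real M powr (- 1 / p)"])
    show "lp_norm n p (real M powr (- 1 / p) *\<^sub>R v) \<le> 1"
      if v: "v \<in> real_space M" "\<And>i. i < M \<Longrightarrow> \<bar>v i\<bar> = 1" for v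
    proof -
      have "(\<Sum>i<n. \<bar>v i\<bar> powr p) = (\<Sum>i<M. \<bar>v i\<bar> powr p)"
        using M(2) v(1) by (intro sum.mono_neutral_right) (auto simp: real_space_def)
      also have "\<dots> = M"
        using v(2) by simp
      finally have "lp_norm n p v = real M powr (1 / p)"
        by (simp add: lp_norm_def)
      then show ?thesis
        using M0 by (simp add: scale flip: powr_add)
    qed
    show "(\<Sum>i<M. (h i)\<^sup>2) \<le> real M * (real M powr (- 1 / p))\<^sup>2 * (lp_norm n p h)\<^sup>2" for h
      by (rule sum_squares_le_lp_norm[OF p M0 M(2)])
  qed (use M m C M0 in auto)
qed

lemma whitney3_linf_lower:
  assumes M: "M = 4 ^ m" "M \<le> n" and m: "1 \<le> m"
    and C: "0 < C" "\<And>t h. \<bar>third_diff x2lnx h t\<bar> \<le> C * h\<^sup>2"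
  shows "ereal (ln (real M) / (4 * C)) \<le> whitney3 n (linf_norm n)"
proof -
  have M0: "0 < M"
    using M by simp
  then have n: "1 \<le> n"
    using M(2) by simp
  interpret coord_norm "linf_norm n" n
    by (rule coord_norm_linf[OF n])
  show ?thesis
  proof (rule whitney3_lower_log[where s = 1])
    show "linf_norm n (1 *\<^sub>R v) \<le> 1" if v: "v \<in> real_space M" "\<And>i. i < M \<Longrightarrow> \<bar>v i\<bar> = 1" for v
      unfolding linf_norm_le_iff[OF n]
    proof (intro allI impI)
      fix i
      show "\<bar>(1 *\<^sub>R v) i\<bar> \<le> 1"
        using v(2)[of i] v(1) by (cases "i < M") (auto simp: real_space_def)
    qed
    show "(\<Sum>i<M. (h i)\<^sup>2) \<le> real M * 1\<^sup>2 * (linf_norm n h)\<^sup>2" for h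
    proof -
      have "(\<Sum>i<M. (h i)\<^sup>2) \<le> (\<Sum>i<M. (linf_norm n h)\<^sup>2)"
      proof (rule sum_mono)
        fix i assume "i \<in> {..<M}"
        then have "\<bar>h i\<bar> \<le> \<bar>linf_norm n h\<bar>"
          using coord_le[of i h] M(2) by simp
        then show "(h i)\<^sup>2 \<le> (linf_norm n h)\<^sup>2"
          by (simp only: abs_le_square_iff)
      qed
      then show ?thesis
        by simp
    qed
  qed (use M m C in auto)
qed

text \<open>For \<open>p = 1\<close> the linear part is already badly approximable: Ribe's function \<open>\<Sum> x\<^sub>i ln \<bar>x\<^sub>i\<bar>\<close>
  vanishes at the unit vectors, but its value at their barycentre is \<open>- ln n\<close>, whereas a linear form
  takes there the mean of its values at the unit vectors.\<close>

lemma whitney3_l1_lower: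
  assumes n: "1 \<le> n"
    and C: "0 < C" "\<And>t h. \<bar>third_diff xlnx h t\<bar> \<le> C * \<bar>h\<bar>"
  shows "ereal (ln (real n) / 2 / C) \<le> whitney3 n (lp_norm n 1)"
proof -
  interpret coord_norm "lp_norm n 1" n
    by (rule coord_norm_lp) simp
  have N1: "lp_norm n 1 x = (\<Sum>i<n. \<bar>x i\<bar>)" for x
    by (simp add: lp_norm_def sum_nonneg)
  define f where "f x = (\<Sum>i<n. xlnx (x i))" for x :: "nat \<Rightarrow> real"
  show ?thesis
  proof (rule whitney3_lower)
    show "continuous_on UNIV f"
      unfolding f_def
      by (intro continuous_intros continuous_on_compose2[OF continuous_xlnx] continuous_on_product_coordinates) auto
    show "\<bar>third_diff f h x\<bar> \<le> C" if "lp_norm n 1 h \<le> 1" for x h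
    proof -
      have "third_diff f h x = (\<Sum>i<n. third_diff xlnx (h i) (x i))"
        by (simp add: third_diff_def f_def sum.distrib sum_subtractf sum_distrib_left)
      also have "\<bar>\<dots>\<bar> \<le> (\<Sum>i<n. C * \<bar>h i\<bar>)"
        by (intro order_trans[OF sum_abs] sum_mono C(2))
      also have "\<dots> = C * lp_norm n 1 h"
        by (simp add: N1 sum_distrib_left)
      also have "\<dots> \<le> C"
        using C(1) that by simp
      finally show ?thesis .
    qed
    fix a t q
    define E where "E x = f x - quadratic n a t q x" for x
    define v where "v = (\<lambda>i. if i < n then 1 / real n else 0)"
    have odd_quadratic: "quadratic n a t q x - quadratic n a t q (- x) = 2 * (\<Sum>i<n. t i * x i)" for x
      by (simp add: quadratic_def sum_negf)
    have lin_e: "(\<Sum>i<n. t i * unit_vec l i) = t l" if "l < n" for l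
      using ip_unit_vec[OF that, of t] by (simp add: ip_def)
    have f_e: "f (unit_vec l) = 0" "f (- unit_vec l) = 0" for l
      by (auto simp: f_def unit_vec_def xlnx_def intro!: sum.neutral)
    have f_v: "f v = - ln n" "f (- v) = ln n"
      using n by (simp_all add: f_def v_def xlnx_def ln_div)
    have lin_v: "n * (\<Sum>i<n. t i * v i) = (\<Sum>i<n. t i)"
      using n by (simp add: v_def sum_distrib_left)
    define b where "b l = (E (- v) - E v) + (E (unit_vec l) - E (- unit_vec l))" for l
    \<comment> \<open>differences of opposite values remove the even part of the polynomial\<close>
    have b_eq: "b l = 2 * ln n + 2 * (\<Sum>i<n. t i * v i) - 2 * t l" if "l < n" for l
      unfolding b_def E_def using odd_quadratic[of v] odd_quadratic[of "unit_vec l"] lin_e[OF that] f_e[of l] f_v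
      by linarith
    have "(\<Sum>l<n. b l) = (\<Sum>l<n. 2 * ln n + 2 * (\<Sum>i<n. t i * v i) - 2 * t l)"
      by (intro sum.cong) (auto simp: b_eq)
    also have "\<dots> = 2 * n * ln n + 2 * (n * (\<Sum>i<n. t i * v i)) - 2 * (\<Sum>l<n. t l)"
      by (simp only: sum_subtractf sum.distrib sum_constant card_lessThan sum_distrib_left[symmetric])
    also have "\<dots> = (\<Sum>l<n. 2 * ln n)"
      by (simp add: lin_v)
    finally have sum_b: "(\<Sum>l<n. b l) = (\<Sum>l<n. 2 * ln n)" .
    have "\<exists>l<n. 2 * ln n \<le> b l"
    proof (rule ccontr)
      assume "\<not> (\<exists>l<n. 2 * ln n \<le> b l)"
      then have "(\<Sum>l<n. b l) < (\<Sum>l<n. 2 * ln n)"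
        using n by (intro sum_strict_mono) (auto simp: not_le lessThan_empty_iff)
      then show False
        using sum_b by simp
    qed
    then obtain l where l: "l < n" "2 * ln n \<le> b l"
      by blast
    have "(\<Sum>i<n. \<bar>unit_vec l i\<bar>) = (\<Sum>i<n. if i = l then 1 else 0)"
      by (intro sum.cong) (auto simp: unit_vec_def)
    then have "lp_norm n 1 (unit_vec l) \<le> 1" "lp_norm n 1 v \<le> 1"
      using l(1) n by (simp_all add: N1 v_def)
    then have "unit_vec l \<in> unit_cball n (lp_norm n 1)" "- unit_vec l \<in> unit_cball n (lp_norm n 1)"
      "v \<in> unit_cball n (lp_norm n 1)" "- v \<in> unit_cball n (lp_norm n 1)"
      using real_space_unit_vec[OF l(1)] by (auto simp: unit_cball_def real_space_def v_def)
    moreover have "ln n / 2 \<le> \<bar>E v\<bar> \<or> ln n / 2 \<le> \<bar>E (- v)\<bar> \<or> ln n / 2 \<le> \<bar>E (unit_vec l)\<bar> \<or> ln n / 2 \<le> \<bar>E (- unit_vec l)\<bar>"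
      using l(2) unfolding b_def by linarith
    ultimately show "\<exists>x\<in>unit_cball n (lp_norm n 1). ln (real n) / 2 \<le> \<bar>f x - quadratic n a t q x\<bar>"
      unfolding E_def by blast
  qed (rule C(1))
qed

section \<open>Logarithmic bounds with absolute constants\<close>

lemma ln_2_ge_half: "1 / 2 \<le> ln (2::real)"
  using ln_le_minus_one[of "1 / 2 :: real"] by (simp add: ln_div)

lemma exists_two_power:
  assumes "1 \<le> n"
  obtains k :: nat where "n + 1 \<le> 2 ^ k" "real k \<le> 4 * ln (real n + 1)"
proof -
  define k where "k = nat \<lceil>log 2 (real n + 1)\<rceil>"
  have ge: "1 \<le> log 2 (real n + 1)"
    using assms by simp
  then have k: "log 2 (real n + 1) \<le> k" "k \<le> log 2 (real n + 1) + 1"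
    unfolding k_def by linarith+
  have "real n + 1 = 2 powr log 2 (real n + 1)"
    by simp
  also have "\<dots> \<le> 2 powr k"
    using k(1) by (intro powr_mono) auto
  also have "\<dots> = 2 ^ k"
    by (simp add: powr_realpow)
  finally have "real (n + 1) \<le> real (2 ^ k)"
    by simp
  then have 1: "n + 1 \<le> 2 ^ k"
    by (simp only: of_nat_le_iff)
  have "real k \<le> 2 * log 2 (real n + 1)"
    using k(2) ge by linarith
  also have "\<dots> = 2 * (ln (real n + 1) / ln 2)"
    by (simp add: log_def)
  also have "\<dots> \<le> 2 * (ln (real n + 1) / (1 / 2))"
    using ln_2_ge_half by (intro mult_left_mono divide_left_mono) auto
  finally show ?thesis
    using that[OF 1] by simp
qed

lemma whitney3_lp_upper:
  assumes n: "1 \<le> n" and p: "p = 1 \<or> 2 \<le> p"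
  shows "whitney3 n (lp_norm n p) \<le> ereal (10 ^ 8 * p * ln (real n + 1))"
proof -
  interpret coord_norm "lp_norm n p" n
    using p by (intro coord_norm_lp) auto
  define L where "L = ln (real n + 1)"
  obtain k where k: "n + 1 \<le> 2 ^ k" "real k \<le> 4 * L"
    using exists_two_power[OF n] unfolding L_def by blast
  have "ln 2 \<le> L"
    using n unfolding L_def by (subst ln_le_cancel_iff) auto
  then have L: "1 / 2 \<le> L"
    using ln_2_ge_half by linarith
  have p1: "1 \<le> p"
    using p by auto
  then have "1 * L \<le> p * L"
    using L by (intro mult_right_mono) auto
  then have kp: "real k \<le> 4 * (p * L)" "1 / 2 \<le> p * L"
    using k(2) L by linarith+
  have "\<exists>A\<ge>0. A \<le> 2240 * (p * L) \<and> approx_by_quadratic A"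
    using p
  proof
    assume p: "p = 1"
    have "approx_by_quadratic (140 * k)"
      using approx_by_quadratic_l1[of n k] k(1) p by simp
    moreover have "140 * real k \<le> 2240 * (p * L)"
      using kp by linarith
    ultimately show ?thesis
      by (intro exI[of _ "140 * real k"]) auto
  next
    assume p: "2 \<le> p"
    have "n * n + 1 \<le> (n + 1) * (n + 1)"
      by simp
    also have "\<dots> \<le> 2 ^ k * 2 ^ k"
      using k(1) by (intro mult_mono) auto
    also have "\<dots> = 2 ^ (2 * k)"
      by (simp add: power_add[symmetric] mult_2)
    finally have "approx_by_quadratic (280 * p * (2 * k))"
      using approx_by_quadratic_type2[OF lp_type2[OF p, of n], of "2 * k"] n by simp
    moreover have "280 * p * (2 * k) \<le> 2240 * (p * L)"
      using mult_left_mono[OF k(2), of p] p by simp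
    ultimately show ?thesis
      using p by (intro exI[of _ "280 * p * (2 * k)"]) auto
  qed
  then obtain A where A: "0 \<le> A" "A \<le> 2240 * (p * L)" "approx_by_quadratic A"
    by blast
  have "whitney3 n (lp_norm n p) \<le> ereal (2401 * (105 + 70 * real k + A / 2) + 400)"
    by (rule whitney3_upper[OF A(3,1) k(1)])
  also have "2401 * (105 + 70 * real k + A / 2) + 400 \<le> 10 ^ 8 * (p * L)"
    using A(2) kp by simp
  finally show ?thesis
    by (simp add: L_def mult.assoc)
qed

text \<open>Both the type 2 constant and the depth of the binary tree are of order \<open>ln n\<close>.\<close>

lemma whitney3_linf_upper:
  assumes n: "1 \<le> n"
  shows "whitney3 n (linf_norm n) \<le> ereal (10 ^ 8 * (ln (real n + 1))\<^sup>2)"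
proof -
  interpret coord_norm "linf_norm n" n
    by (rule coord_norm_linf[OF n])
  define L where "L = ln (real n + 1)"
  obtain k where k: "n + 1 \<le> 2 ^ k" "real k \<le> 4 * L"
    using exists_two_power[OF n] unfolding L_def by blast
  have "ln 2 \<le> L"
    using n unfolding L_def by (subst ln_le_cancel_iff) auto
  then have L: "1 / 2 \<le> L"
    using ln_2_ge_half by linarith
  have "L * (1 / 2) \<le> L * L"
    using L by (intro mult_left_mono) auto
  then have LL: "L \<le> 2 * L\<^sup>2" "1 \<le> 4 * L\<^sup>2"
    using L unfolding power2_eq_square by linarith+
  define T where "T = 9 * max 2 (ln (real n))"
  have "ln (real n) \<le> L"
    using n unfolding L_def by (subst ln_le_cancel_iff) auto
  then have T: "0 \<le> T" "T \<le> 36 * L"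
    using L by (auto simp: T_def)
  have "n * n + 1 \<le> (n + 1) * (n + 1)"
    by simp
  also have "\<dots> \<le> 2 ^ k * 2 ^ k"
    using k(1) by (intro mult_mono) auto
  also have "\<dots> = 2 ^ (2 * k)"
    by (simp add: power_add[symmetric] mult_2)
  finally have A: "approx_by_quadratic (280 * T * (2 * k))"
    using approx_by_quadratic_type2[OF linf_type2[OF n], of "2 * k"] n by (simp add: T_def)
  have "T * real k \<le> 36 * L * (4 * L)"
    using T k(2) L by (intro mult_mono) auto
  then have Tk: "T * real k \<le> 144 * L\<^sup>2"
    by (simp add: power2_eq_square)
  have "whitney3 n (linf_norm n) \<le> ereal (2401 * (105 + 70 * real k + 280 * T * (2 * k) / 2) + 400)"
    by (rule whitney3_upper[OF A _ k(1)]) (use T in simp)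
  also have "2401 * (105 + 70 * real k + 280 * T * (2 * k) / 2) + 400 \<le> 10 ^ 8 * L\<^sup>2"
    using Tk LL k(2) by simp
  finally show ?thesis
    by (simp add: L_def)
qed

text \<open>Among the powers of \<open>4\<close> up to \<open>n \<ge> 4\<close> the largest one is at least \<open>n / 4\<close>, so its logarithm
  is comparable to \<open>ln n\<close>.\<close>

lemma exists_four_power:
  assumes "4 \<le> n"
  obtains m :: nat where "1 \<le> m" "4 ^ m \<le> n" "ln (real n + 1) \<le> 2 * ln (real (4 ^ m))"
proof -
  obtain m where m: "4 ^ m \<le> n" "n < 4 ^ (m + 1)"
    using ex_power_ivl1[of 4 n] assms by auto
  have "m \<noteq> 0"
    using m(2) assms by (intro notI) simp
  then have m1: "1 \<le> m"
    by simp
  have "(4::nat) ^ 1 \<le> 4 ^ m"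
    using m1 by (intro power_increasing) auto
  then have "4 * 4 ^ m \<le> (4 ^ m * 4 ^ m :: nat)"
    by (intro mult_right_mono) auto
  moreover have "n + 1 \<le> 4 * 4 ^ m"
    using m(2) by simp
  ultimately have "n + 1 \<le> (4 ^ m)\<^sup>2"
    unfolding power2_eq_square by linarith
  then have "real n + 1 \<le> (real (4 ^ m))\<^sup>2"
    by (metis of_nat_1 of_nat_add of_nat_le_iff of_nat_power)
  then have "ln (real n + 1) \<le> ln ((real (4 ^ m))\<^sup>2)"
    by (subst ln_le_cancel_iff) auto
  also have "\<dots> = 2 * ln (real (4 ^ m))"
    by (rule ln_realpow[of _ 2, simplified])
  finally show ?thesis
    using that m1 m(1) by blast
qed

text \<open>For \<open>n < 4\<close> the bound \<open>1/27\<close> is enough, as \<open>ln (n + 1) \<le> 3\<close>; this is where \<open>1/81\<close> comes from.\<close>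

lemma whitney3_log_lower_bounds:
  obtains c :: real where "0 < c" "c < 1"
    "\<And>n p. 1 \<le> n \<Longrightarrow> p = 1 \<or> 2 \<le> p \<Longrightarrow> ereal (c * ln (real n + 1)) \<le> whitney3 n (lp_norm n p)"
    "\<And>n. 1 \<le> n \<Longrightarrow> ereal (c * ln (real n + 1)) \<le> whitney3 n (linf_norm n)"
proof -
  obtain C1 where C1: "0 < C1" "\<And>t h. \<bar>third_diff xlnx h t\<bar> \<le> C1 * \<bar>h\<bar>"
    using third_diff_xlnx by blast
  obtain C2 where C2: "0 < C2" "\<And>t h. \<bar>third_diff x2lnx h t\<bar> \<le> C2 * h\<^sup>2"
    using third_diff_x2lnx by blast
  define c where "c = min (1 / 81) (min (1 / (8 * C2)) (1 / (4 * C1)))"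
  have c: "0 < c" "c \<le> 1 / 81" "c \<le> 1 / (8 * C2)" "c \<le> 1 / (4 * C1)"
    using C1(1) C2(1) by (auto simp: c_def)
  have small: "c * ln (real n + 1) \<le> 1 / 27" if "n < 4" for n
  proof -
    have "c * ln (real n + 1) \<le> 1 / 81 * 3"
      using c(1,2) ln_le_minus_one[of "real n + 1"] that by (intro mult_mono) auto
    then show ?thesis
      by simp
  qed
  have large: "c * ln (real n + 1) \<le> ln (real (4 ^ m)) / (4 * C2)"
    if "ln (real n + 1) \<le> 2 * ln (real (4 ^ m))" for n m :: nat
  proof -
    have "c * ln (real n + 1) \<le> 1 / (8 * C2) * (2 * ln (real (4 ^ m)))"
      using c that C2(1) by (intro mult_mono) auto
    then show ?thesis
      by simp
  qed
  show ?thesis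
  proof (rule that[OF c(1)])
    show "c < 1"
      using c(2) by simp
    show "ereal (c * ln (real n + 1)) \<le> whitney3 n (linf_norm n)" if n: "1 \<le> n" for n
    proof (cases "n < 4")
      case True
      interpret coord_norm "linf_norm n" n
        by (rule coord_norm_linf[OF n])
      show ?thesis
        by (rule order_trans[OF _ whitney3_lower_constant[OF n]]) (simp only: ereal_less_eq(3) small[OF True])
    next
      case False
      then have "4 \<le> n"
        by simp
      then obtain m where m: "1 \<le> m" "4 ^ m \<le> n" "ln (real n + 1) \<le> 2 * ln (real (4 ^ m))"
        by (rule exists_four_power)
      show ?thesis
        by (rule order_trans[OF _ whitney3_linf_lower[OF refl m(2,1) C2]]) (simp only: ereal_less_eq(3) large[OF m(3)])
    qed
    show "ereal (c * ln (real n + 1)) \<le> whitney3 n (lp_norm n p)" if n: "1 \<le> n" and p: "p = 1 \<or> 2 \<le> p" for n p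
    proof -
      interpret coord_norm "lp_norm n p" n
        using p by (intro coord_norm_lp) auto
      consider "n < 4" | "4 \<le> n" "p = 1" | "4 \<le> n" "2 \<le> p"
        using p by linarith
      then show ?thesis
      proof cases
        case 1
        show ?thesis
          by (rule order_trans[OF _ whitney3_lower_constant[OF n]]) (simp only: ereal_less_eq(3) small[OF 1])
      next
        case 2
        have "4 * n \<le> n * n"
          using 2(1) by (rule mult_right_mono) simp
        then have "n + 1 \<le> n\<^sup>2"
          using 2(1) unfolding power2_eq_square by linarith
        then have "real n + 1 \<le> (real n)\<^sup>2"
          by (metis of_nat_1 of_nat_add of_nat_le_iff of_nat_power)
        then have "ln (real n + 1) \<le> ln ((real n)\<^sup>2)"
          using n by (subst ln_le_cancel_iff) auto
        also have "\<dots> = 2 * ln (real n)"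
          by (rule ln_realpow[of _ 2, simplified])
        finally have "c * ln (real n + 1) \<le> 1 / (4 * C1) * (2 * ln (real n))"
          using c C1(1) by (intro mult_mono) auto
        then have "c * ln (real n + 1) \<le> ln (real n) / 2 / C1"
          by simp
        then show ?thesis
          unfolding 2(2) by (intro order_trans[OF _ whitney3_l1_lower[OF n C1]]) (simp only: ereal_less_eq(3))
      next
        case 3
        obtain m where m: "1 \<le> m" "4 ^ m \<le> n" "ln (real n + 1) \<le> 2 * ln (real (4 ^ m))"
          by (rule exists_four_power[OF 3(1)])
        show ?thesis
          by (rule order_trans[OF _ whitney3_lp_lower[OF 3(2) refl m(2,1) C2]]) (simp only: ereal_less_eq(3) large[OF m(3)])
      qed
    qed
  qed
qed

theorem theorem4p3:
  "\<exists>c C :: real. 0 < c \<and> c < C \<and>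
     (\<forall>n :: nat. n \<ge> 1 \<longrightarrow>
        (\<forall>p :: real. p = 1 \<or> 2 \<le> p \<longrightarrow>
           ereal (c * ln (real n + 1)) \<le> whitney3 n (lp_norm n p) \<and>
           whitney3 n (lp_norm n p) \<le> ereal (C * p * ln (real n + 1))) \<and>
        ereal (c * ln (real n + 1)) \<le> whitney3 n (linf_norm n) \<and>
        whitney3 n (linf_norm n) \<le> ereal (C * (ln (real n + 1))\<^sup>2))"
proof -
  obtain c :: real where c: "0 < c" "c < 1"
    "\<And>n p. 1 \<le> n \<Longrightarrow> p = 1 \<or> 2 \<le> p \<Longrightarrow> ereal (c * ln (real n + 1)) \<le> whitney3 n (lp_norm n p)"
    "\<And>n. 1 \<le> n \<Longrightarrow> ereal (c * ln (real n + 1)) \<le> whitney3 n (linf_norm n)"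
    by (rule whitney3_log_lower_bounds) blast
  show ?thesis
    by (intro exI[of _ c] exI[of _ "10 ^ 8"] conjI allI impI c whitney3_lp_upper whitney3_linf_upper)
      (use c(2) in simp_all)
qed

end
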